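(* Let $\omega$ be a concave weight function. Then both rings ${}_1\mathcal{E}^{\{\omega\}}$ and ${}_1\mathcal{E}^{(\omega)}$ have property $(\mathscr{D})$.
   Context: A weight function is a continuous increasing $\omega:[0,\infty)\to[0,\infty)$ with $\omega(2t)=O(\omega(t))$, $\omega(t)=o(t)$, $\log t=o(\omega(t))$ as $t\to\infty$, and such that $\varphi_\omega(t):=\omega(e^t)$ is convex on $[0,\infty)$. Let $\varphi_\omega^*(s):=\sup_{t\ge0}(st-\varphi_\omega(t))$. For open $U\subseteq\mathbb{R}^d$ and $\rho>0$, $\mathcal{B}^\omega_\rho(U)$ is the set of $f\in C^\infty(U)$ with $\sup_{x\in U,\alpha\in\mathbb{N}^d}|\partial^\alpha f(x)|e^{-\varphi_\omega^*(\rho|\alpha|)/\rho}<\infty$. $\mathcal{E}^{\{\omega\}}(U)$ is the set of $f\in C^\infty(U)$ such that for every relatively compact open $V\subseteq U$ there is $n\in\mathbb{N}_{\ge1}$ with $f|_V\in\mathcal{B}^\omega_n(V)$; $\mathcal{E}^{(\omega)}(U)$ is the set of $f$ with $f|_V\in\mathcal{B}^\omega_{1/n}(V)$ for all such $V$ and all $n\ge1$. ${}_d\mathcal{E}^{\{\omega\}}$ (resp. ${}_d\mathcal{E}^{(\omega)}$) is the ring of germs at $0\in\mathbb{R}^d$ of complex valued functions of class $\mathcal{E}^{\{\omega\}}$ (resp. $\mathcal{E}^{(\omega)}$). A subring $\mathcal{S}$ of the ring of germs at $0\in\mathbb{R}^d$ of complex valued $C^\infty$ functions has property $(\mathscr{D})$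 if for every complex valued function germ $f$ at $0$: if $f^j,f^{j+1}\in\mathcal{S}$ for some integer $j\ge1$, then $f\in\mathcal{S}$. *)

theory Defs
  imports "HOL-Analysis.Analysis" "HOL-Library.Landau_Symbols"
begin

text \<open>Weight functions (Braun--Meise--Taylor), on [0,\<infinity>).\<close>
definition weight_function :: "(real \<Rightarrow> real) \<Rightarrow> bool" where
  "weight_function \<omega> \<longleftrightarrow>
     continuous_on {0..} \<omega> \<and> mono_on {0..} \<omega> \<and> (\<forall>t\<ge>0. \<omega> t \<ge> 0) \<and>
     (\<lambda>t. \<omega> (2 * t)) \<in> O[at_top](\<omega>) \<and>
     \<omega> \<in> o[at_top](\<lambda>t. t) \<and>
     (\<lambda>t. ln t) \<in> o[at_top](\<omega>) \<and>
     convex_on {0..} (\<lambda>t. \<omega> (exp t))"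

definition phi_w :: "(real \<Rightarrow> real) \<Rightarrow> real \<Rightarrow> real" where
  "phi_w \<omega> t = \<omega> (exp t)"

definition phi_w_star :: "(real \<Rightarrow> real) \<Rightarrow> real \<Rightarrow> real" where
  "phi_w_star \<omega> s = (SUP t\<in>{0..}. s * t - phi_w \<omega> t)"

definition derivs_on :: "real set \<Rightarrow> (real \<Rightarrow> complex) \<Rightarrow> (nat \<Rightarrow> real \<Rightarrow> complex) \<Rightarrow> bool" where
  "derivs_on U f D \<longleftrightarrow> (\<forall>x\<in>U. D 0 x = f x) \<and>
     (\<forall>n. \<forall>x\<in>U. (D n has_vector_derivative D (Suc n) x) (at x))"

definition smooth_on :: "real set \<Rightarrow> (real \<Rightarrow> complex) \<Rightarrow> bool" where
  "smooth_on U f \<longleftrightarrow> (\<exists>D. derivs_on U f D)"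

definition B_omega :: "(real \<Rightarrow> real) \<Rightarrow> real \<Rightarrow> real set \<Rightarrow> (real \<Rightarrow> complex) \<Rightarrow> bool" where
  "B_omega \<omega> \<rho> U f \<longleftrightarrow> (\<exists>D C. derivs_on U f D \<and>
     (\<forall>x\<in>U. \<forall>n. norm (D n x) * exp (- phi_w_star \<omega> (\<rho> * real n) / \<rho>) \<le> C))"

definition rel_compact_open_in :: "real set \<Rightarrow> real set \<Rightarrow> bool" where
  "rel_compact_open_in V U \<longleftrightarrow> open V \<and> V \<subseteq> U \<and> compact (closure V) \<and> closure V \<subseteq> U"

definition E_Roumieu :: "(real \<Rightarrow> real) \<Rightarrow> real set \<Rightarrow> (real \<Rightarrow> complex) \<Rightarrow> bool" where
  "E_Roumieu \<omega> U f \<longleftrightarrow> smooth_on U f \<and>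
     (\<forall>V. rel_compact_open_in V U \<longrightarrow> (\<exists>n::nat. n \<ge> 1 \<and> B_omega \<omega> (real n) V f))"

definition E_Beurling :: "(real \<Rightarrow> real) \<Rightarrow> real set \<Rightarrow> (real \<Rightarrow> complex) \<Rightarrow> bool" where
  "E_Beurling \<omega> U f \<longleftrightarrow> smooth_on U f \<and>
     (\<forall>V. rel_compact_open_in V U \<longrightarrow> (\<forall>n::nat. n \<ge> 1 \<longrightarrow> B_omega \<omega> (1 / real n) V f))"

text \<open>Germs at 0 in \<open>\<real>\<close>: a function represents a germ of the class iff it is of the
  class on some neighbourhood of 0 (membership only depends on the germ).\<close>
definition germ_Roumieu :: "(real \<Rightarrow> real) \<Rightarrow> (real \<Rightarrow> complex) \<Rightarrow> bool" where
  "germ_Roumieu \<omega> f \<longleftrightarrow> (\<exists>r>0. E_Roumieu \<omega> (ball 0 r) f)"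

definition germ_Beurling :: "(real \<Rightarrow> real) \<Rightarrow> (real \<Rightarrow> complex) \<Rightarrow> bool" where
  "germ_Beurling \<omega> f \<longleftrightarrow> (\<exists>r>0. E_Beurling \<omega> (ball 0 r) f)"

definition property_D :: "((real \<Rightarrow> complex) \<Rightarrow> bool) \<Rightarrow> bool" where
  "property_D S \<longleftrightarrow> (\<forall>f j. j \<ge> (1::nat) \<longrightarrow> S (\<lambda>x. f x ^ j) \<longrightarrow> S (\<lambda>x. f x ^ (j + 1)) \<longrightarrow> S f)"

end

theory Submission
  imports Defs "HOL-Complex_Analysis.Complex_Analysis"
begin

text \<open>
  The class is characterised by local holomorphic approximation: on the disc of radius \<open>\<epsilon>\<close> about a
  real point, Taylor polynomials of suitably chosen degree approximate a function of the class
  with error \<open>exp (- conj_weight (a * \<epsilon>) / b)\<close> and stay bounded; here concavity of \<open>\<omega>\<close> enters.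
  Conversely, by the two constants theorem and Cauchy's inequalities, such approximations force the
  derivative bounds, and a power of the error only changes the parameter \<open>b\<close>.

  Approximable functions form a ring, so \<open>f ^ j\<close> and \<open>f ^ (j + 1)\<close> give all high powers of \<open>f\<close>, and by
  descending one reduces to: if \<open>f\<^sup>2\<close> and \<open>f ^ 3\<close> are approximable, so is \<open>f\<close>. If \<open>G\<close> and \<open>H\<close>
  approximate \<open>f\<^sup>2\<close> and \<open>f ^ 3\<close>, then \<open>H\<^sup>2 - G ^ 3\<close> is tiny on the disc, and
  \<open>u = H * cnj G / ((norm G)\<^sup>2 + r\<^sup>2)\<close> is close to \<open>f\<close> on the real axis. It is nearly holomorphic:
  an energy estimate shows that its antiholomorphic derivative is small in the mean square, so the
  Cauchy integral of \<open>u\<close> is a holomorphic function close to \<open>u\<close>.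
\<close>

text \<open>The approximants cannot simply be divided: \<open>f\<close> may have zeros, and the
  zeros of \<open>G\<close> and \<open>H\<close> need not match, so \<open>H / G\<close> can be
  unbounded. Regularising by \<open>r\<^sup>2\<close> keeps the quotient bounded at the cost of
  holomorphy, and the repair must be quantitative, with exponents that do not depend on the position
  of the zeros. Nothing is assumed about the regularity of \<open>f\<close>, so its derivatives have
  to be constructed, as limits of derivatives of approximants on shrinking discs. The descent makes
  \<open>j * j\<close> passages from square and cube to the base, each replacing
  \<open>\<delta> \<epsilon>\<close> by \<open>\<delta> (32 * \<epsilon>) powr (1/96)\<close>. The
  dilation is paid for by the doubling property of \<open>\<omega>\<close>, the power by enlarging
  \<open>\<rho>\<close>. Neither loss depends on \<open>f\<close> or \<open>\<rho>\<close>, so the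
  net effect is a passage from \<open>\<rho>\<close> to \<open>\<Lambda> * \<rho>\<close> with
  \<open>\<Lambda>\<close> determined by \<open>\<omega>\<close> and \<open>j\<close>. A linear loss
  respects both "some parameter" and "every parameter", so one estimate serves both rings.\<close>

section \<open>The two constants theorem on a disc\<close>

text \<open>The real part \<open>(1 - s * Im z)\<^sup>2 - (Re z)\<^sup>2\<close> of \<open>(1 + \<i> * s * z)\<^sup>2\<close> is at most \<open>1\<close> on the diameter and
  nonpositive on the unit half circle, so it serves as a lower bound for harmonic measure.\<close>

lemma two_constants_half_disc:
  fixes G :: "complex \<Rightarrow> complex" and s :: real
  assumes hol: "G holomorphic_on ball 0 1"
    and bd: "\<And>z. z \<in> ball 0 1 \<Longrightarrow> norm (G z) \<le> K"
    and re: "\<And>x::real. \<bar>x\<bar> < 1 \<Longrightarrow> norm (G (of_real x)) \<le> K * \<eta>"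
    and \<eta>: "0 < \<eta>" "\<eta> \<le> 1" and s: "s\<^sup>2 = 1" and z: "norm z \<le> 1/4" "s * Im z \<ge> 0"
  shows "norm (G z) \<le> K * sqrt \<eta>"
proof -
  have K: "K \<ge> 0" using bd[of 0] norm_ge_zero[of "G 0"] by (simp del: norm_ge_zero)
  \<comment> \<open>The closed half disc must lie inside the open unit disc, so its radius is below
    1; \<open>8/9\<close> is still large enough for \<open>v z \<ge> 1/2\<close> on the disc of
    radius \<open>1/4\<close>.\<close>
  define \<rho> :: real where "\<rho> = 8/9"
  define c where "c = - ln \<eta>"
  have c0: "c \<ge> 0" using \<eta> by (simp add: c_def)
  have expc: "\<eta> * exp c = 1" using \<eta> by (simp add: c_def exp_minus)
  define v where "v = (\<lambda>z::complex. (1 - s * Im z / \<rho>)\<^sup>2 - (Re z / \<rho>)\<^sup>2)"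
  \<comment> \<open>The added factor has norm \<open>exp (c * v z)\<close>. On the diameter this is
    at most \<open>exp c\<close>, which cancels the small factor \<open>\<eta>\<close>; on the arc
    it is at most 1. Hence \<open>K\<close> bounds \<open>f\<close> on the frontier, and
    \<open>v z \<ge> 1/2\<close> inside gives back \<open>sqrt \<eta>\<close>.\<close>
  define f where "f = (\<lambda>z. G z * exp (of_real c * (1 + \<i> * of_real (s / \<rho>) * z)\<^sup>2))"
  have nf: "norm (f z) = norm (G z) * exp (c * v z)" for z
  proof -
    define a where "a = s / \<rho>"
    have "(a * Re z)\<^sup>2 = (Re z / \<rho>)\<^sup>2" "s * Im z / \<rho> = a * Im z"
      using s by (auto simp: a_def power_mult_distrib power_divide)
    moreover have "Re (of_real c * (1 + \<i> * of_real a * z)\<^sup>2) = c * ((1 - a * Im z)\<^sup>2 - (a * Re z)\<^sup>2)"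
      by (simp add: power2_eq_square algebra_simps)
    ultimately show ?thesis by (simp add: f_def norm_mult v_def flip: a_def)
  qed
  define S where "S = cball 0 \<rho> \<inter> {z. s * Im z \<ge> 0}"
  have clS: "closed S" unfolding S_def
    by (intro closed_Int closed_cball closed_Collect_le continuous_intros)
  have Ssub: "S \<subseteq> ball 0 1" unfolding S_def \<rho>_def by auto
  have holf: "f holomorphic_on ball 0 1" unfolding f_def by (intro holomorphic_intros hol)
  have zS: "z \<in> S" using z unfolding S_def \<rho>_def by simp
  have "norm (f z) \<le> K"
  proof (rule maximum_modulus_frontier[of f S])
    show "f holomorphic_on interior S"
      using holf Ssub interior_subset by (meson holomorphic_on_subset subset_trans)
    show "continuous_on (closure S) f"
      using clS holf Ssub by (metis closure_closed holomorphic_on_imp_continuous_on holomorphic_on_subset)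
    show "bounded S" unfolding S_def by (simp add: bounded_Int)
    show "z \<in> S" by (fact zS)
    fix w assume "w \<in> frontier S"
    then have wS: "w \<in> S" and wi: "w \<notin> interior S"
      using clS by (auto simp: frontier_def)
    have "w \<notin> ball 0 \<rho> \<inter> {z. s * Im z > 0}"
    proof
      assume "w \<in> ball 0 \<rho> \<inter> {z. s * Im z > 0}"
      moreover have "open (ball 0 \<rho> \<inter> {z. s * Im z > 0})"
        by (intro open_Int open_ball open_Collect_less continuous_intros)
      moreover have "ball 0 \<rho> \<inter> {z. s * Im z > 0} \<subseteq> S" unfolding S_def by auto
      ultimately show False using wi interior_maximal by blast
    qed
    then consider "norm w = \<rho>" "s * Im w \<ge> 0" | "Im w = 0" "norm w \<le> \<rho>"
      using wS s unfolding S_def by (cases "norm w = \<rho>") (auto simp: less_le)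
    then show "norm (f w) \<le> K"
    proof cases
      case 1
      have "(Re w)\<^sup>2 + (Im w)\<^sup>2 = \<rho>\<^sup>2" using 1 cmod_power2[of w] by simp
      then have e: "(Re w / \<rho>)\<^sup>2 = 1 - (s * Im w / \<rho>)\<^sup>2" using s
        by (simp add: power_divide power_mult_distrib \<rho>_def field_simps)
      have "s * Im w \<le> \<rho>" using 1 abs_Im_le_cmod[of w] s
        by (metis abs_le_D1 abs_mult abs_one mult_cancel_right1 power2_eq_1_iff real_sqrt_abs real_sqrt_one abs_minus_cancel)
      then have "s * Im w / \<rho> \<le> 1" "s * Im w / \<rho> \<ge> 0" using 1 by (auto simp: \<rho>_def)
      then have "(s * Im w / \<rho>) * (1 - s * Im w / \<rho>) \<ge> 0" by (intro mult_nonneg_nonneg) auto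
      moreover have "v w = -2 * ((s * Im w / \<rho>) * (1 - s * Im w / \<rho>))"
        unfolding v_def e by (simp only: power2_eq_square) algebra
      ultimately have "v w \<le> 0" by linarith
      then have "exp (c * v w) \<le> 1" using c0 by (simp add: mult_nonneg_nonpos)
      then show ?thesis unfolding nf using bd[of w] wS Ssub K
        by (metis mult_left_le norm_ge_zero order_trans subsetD)
    next
      case 2
      have w: "w = of_real (Re w)" using 2 by (simp add: complex_eq_iff)
      have "\<bar>Re w\<bar> < 1" using 2 abs_Re_le_cmod[of w] by (simp add: \<rho>_def)
      then have g: "norm (G w) \<le> K * \<eta>" using re[of "Re w"] w by simp
      have "v w \<le> 1" unfolding v_def using 2 by simp
      then have "exp (c * v w) \<le> exp c" using c0 by (simp add: mult_left_le)
      then have "norm (G w) * exp (c * v w) \<le> (K * \<eta>) * exp c"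
        using g by (intro mult_mono) (auto simp: K \<eta> less_imp_le)
      then show ?thesis unfolding nf using expc by (simp add: mult.assoc)
    qed
  qed
  have "v z \<ge> 1/2"
  proof -
    define y where "y = s * Im z"
    have y2: "y\<^sup>2 = (Im z)\<^sup>2" using s by (simp add: y_def power_mult_distrib)
    have n: "(Re z)\<^sup>2 + y\<^sup>2 \<le> 1/16" 
      using power_mono[OF z(1), of 2] unfolding cmod_power2 y2 by (simp add: power2_eq_square)
    have "y\<^sup>2 \<le> 1/16" using n zero_le_power2[of "Re z"] by linarith
    then have "y\<^sup>2 \<le> (1/4)\<^sup>2" by (simp add: power2_eq_square)
    then have "y \<le> 1/4" by (rule power2_le_imp_le) simp
    \<comment> \<open>With q(y) = (81/32) y^2 - (9/4) y, the part of \<open>v\<close> depending on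
      \<open>y\<close> once \<open>(Re z)\<^sup>2\<close> is eliminated by \<open>n\<close>, the
      product is q(y) - q(1/4).\<close>
    then have "(1/4 - y) * (9/4 - (81/32)*(1/4 + y)) \<ge> 0"
      by (intro mult_nonneg_nonneg) auto
    moreover have "(1/4 - y) * (9/4 - (81/32)*(1/4 + y)) = 9/16 - 81/512 - (9/4) * y + (81/32) * y\<^sup>2"
      by (simp add: power2_eq_square field_simps)
    ultimately have "1 - 2 * (y * (9/8)) + 2*(y\<^sup>2*(81/64)) - 81/64/16 \<ge> 1/2" by simp
    moreover have "v z = 1 - 2 * (y * (9/8)) + y\<^sup>2 *(81/64) - (Re z)\<^sup>2 *(81/64)"
      unfolding v_def y_def[symmetric] \<rho>_def by (simp add: power2_eq_square algebra_simps)
    ultimately show ?thesis using n by simp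
  qed
  then have "exp (c / 2) \<le> exp (c * v z)" using c0 by (simp add: mult_left_mono[of "1/2" "v z" c, simplified])
  then have "norm (G z) * exp (c / 2) \<le> K"
    using \<open>norm (f z) \<le> K\<close> unfolding nf by (smt (verit) mult_left_mono norm_ge_zero)
  moreover have "exp (c / 2) = 1 / sqrt \<eta>"
    using \<eta> by (simp add: c_def exp_minus powr_half_sqrt[symmetric] powr_def field_simps)
  ultimately show ?thesis using \<eta> by (simp add: field_simps)
qed

text \<open>An affine change to the unit disc, with \<open>s\<close> the sign of the half plane
  containing the point. Smallness on the real diameter spreads into the complex disc at the price of
  a square root and of three quarters of the radius.\<close>

lemma two_constants:
  fixes G :: "complex \<Rightarrow> complex" and x \<epsilon> :: real
  assumes hol: "G holomorphic_on ball (of_real x) \<epsilon>" and \<epsilon>: "\<epsilon> > 0"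
    and bd: "\<And>z. z \<in> ball (of_real x) \<epsilon> \<Longrightarrow> norm (G z) \<le> K"
    and re: "\<And>y::real. \<bar>y - x\<bar> < \<epsilon> \<Longrightarrow> norm (G (of_real y)) \<le> K * \<eta>"
    and \<eta>: "0 < \<eta>" "\<eta> \<le> 1" and z: "z \<in> cball (of_real x) (\<epsilon> / 4)"
  shows "norm (G z) \<le> K * sqrt \<eta>"
proof -
  define A where "A = (\<lambda>w::complex. of_real x + of_real \<epsilon> * w)"
  define w where "w = (z - of_real x) / of_real \<epsilon>"
  have Aw: "A w = z" using \<epsilon> by (simp add: A_def w_def)
  have A: "A u \<in> ball (of_real x) \<epsilon>" if "u \<in> ball 0 1" for u
    using that \<epsilon> by (simp add: A_def dist_norm norm_mult)
  have holA: "(G \<circ> A) holomorphic_on ball 0 1"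
    by (rule holomorphic_on_compose_gen[OF _ hol]) (auto simp: A_def intro!: holomorphic_intros A[unfolded A_def])
  have w4: "norm w \<le> 1/4" using z \<epsilon> by (simp add: w_def dist_norm norm_divide norm_minus_commute field_simps)
  have reA: "norm ((G \<circ> A) (of_real u)) \<le> K * \<eta>" if "\<bar>u\<bar> < 1" for u :: real
    using re[of "x + \<epsilon> * u"] that \<epsilon> by (simp add: A_def abs_mult)
  define s :: real where "s = (if Im w \<ge> 0 then 1 else -1)"
  have "norm ((G \<circ> A) w) \<le> K * sqrt \<eta>"
    by (rule two_constants_half_disc[OF holA _ reA \<eta>, of s]) (use A bd w4 in \<open>auto simp: s_def\<close>)
  then show ?thesis by (simp add: Aw)
qed

section \<open>Green's formula in Wirtinger form\<close>

text \<open>\<open>P\<close> and \<open>Q\<close> are the Wirtinger derivatives with respect to z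
  and its conjugate, read off from the complex linear and antilinear parts of the real derivative;
  \<open>Q = 0\<close> is the Cauchy-Riemann equation.\<close>

definition has_wirtinger :: "(complex \<Rightarrow> complex) \<Rightarrow> complex \<Rightarrow> complex \<Rightarrow> complex \<Rightarrow> bool" where
  "has_wirtinger f P Q z \<longleftrightarrow> (f has_derivative (\<lambda>h. P * h + Q * cnj h)) (at z)"

lemma has_wirtinger_holomorphic:
  assumes "(f has_field_derivative P) (at z)" shows "has_wirtinger f P 0 z"
  using assms by (simp add: has_wirtinger_def has_field_derivative_def mult_commute_abs)

lemma has_wirtinger_const: "has_wirtinger (\<lambda>_. c) 0 0 z"
  by (simp add: has_wirtinger_def)

lemma has_wirtinger_cnj:
  assumes "has_wirtinger f P Q z" shows "has_wirtinger (\<lambda>z. cnj (f z)) (cnj Q) (cnj P) z"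
proof -
  have "((\<lambda>z. cnj (f z)) has_derivative (\<lambda>h. cnj (P * h + Q * cnj h))) (at z)"
    by (rule has_derivative_cnj) (use assms in \<open>simp add: has_wirtinger_def\<close>)
  then show ?thesis by (simp add: has_wirtinger_def add.commute)
qed

lemma has_wirtinger_add:
  assumes "has_wirtinger f P Q z" "has_wirtinger g R T z"
  shows "has_wirtinger (\<lambda>z. f z + g z) (P + R) (Q + T) z"
  using has_derivative_add[OF assms[unfolded has_wirtinger_def]]
  by (simp add: has_wirtinger_def algebra_simps)

lemma has_wirtinger_diff:
  assumes "has_wirtinger f P Q z" "has_wirtinger g R T z"
  shows "has_wirtinger (\<lambda>z. f z - g z) (P - R) (Q - T) z"
  using has_derivative_diff[OF assms[unfolded has_wirtinger_def]]
  by (simp add: has_wirtinger_def algebra_simps)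

lemma has_wirtinger_mult:
  assumes "has_wirtinger f P Q z" "has_wirtinger g R T z"
  shows "has_wirtinger (\<lambda>z. f z * g z) (P * g z + f z * R) (Q * g z + f z * T) z"
  using has_derivative_mult[OF assms[unfolded has_wirtinger_def]]
  by (simp add: has_wirtinger_def algebra_simps)

lemma has_wirtinger_of_real_comp:
  assumes "has_wirtinger (\<lambda>z. of_real (N z)) P Q z" "(\<theta> has_real_derivative d) (at (N z))"
  shows "has_wirtinger (\<lambda>z. of_real (\<theta> (N z))) (of_real d * P) (of_real d * Q) z"
proof -
  have "(N has_derivative (\<lambda>h. Re (P * h + Q * cnj h))) (at z)"
    using has_derivative_Re[OF assms(1)[unfolded has_wirtinger_def]] by simp
  \<comment> \<open>\<open>N\<close> is real valued, so the imaginary part of its derivative is the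
    derivative of 0; this makes \<open>P * h + Q * cnj h\<close> real for every
    \<open>h\<close>.\<close>
  moreover have N: "of_real (Re (P * h + Q * cnj h)) = P * h + Q * cnj h" for h
  proof -
    have "((\<lambda>z. 0::real) has_derivative (\<lambda>h. Im (P * h + Q * cnj h))) (at z)"
      using has_derivative_Im[OF assms(1)[unfolded has_wirtinger_def]] by simp
    then have "(\<lambda>h. Im (P * h + Q * cnj h)) = (\<lambda>h. 0)"
      using has_derivative_unique has_derivative_const by blast
    then have "Im (P * h + Q * cnj h) = 0" by metis
    then show ?thesis by (simp add: complex_eq_iff)
  qed
  ultimately have "((\<lambda>z. \<theta> (N z)) has_derivative (\<lambda>h. d * Re (P * h + Q * cnj h))) (at z)"
    using has_derivative_compose[of N _ z UNIV \<theta> "(*) d"] assms(2) unfolding has_field_derivative_def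
    by simp
  from has_derivative_of_real[OF this, where 'a=complex] 
  have "((\<lambda>z. complex_of_real (\<theta> (N z))) has_derivative (\<lambda>h. of_real d * (P * h + Q * cnj h))) (at z)"
    using N by (simp del: complex_cnj_mult)
  then show ?thesis unfolding has_wirtinger_def by (simp add: algebra_simps)
qed

lemma has_wirtinger_inverse_of_real:
  assumes "has_wirtinger (\<lambda>z. of_real (N z)) P Q z" "N z \<noteq> 0"
  shows "has_wirtinger (\<lambda>z. 1 / of_real (N z)) (- P / (of_real (N z))\<^sup>2) (- Q / (of_real (N z))\<^sup>2) z"
proof -
  have "((\<lambda>x. 1 / x) has_real_derivative - 1 / (N z)\<^sup>2) (at (N z))"
    using assms(2) by (auto intro!: derivative_eq_intros simp: power2_eq_square)
  from has_wirtinger_of_real_comp[OF assms(1) this] show ?thesis by simp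
qed

text \<open>The domain is a box of real pairs and not of complex numbers, so that the Fubini
  theorems for continuous functions on products apply; \<open>sq\<close> is the same square seen in
  the plane.\<close>

definition sq_integral :: "real \<Rightarrow> (complex \<Rightarrow> 'a::banach) \<Rightarrow> 'a" where
  "sq_integral s f = integral (cbox (-s, -s) (s, s)) (\<lambda>(x, y). f (Complex x y))"

abbreviation sq :: "real \<Rightarrow> complex set" where
  "sq s \<equiv> cbox (Complex (-s) (-s)) (Complex s s)"

lemma continuous_on_Complex_pair: "continuous_on S (\<lambda>p::real\<times>real. Complex (fst p) (snd p))"
  unfolding Complex_eq by (intro continuous_intros)

lemma continuous_on_sq_pair:
  assumes "continuous_on (sq s) f"
  shows "continuous_on (cbox (-s, -s) (s, s)) (\<lambda>(x, y). f (Complex x y))"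
  unfolding case_prod_unfold
  by (rule continuous_on_compose2[OF assms continuous_on_Complex_pair])
     (auto simp: in_cbox_complex_iff cbox_Pair_eq)

lemma sq_integrable:
  assumes "continuous_on (sq s) (f :: complex \<Rightarrow> 'a::banach)"
  shows "(\<lambda>(x, y). f (Complex x y)) integrable_on cbox (-s, -s) (s, s)"
  by (rule integrable_continuous[OF continuous_on_sq_pair[OF assms]])

lemma sq_integral_add:
  assumes "continuous_on (sq s) f" "continuous_on (sq s) g"
  shows "sq_integral s (\<lambda>z. f z + g z) = sq_integral s f + sq_integral s (g :: complex \<Rightarrow> 'a::banach)"
  using integral_add[OF sq_integrable[OF assms(1)] sq_integrable[OF assms(2)]]
  by (simp add: sq_integral_def case_prod_unfold)

lemma sq_integral_cmult:
  "sq_integral s (\<lambda>z. c * f z) = c * sq_integral s (f :: complex \<Rightarrow> real)"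
  by (simp add: sq_integral_def case_prod_unfold)

lemma sq_integral_mono:
  assumes "continuous_on (sq s) f" "continuous_on (sq s) g" "\<And>z. z \<in> sq s \<Longrightarrow> f z \<le> (g z :: real)"
  shows "sq_integral s f \<le> sq_integral s g"
  unfolding sq_integral_def
  by (intro integral_le sq_integrable assms(1,2)) (auto intro!: assms(3) simp: cbox_Pair_eq in_cbox_complex_iff)

lemma norm_sq_integral_le:
  fixes f :: "complex \<Rightarrow> 'a::{euclidean_space}"
  assumes "continuous_on (sq s) f" "continuous_on (sq s) g" "\<And>z. z \<in> sq s \<Longrightarrow> norm (f z) \<le> g z"
  shows "norm (sq_integral s f) \<le> sq_integral s g"
  unfolding sq_integral_def
  by (intro integral_norm_bound_integral sq_integrable assms(1,2)) (auto intro!: assms(3) simp: cbox_Pair_eq in_cbox_complex_iff)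

lemma sq_integral_const: "s \<ge> 0 \<Longrightarrow> sq_integral s (\<lambda>_. c::real) = 4 * s\<^sup>2 * c"
  by (simp add: sq_integral_def case_prod_unfold content_Pair power2_eq_square)

lemma sq_integral_mono_set:
  assumes "s \<le> t" "continuous_on (sq t) f" "\<And>z. z \<in> sq t \<Longrightarrow> (f z :: real) \<ge> 0"
  shows "sq_integral s f \<le> sq_integral t f"
proof -
  have "continuous_on (sq s) f"
    by (rule continuous_on_subset[OF assms(2)]) (use assms(1) in \<open>auto simp: in_cbox_complex_iff\<close>)
  then show ?thesis
  unfolding sq_integral_def
    by (intro integral_subset_le sq_integrable assms(2))
     (use assms(1) in \<open>auto intro!: assms(3) simp: cbox_Pair_eq in_cbox_complex_iff\<close>)
qed

lemma contour_integral_linepath_horizontal: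
  assumes "a < b" "continuous_on (closed_segment (Complex a c) (Complex b c)) f"
  shows "contour_integral (linepath (Complex a c) (Complex b c)) f = integral {a..b} (\<lambda>x. f (Complex x c))"
proof -
  define g where "g = (\<lambda>x. f (Complex x c))"
  have "continuous_on {a..b} g" unfolding g_def
    by (rule continuous_on_compose2[OF assms(2)])
       (auto simp: closed_segment_same_Im closed_segment_eq_real_ivl Complex_eq intro!: continuous_intros)
  then have "(g has_integral integral {a..b} g) (cbox a b)"
    by (simp add: integrable_continuous_interval integrable_integral)
  from has_integral_affinity'[OF this, of "b - a" a] assms(1)
  have "integral {0..1} (\<lambda>x. g ((b - a) * x + a)) = integral {a..b} g / of_real (b - a)"
    by (simp add: integral_unique scaleR_conv_of_real divide_inverse mult.commute)
  moreover have "f (linepath (Complex a c) (Complex b c) x) = g ((b - a) * x + a)" for x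
  proof -
    have "linepath (Complex a c) (Complex b c) x = Complex ((b - a) * x + a) c"
      by (simp add: linepath_def complex_eq_iff algebra_simps)
    then show ?thesis by (simp add: g_def)
  qed
  moreover have "Complex b c - Complex a c = of_real (b - a)" by (simp add: complex_eq_iff)
  ultimately show ?thesis
    unfolding contour_integral_integral g_def[symmetric] using assms(1)
    by (simp add: vector_derivative_linepath_within[of _] g_def)
qed

text \<open>The partial derivatives of \<open>\<psi>\<close> in x and y are \<open>P + Q\<close> and
  \<open>\<i> * (P - Q)\<close>. Integrating them by the fundamental theorem along horizontal and
  vertical lines, with Fubini in both orders, produces the four sides, and
  \<open>2 * \<i> * Q\<close> is \<open>\<i>\<close> times the first minus the second.\<close>

theorem green_rectpath:
  assumes s: "s > 0"
    and w: "\<And>z. z \<in> sq s \<Longrightarrow> has_wirtinger \<psi> (P z) (Q z) z"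
    and cP: "continuous_on (sq s) P" and cQ: "continuous_on (sq s) Q"
  shows "contour_integral (rectpath (Complex (-s) (-s)) (Complex s s)) \<psi> = 2 * \<i> * sq_integral s Q"
    and "\<psi> contour_integrable_on (rectpath (Complex (-s) (-s)) (Complex s s))"
proof -
  have c\<psi>: "continuous_on (sq s) \<psi>"
    using w unfolding has_wirtinger_def
    by (meson continuous_at_imp_continuous_on has_derivative_continuous)
  let ?a = "Complex (-s) (-s)" and ?b = "Complex s (-s)" and ?c = "Complex s s" and ?d = "Complex (-s) s"
  have seg: "closed_segment u v \<subseteq> sq s" if "u \<in> sq s" "v \<in> sq s" for u v
    using that convex_box(1) by (simp add: closed_segment_subset)
  have int: "\<psi> contour_integrable_on linepath u v" if "u \<in> sq s" "v \<in> sq s" for u v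
    by (rule contour_integrable_continuous_linepath) (rule continuous_on_subset[OF c\<psi> seg[OF that]])
  have corners: "?a \<in> sq s" "?b \<in> sq s" "?c \<in> sq s" "?d \<in> sq s"
    using s by (auto simp: in_cbox_complex_iff)
  show "\<psi> contour_integrable_on (rectpath ?a ?c)"
    unfolding rectpath_def Let_def using int corners by (simp add: contour_integrable_join)
  have hs: "((\<lambda>x. \<psi> (Complex x y)) has_vector_derivative (P (Complex x y) + Q (Complex x y))) (at x within A)"
    if "x \<in> {-s..s}" "y \<in> {-s..s}" for x y A
  proof -
    have "((\<lambda>x. Complex x y) has_derivative (\<lambda>h. of_real h)) (at x within A)"
      unfolding Complex_eq by (auto intro!: derivative_eq_intros)
    from has_derivative_compose[OF this w[unfolded has_wirtinger_def]] show ?thesis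
      using that unfolding has_vector_derivative_def
      by (simp add: in_cbox_complex_iff algebra_simps scaleR_conv_of_real)
  qed
  have vs: "((\<lambda>y. \<psi> (Complex x y)) has_vector_derivative (\<i> * (P (Complex x y) - Q (Complex x y)))) (at y within A)"
    if "x \<in> {-s..s}" "y \<in> {-s..s}" for x y A
  proof -
    have "((\<lambda>y. Complex x y) has_derivative (\<lambda>h. \<i> * of_real h)) (at y within A)"
      unfolding Complex_eq by (auto intro!: derivative_eq_intros)
    from has_derivative_compose[OF this w[unfolded has_wirtinger_def]] show ?thesis
      using that unfolding has_vector_derivative_def
      by (simp add: in_cbox_complex_iff algebra_simps scaleR_conv_of_real)
  qed
  have H: "integral {-s..s} (\<lambda>x. P (Complex x y) + Q (Complex x y)) = \<psi> (Complex s y) - \<psi> (Complex (-s) y)"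
    if "y \<in> {-s..s}" for y
    by (rule integral_unique, rule fundamental_theorem_of_calculus) (use s hs that in auto)
  have V: "integral {-s..s} (\<lambda>y. \<i> * (P (Complex x y) - Q (Complex x y))) = \<psi> (Complex x s) - \<psi> (Complex x (-s))"
    if "x \<in> {-s..s}" for x
    by (rule integral_unique, rule fundamental_theorem_of_calculus) (use s vs that in auto)
  have cadd: "continuous_on (sq s) (\<lambda>z. P z + Q z)" and csub: "continuous_on (sq s) (\<lambda>z. \<i> * (P z - Q z))"
    by (intro continuous_intros cP cQ)+
  have "sq_integral s (\<lambda>z. P z + Q z) = integral {-s..s} (\<lambda>x. integral {-s..s} (\<lambda>y. P (Complex x y) + Q (Complex x y)))"
    unfolding sq_integral_def using integral_prod_continuous[OF continuous_on_sq_pair[OF cadd]] by simp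
  also have "\<dots> = integral {-s..s} (\<lambda>y. integral {-s..s} (\<lambda>x. P (Complex x y) + Q (Complex x y)))"
    using integral_swap_continuous[OF continuous_on_sq_pair[OF cadd]] by simp
  also have "\<dots> = integral {-s..s} (\<lambda>y. \<psi> (Complex s y) - \<psi> (Complex (-s) y))"
    by (rule integral_cong) (rule H)
  finally have 1: "sq_integral s (\<lambda>z. P z + Q z) = integral {-s..s} (\<lambda>y. \<psi> (Complex s y) - \<psi> (Complex (-s) y))" .
  have "sq_integral s (\<lambda>z. \<i> * (P z - Q z)) = integral {-s..s} (\<lambda>x. integral {-s..s} (\<lambda>y. \<i> * (P (Complex x y) - Q (Complex x y))))"
    unfolding sq_integral_def using integral_prod_continuous[OF continuous_on_sq_pair[OF csub]] by simp
  also have "\<dots> = integral {-s..s} (\<lambda>x. \<psi> (Complex x s) - \<psi> (Complex x (-s)))"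
    by (rule integral_cong) (rule V)
  finally have 2: "sq_integral s (\<lambda>z. \<i> * (P z - Q z)) = integral {-s..s} (\<lambda>x. \<psi> (Complex x s) - \<psi> (Complex x (-s)))" .
  have cont1: "continuous_on {-s..s} (\<lambda>x. \<psi> (Complex x y))" "continuous_on {-s..s} (\<lambda>x. \<psi> (Complex y x))" if "y \<in> {-s..s}" for y
    by (rule continuous_on_compose2[OF c\<psi>]; use that in \<open>auto simp: Complex_eq in_cbox_complex_iff intro!: continuous_intros\<close>)+
  have i1: "integral {-s..s} (\<lambda>y. \<psi> (Complex s y) - \<psi> (Complex (-s) y)) = integral {-s..s} (\<lambda>y. \<psi> (Complex s y)) - integral {-s..s} (\<lambda>y. \<psi> (Complex (-s) y))"
    by (rule integral_diff; rule integrable_continuous_interval; rule cont1) (use s in auto)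
  have i2: "integral {-s..s} (\<lambda>x. \<psi> (Complex x s) - \<psi> (Complex x (-s))) = integral {-s..s} (\<lambda>y. \<psi> (Complex y s)) - integral {-s..s} (\<lambda>y. \<psi> (Complex y (-s)))"
    by (rule integral_diff; rule integrable_continuous_interval; rule cont1) (use s in auto)
  have eq: "(\<lambda>z. 2 * \<i> * Q z) = (\<lambda>z. \<i> * (P z + Q z) + (-1) * (\<i> * (P z - Q z)))"
    by (auto simp: algebra_simps)
  have "2 * \<i> * sq_integral s Q = sq_integral s (\<lambda>z. 2 * \<i> * Q z)"
    by (simp add: sq_integral_def case_prod_unfold)
  also have "\<dots> = \<i> * sq_integral s (\<lambda>z. P z + Q z) - sq_integral s (\<lambda>z. \<i> * (P z - Q z))"
  proof -
    have "sq_integral s (\<lambda>z. 2 * \<i> * Q z) = sq_integral s (\<lambda>z. \<i> * (P z + Q z)) + sq_integral s (\<lambda>z. (-1) * (\<i> * (P z - Q z)))"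
      unfolding eq by (rule sq_integral_add) (intro continuous_intros cP cQ)+
    then show ?thesis by (simp add: sq_integral_def case_prod_unfold)
  qed
  finally have Q: "2 * \<i> * sq_integral s Q = \<i> * (integral {-s..s} (\<lambda>y. \<psi> (Complex s y)) - integral {-s..s} (\<lambda>y. \<psi> (Complex (-s) y)))
     - (integral {-s..s} (\<lambda>y. \<psi> (Complex y s)) - integral {-s..s} (\<lambda>y. \<psi> (Complex y (-s))))"
    unfolding 1 2 i1 i2 .
  have "contour_integral (rectpath ?a ?c) \<psi> = contour_integral (linepath ?a ?b) \<psi> + (contour_integral (linepath ?b ?c) \<psi>
     + (contour_integral (linepath ?c ?d) \<psi> + contour_integral (linepath ?d ?a) \<psi>))"
    unfolding rectpath_def Let_def using int corners by (simp add: contour_integrable_join)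
  also have "contour_integral (linepath ?c ?d) \<psi> = - contour_integral (linepath ?d ?c) \<psi>"
    by (rule contour_integral_reverse_linepath) (rule continuous_on_subset[OF c\<psi> seg[OF corners(3,4)]])
  also have "contour_integral (linepath ?d ?a) \<psi> = - contour_integral (linepath ?a ?d) \<psi>"
    by (rule contour_integral_reverse_linepath) (rule continuous_on_subset[OF c\<psi> seg[OF corners(4,1)]])
  also have "contour_integral (linepath ?a ?b) \<psi> = integral {-s..s} (\<lambda>x. \<psi> (Complex x (-s)))"
    by (rule contour_integral_linepath_horizontal) (use s continuous_on_subset[OF c\<psi> seg[OF corners(1,2)]] in auto)
  also have "contour_integral (linepath ?b ?c) \<psi> = \<i> * integral {-s..s} (\<lambda>x. \<psi> (Complex s x))"
    by (rule contour_integral_linepath_same_Re) (use s in auto)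
  also have "contour_integral (linepath ?d ?c) \<psi> = integral {-s..s} (\<lambda>x. \<psi> (Complex x s))"
    by (rule contour_integral_linepath_horizontal) (use s continuous_on_subset[OF c\<psi> seg[OF corners(4,3)]] in auto)
  also have "contour_integral (linepath ?a ?d) \<psi> = \<i> * integral {-s..s} (\<lambda>x. \<psi> (Complex (-s) x))"
    by (rule contour_integral_linepath_same_Re) (use s in auto)
  finally show "contour_integral (rectpath ?a ?c) \<psi> = 2 * \<i> * sq_integral s Q"
    unfolding Q by (simp add: algebra_simps)
qed

section \<open>The Cauchy--Pompeiu estimate\<close>

text \<open>The integrand is dominated by the power \<open>-3/4\<close> of the distance to
  \<open>c\<close>, whose integral over a unit interval starting at \<open>c\<close> is 4, and the
  shifted interval lies in \<open>{-1..1}\<close>. The bound is therefore uniform in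
  \<open>t\<close> and \<open>c\<close>.\<close>

lemma integral_power_singularity_le:
  fixes t c :: real
  assumes t: "t > 0" and c: "\<bar>c\<bar> \<le> 1/2"
  shows "integral {-1/2..1/2} (\<lambda>x. ((x - c)\<^sup>2 + t\<^sup>2) powr (-3/8)) \<le> 8"
proof -
  define \<theta> where "\<theta> = (\<lambda>x::real. (x\<^sup>2 + t\<^sup>2) powr (-3/8))"
  have pos: "x\<^sup>2 + t\<^sup>2 > 0" for x :: real using t by (simp add: add_nonneg_pos)
  have cont: "continuous_on A \<theta>" for A
    unfolding \<theta>_def by (intro continuous_intros) (use pos in \<open>auto simp: less_imp_neq[symmetric]\<close>)
  have int: "\<theta> integrable_on {a..b}" for a b by (rule integrable_continuous_interval[OF cont])
  have "integral {-1/2..1/2} (\<lambda>x. \<theta> (x - c)) = integral {-1/2 - c..1/2 - c} \<theta>"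
    using integral_shift_real_ivl[of "-1/2" c "1/2" "\<lambda>x. \<theta> (x - c)"] by simp
  also have "\<dots> \<le> integral {-1..1} \<theta>"
    by (rule integral_subset_le) (use c int in \<open>auto simp: \<theta>_def\<close>)
  also have "\<dots> = integral {-1..0} \<theta> + integral {0..1} \<theta>"
    by (rule Henstock_Kurzweil_Integration.integral_combine[symmetric]) (use int in auto)
  also have "integral {-1..0} \<theta> = integral {0..1} \<theta>"
    using Henstock_Kurzweil_Integration.integral_reflect_real[of 1 0 \<theta>] by (simp add: \<theta>_def)
  also have "integral {0..1} \<theta> \<le> 4"
  proof -
    have "((\<lambda>x. x powr (-3/4)) has_integral 4) {0..1::real}"
      using has_integral_powr_from_0[of "-3/4" 1] by simp
    \<comment> \<open>\<open>0 powr (-3/4)\<close> is 0, so the pointwise comparison would fail at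
      0; the value there is changed, which the integral does not see.\<close>
    then have h: "((\<lambda>x. if x = 0 then \<theta> 0 else x powr (-3/4)) has_integral 4) {0..1}"
      by (rule has_integral_spike_finite[of "{0}", rotated 2]) auto
    show ?thesis
    proof (rule has_integral_le[OF integrable_integral[OF int] h])
      fix x :: real assume x: "x \<in> {0..1}"
      show "\<theta> x \<le> (if x = 0 then \<theta> 0 else x powr (-3/4))"
      proof (cases "x = 0")
        case False
        then have x0: "x > 0" using x by simp
        have "\<theta> x \<le> (x\<^sup>2) powr (-3/8)"
          unfolding \<theta>_def by (rule powr_mono2') (use x0 in auto)
        also have "(x\<^sup>2) powr (-3/8) = x powr (-3/4)"
          using x0 by (simp add: powr_powr flip: powr_numeral)
        finally show ?thesis using False by simp
      qed simp
    qed
  qed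
  finally show ?thesis by (simp add: \<theta>_def)
qed

text \<open>Giving one \<open>t\<^sup>2\<close> to each coordinate and using
  \<open>a * b \<le> (a + b)\<^sup>2\<close> bounds the planar singularity, of order -3/2 in the
  distance, by a product of integrable one-variable singularities. This is why the regularisation is
  \<open>2 * t\<^sup>2\<close>.\<close>

lemma sq_integral_singularity_le:
  assumes t: "t > 0" and z: "\<bar>Re z\<bar> \<le> 1/2" "\<bar>Im z\<bar> \<le> 1/2"
  shows "sq_integral (1/2) (\<lambda>\<zeta>. ((norm (\<zeta> - z))\<^sup>2 + 2 * t\<^sup>2) powr (-3/4)) \<le> 64"
proof -
  define \<theta> where "\<theta> = (\<lambda>x::real. (x\<^sup>2 + t\<^sup>2) powr (-3/8))"
  have pos: "x\<^sup>2 + t\<^sup>2 > 0" for x :: real using t by (simp add: add_nonneg_pos)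
  have pos2: "x\<^sup>2 + 2 * t\<^sup>2 > 0" for x :: real using t by (simp add: add_nonneg_pos)
  have cont: "continuous_on A \<theta>" for A
    unfolding \<theta>_def by (intro continuous_intros) (use pos in \<open>auto simp: less_imp_neq[symmetric]\<close>)
  have c1: "continuous_on A (\<lambda>\<zeta>. \<theta> (Re \<zeta> - Re z) * \<theta> (Im \<zeta> - Im z))" for A
    unfolding \<theta>_def by (intro continuous_intros) (use pos in \<open>auto simp: less_imp_neq[symmetric]\<close>)
  have c2: "continuous_on A (\<lambda>\<zeta>. ((norm (\<zeta> - z))\<^sup>2 + 2 * t\<^sup>2) powr (-3/4))" for A
    by (intro continuous_intros) (use pos2 in \<open>auto simp: less_imp_neq[symmetric]\<close>)
  have "sq_integral (1/2) (\<lambda>\<zeta>. ((norm (\<zeta> - z))\<^sup>2 + 2 * t\<^sup>2) powr (-3/4))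
      \<le> sq_integral (1/2) (\<lambda>\<zeta>. \<theta> (Re \<zeta> - Re z) * \<theta> (Im \<zeta> - Im z))"
  proof (rule sq_integral_mono[OF c2 c1])
    fix \<zeta>
    define a where "a = (Re \<zeta> - Re z)\<^sup>2 + t\<^sup>2"
    define b where "b = (Im \<zeta> - Im z)\<^sup>2 + t\<^sup>2"
    have ab: "a > 0" "b > 0" using pos by (auto simp: a_def b_def)
    have "(norm (\<zeta> - z))\<^sup>2 + 2 * t\<^sup>2 = a + b" by (simp add: a_def b_def cmod_power2)
    then have "((norm (\<zeta> - z))\<^sup>2 + 2 * t\<^sup>2) powr (-3/4) = ((a + b)\<^sup>2) powr (-3/8)"
      using ab by (simp add: powr_powr flip: powr_numeral)
    also have "\<dots> \<le> (a * b) powr (-3/8)"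
    proof (rule powr_mono2')
      have "0 \<le> a\<^sup>2 + b\<^sup>2 + a * b" using ab by (intro add_nonneg_nonneg) auto
      then show "a * b \<le> (a + b)\<^sup>2" by (simp add: power2_eq_square algebra_simps)
    qed (use ab in auto)
    also have "\<dots> = \<theta> (Re \<zeta> - Re z) * \<theta> (Im \<zeta> - Im z)"
      using ab by (simp add: \<theta>_def powr_mult a_def b_def)
    finally show "((norm (\<zeta> - z))\<^sup>2 + 2 * t\<^sup>2) powr (-3/4) \<le> \<theta> (Re \<zeta> - Re z) * \<theta> (Im \<zeta> - Im z)" .
  qed
  also have "\<dots> = integral {-1/2..1/2} (\<lambda>x. integral {-1/2..1/2} (\<lambda>y. \<theta> (x - Re z) * \<theta> (y - Im z)))"
    unfolding sq_integral_def using integral_prod_continuous[OF continuous_on_sq_pair[OF c1, of "1/2"]] by simp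
  also have "\<dots> = integral {-1/2..1/2} (\<lambda>x. \<theta> (x - Re z)) * integral {-1/2..1/2} (\<lambda>y. \<theta> (y - Im z))"
    by simp
  also have "\<dots> \<le> 8 * 8"
    using integral_power_singularity_le[OF t z(1)] integral_power_singularity_le[OF t z(2)]
    unfolding \<theta>_def by (intro mult_mono Henstock_Kurzweil_Integration.integral_nonneg integrable_continuous_interval continuous_intros)
      (use pos in \<open>auto simp: less_imp_neq[symmetric]\<close>)
  finally show ?thesis by simp
qed

text \<open>The Cauchy kernel is not square integrable in the plane, so a mean square bound on
  \<open>a\<close> alone does not control the integral of \<open>a / W\<close>. Where
  \<open>\<mu> * a \<ge> 1 / W\<close> the quadratic term suffices; elsewhere the crude bound
  \<open>B\<close> gives \<open>a\<^sup>2 \<le> B / (\<mu> * W)\<close>, which leaves a singularity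
  of order -3/2.\<close>

lemma kernel_split_le:
  fixes a B W \<mu> :: real
  assumes "0 \<le> a" "a \<le> B" "W > 0" "\<mu> > 0"
  shows "a / W \<le> \<mu> * a\<^sup>2 + sqrt (B / \<mu>) * (W\<^sup>2) powr (-3/4)"
proof (cases "\<mu> * a \<ge> 1 / W")
  case True
  then have "a * (1 / W) \<le> a * (\<mu> * a)" using assms by (intro mult_left_mono) auto
  also have "\<dots> \<le> a * (\<mu> * a) + sqrt (B / \<mu>) * (W\<^sup>2) powr (-3/4)" using assms by simp
  finally show ?thesis by (simp add: power2_eq_square mult.assoc mult.left_commute)
next
  case False
  have W: "(W\<^sup>2) powr (-3/4) = 1 / (W * sqrt W)"
  proof -
    have "(W\<^sup>2) powr (-3/4) = W powr (-(1 + 1/2))" using assms by (simp add: powr_powr flip: powr_numeral)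
    also have "\<dots> = 1 / (W powr 1 * W powr (1/2))" using assms by (simp only: powr_minus_divide powr_add)
    finally show ?thesis using assms by (simp add: powr_half_sqrt)
  qed
  have "a \<le> 1 / (\<mu> * W)" using False assms by (simp add: field_simps)
  then have "a * a \<le> B * (1 / (\<mu> * W))" using assms by (intro mult_mono) auto
  then have "sqrt (a * a) \<le> sqrt (B / \<mu> / W)"
    by (intro real_sqrt_le_mono) (simp add: field_simps)
  then have "a \<le> sqrt (B / \<mu>) / sqrt W" using assms unfolding real_sqrt_divide[of _ W] by simp
  then have "a / W \<le> sqrt (B / \<mu>) / sqrt W / W" using assms by (intro divide_right_mono) auto
  also have "\<dots> = sqrt (B / \<mu>) * (W\<^sup>2) powr (-3/4)" unfolding W by (simp add: field_simps)
  also have "\<dots> \<le> \<mu> * a\<^sup>2 + \<dots>" using assms by simp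
  finally show ?thesis .
qed

lemma rectpath_contour_integrable:
  assumes "continuous_on (path_image (rectpath a b)) f"
  shows "f contour_integrable_on rectpath a b"
proof -
  have "path_image (rectpath a b) = closed_segment a (Complex (Re b) (Im a)) \<union>
     (closed_segment (Complex (Re b) (Im a)) b \<union> (closed_segment b (Complex (Re a) (Im b)) \<union> closed_segment (Complex (Re a) (Im b)) a))"
    by (simp add: rectpath_def Let_def path_image_join)
  then have "continuous_on (closed_segment a (Complex (Re b) (Im a))) f" "continuous_on (closed_segment (Complex (Re b) (Im a)) b) f"
    "continuous_on (closed_segment b (Complex (Re a) (Im b))) f" "continuous_on (closed_segment (Complex (Re a) (Im b)) a) f"
    by (auto intro: continuous_on_subset[OF assms])
  then show ?thesis
    unfolding rectpath_def Let_def by (auto intro: contour_integrable_continuous_linepath)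
qed

text \<open>The bound concerns whatever derivatives exist, so that it passes through joins: at the
  junction the path may or may not be differentiable, and one extra constant accounts for that
  single parameter.\<close>

lemma has_vector_derivative_joinpaths_bounded:
  fixes g1 g2 :: "real \<Rightarrow> 'a::real_normed_vector"
  assumes "\<exists>B. \<forall>t\<in>{0..1}. \<forall>d. (g1 has_vector_derivative d) (at t) \<longrightarrow> norm d \<le> B"
    and "\<exists>B. \<forall>t\<in>{0..1}. \<forall>d. (g2 has_vector_derivative d) (at t) \<longrightarrow> norm d \<le> B"
  shows "\<exists>B. \<forall>t\<in>{0..1}. \<forall>d. ((g1 +++ g2) has_vector_derivative d) (at t) \<longrightarrow> norm d \<le> B"
proof -
  obtain B1 where B1: "\<And>t d. t \<in> {0..1} \<Longrightarrow> (g1 has_vector_derivative d) (at t) \<Longrightarrow> norm d \<le> B1"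
    using assms(1) by blast
  obtain B2 where B2: "\<And>t d. t \<in> {0..1} \<Longrightarrow> (g2 has_vector_derivative d) (at t) \<Longrightarrow> norm d \<le> B2"
    using assms(2) by blast
  let ?g = "g1 +++ g2"
  have 1: "norm d \<le> 2 * B1" if t: "0 \<le> t" "t < 1/2" and d: "(?g has_vector_derivative d) (at t)" for t d
  proof -
    have "((\<lambda>s. ?g (s / 2)) has_vector_derivative (1/2) *\<^sub>R d) (at (2 * t))"
    proof -
      have "((\<lambda>s::real. s / 2) has_vector_derivative 1/2) (at (2 * t))"
        by (auto simp flip: has_real_derivative_iff_has_vector_derivative intro!: derivative_eq_intros)
      from vector_diff_chain_at[OF this, of ?g d] d show ?thesis by (simp add: o_def)
    qed
    then have "(g1 has_vector_derivative (1/2) *\<^sub>R d) (at (2 * t))"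
      by (rule has_vector_derivative_transform_within_open[where S = "{..<1}"])
         (use t in \<open>auto simp: joinpaths_def\<close>)
    from B1[OF _ this] t show ?thesis by simp
  qed
  have 2: "norm d \<le> 2 * B2" if t: "t \<le> 1" "t > 1/2" and d: "(?g has_vector_derivative d) (at t)" for t d
  proof -
    have "((\<lambda>s. ?g ((s + 1) / 2)) has_vector_derivative (1/2) *\<^sub>R d) (at (2 * t - 1))"
    proof -
      have "((\<lambda>s::real. (s + 1) / 2) has_vector_derivative 1/2) (at (2 * t - 1))"
        by (auto simp flip: has_real_derivative_iff_has_vector_derivative intro!: derivative_eq_intros)
      from vector_diff_chain_at[OF this, of ?g d] d show ?thesis by (simp add: o_def)
    qed
    then have "(g2 has_vector_derivative (1/2) *\<^sub>R d) (at (2 * t - 1))"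
      by (rule has_vector_derivative_transform_within_open[where S = "{0<..}"])
         (use t in \<open>auto simp: joinpaths_def add_divide_distrib\<close>)
    from B2[OF _ this] t show ?thesis by simp
  qed
  define B3 where "B3 = norm (vector_derivative ?g (at (1/2)))"
  have 3: "norm d \<le> B3" if "(?g has_vector_derivative d) (at (1/2))" for d
    using vector_derivative_at[OF that] by (simp add: B3_def)
  show ?thesis
  proof (intro exI[of _ "max B3 (max (2 * B1) (2 * B2))"] ballI allI impI)
    fix t d assume "t \<in> {0..1}" "(?g has_vector_derivative d) (at t)"
    then show "norm d \<le> max B3 (max (2 * B1) (2 * B2))"
      using 1[of t d] 2[of t d] 3[of d] by (cases "t = 1/2"; cases "t < 1/2") auto
  qed
qed

lemma vector_derivative_rectpath_bounded:
  obtains B where "\<And>t. t \<in> {0..1} \<Longrightarrow> norm (vector_derivative (rectpath a b) (at t)) \<le> B"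
proof -
  have l: "\<exists>B. \<forall>t\<in>{0..1}. \<forall>d. (linepath u v has_vector_derivative d) (at t) \<longrightarrow> norm d \<le> B" for u v :: complex
    using vector_derivative_at[of "linepath u v"] by auto
  have "\<exists>B. \<forall>t\<in>{0..1}. \<forall>d. (rectpath a b has_vector_derivative d) (at t) \<longrightarrow> norm d \<le> B"
    unfolding rectpath_def Let_def by (intro has_vector_derivative_joinpaths_bounded l)
  then obtain B where B: "\<And>t d. t \<in> {0..1} \<Longrightarrow> (rectpath a b has_vector_derivative d) (at t) \<Longrightarrow> norm d \<le> B"
    by blast
  \<comment> \<open>At corners without a derivative, \<open>vector_derivative\<close> takes the
    default value \<open>SOME d. False\<close>, which has to be bounded as well.\<close>
  have "norm (vector_derivative (rectpath a b) (at t)) \<le> max B (norm (SOME d::complex. False))" if "t \<in> {0..1}" for t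
  proof (cases "rectpath a b differentiable at t")
    case True
    then show ?thesis using B[OF that] vector_derivative_works by (metis max.coboundedI1)
  next
    case False
    then have "\<not> (rectpath a b has_vector_derivative d) (at t)" for d
      using differentiableI_vector by blast
    then show ?thesis unfolding vector_derivative_def by simp
  qed
  then show thesis using that by blast
qed

text \<open>Used on the contour, which keeps distance \<open>1/4\<close> from the pole:
  \<open>128 * t\<^sup>2\<close> is \<open>2 * t\<^sup>2\<close> divided by the cube of
  \<open>1/4\<close>, so the kernels converge uniformly there.\<close>

lemma norm_reg_kernel_diff_le:
  fixes w :: complex
  assumes "norm w \<ge> 1/4" "t > 0"
  shows "norm (cnj w / of_real ((norm w)\<^sup>2 + 2 * t\<^sup>2) - 1 / w) \<le> 128 * t\<^sup>2"
proof -
  define D where "D = (norm w)\<^sup>2 + 2 * t\<^sup>2"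
  have w0: "w \<noteq> 0" using assms by auto
  have D: "D \<ge> (norm w)\<^sup>2" "D > 0" using w0 by (auto simp: D_def add_pos_nonneg)
  have "cnj w / of_real D - 1 / w = (cnj w * w - of_real D) / (of_real D * w)"
    using w0 D by (simp add: field_simps)
  also have "cnj w * w = of_real ((norm w)\<^sup>2)" by (simp only: complex_norm_square mult.commute)
  also have "of_real ((norm w)\<^sup>2) - of_real D = (of_real (- (2 * t\<^sup>2)) :: complex)"
    unfolding D_def by simp
  finally have "norm (cnj w / of_real D - 1 / w) = 2 * t\<^sup>2 / (D * norm w)"
    using D by (simp only: norm_divide norm_mult norm_of_real) simp
  also have "\<dots> \<le> 2 * t\<^sup>2 / ((1/4)\<^sup>2 * (1/4))"
  proof (intro divide_left_mono mult_mono)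
    show "(1/4)\<^sup>2 \<le> D" using D(1) power_mono[OF assms(1), of 2] by linarith
  qed (use assms D w0 in auto)
  finally show ?thesis by (simp add: D_def power2_eq_square)
qed

text \<open>The Cauchy kernel \<open>1 / w\<close> is replaced by the smooth \<open>cnj w / ((norm w)\<^sup>2 + 2 * t\<^sup>2)\<close>, with \<open>t\<close> tending
  to \<open>0\<close> only at the end, so that all area integrals have continuous integrands.\<close>

theorem pompeiu_estimate:
  assumes w: "\<And>\<zeta>. \<zeta> \<in> sq (1/2) \<Longrightarrow> has_wirtinger u (P \<zeta>) (Q \<zeta>) \<zeta>"
    and cP: "continuous_on (sq (1/2)) P" and cQ: "continuous_on (sq (1/2)) Q"
    and QB: "\<And>\<zeta>. \<zeta> \<in> sq (1/2) \<Longrightarrow> norm (Q \<zeta>) \<le> B" and \<mu>: "\<mu> > 0"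
    and z: "\<bar>Re z\<bar> \<le> 1/4" "\<bar>Im z\<bar> \<le> 1/4"
  shows "norm (contour_integral (rectpath (Complex (-(1/2)) (-(1/2))) (Complex (1/2) (1/2))) (\<lambda>\<zeta>. u \<zeta> / (\<zeta> - z)) / (2 * pi * \<i>) - u z)
           \<le> \<mu> * sq_integral (1/2) (\<lambda>\<zeta>. (norm (Q \<zeta>))\<^sup>2) + 64 * sqrt (B / \<mu>)"
proof -
  let ?g = "rectpath (Complex (-(1/2)) (-(1/2))) (Complex (1/2) (1/2))"
  let ?S = "sq (1/2)"
  define E where "E = sq_integral (1/2) (\<lambda>\<zeta>. (norm (Q \<zeta>))\<^sup>2)"
  have zS: "z \<in> ?S" using z by (auto simp: in_cbox_complex_iff)
  have B: "B \<ge> 0" using QB[OF zS] norm_ge_zero order_trans by blast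
  have cu: "continuous_on ?S u"
    using w unfolding has_wirtinger_def
    by (meson continuous_at_imp_continuous_on has_derivative_continuous)
  obtain L where L: "L \<ge> 0" "\<And>\<zeta>. \<zeta> \<in> ?S \<Longrightarrow> norm (u \<zeta> - u z) \<le> L * norm (\<zeta> - z)"
  proof -
    have "compact (P ` ?S)" "compact (Q ` ?S)"
      by (intro compact_continuous_image cP cQ compact_cbox)+
    then obtain M N where M: "\<And>\<zeta>. \<zeta> \<in> ?S \<Longrightarrow> norm (P \<zeta>) \<le> M" and N: "\<And>\<zeta>. \<zeta> \<in> ?S \<Longrightarrow> norm (Q \<zeta>) \<le> N"
      by (metis bounded_iff compact_imp_bounded imageI)
    have "norm (u \<zeta> - u z) \<le> (M + N) * norm (\<zeta> - z)" if "\<zeta> \<in> ?S" for \<zeta>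
    proof (rule differentiable_bound[OF convex_box(1), of _ _ u "\<lambda>z h. P z * h + Q z * cnj h"])
      fix x assume x: "x \<in> ?S"
      show "(u has_derivative (\<lambda>h. P x * h + Q x * cnj h)) (at x within ?S)"
        using w[OF x] unfolding has_wirtinger_def by (rule has_derivative_at_withinI)
      show "onorm (\<lambda>h. P x * h + Q x * cnj h) \<le> M + N"
      proof (rule onorm_le)
        fix h
        have "norm (P x * h + Q x * cnj h) \<le> norm (P x) * norm h + norm (Q x) * norm h"
          by (metis norm_triangle_ineq norm_mult complex_mod_cnj)
        also have "\<dots> \<le> (M + N) * norm h"
          unfolding distrib_right by (intro add_mono mult_right_mono M N x) auto
        finally show "norm (P x * h + Q x * cnj h) \<le> (M + N) * norm h" .
      qed
    qed (use that zS in auto)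
    moreover have "M + N \<ge> 0" using M[OF zS] N[OF zS] norm_ge_zero order_trans by (metis add_nonneg_nonneg)
    ultimately show thesis using that by blast
  qed
  have gS: "path_image ?g \<subseteq> ?S" by (rule path_image_rectpath_subset_cbox) auto
  have gz: "norm (\<zeta> - z) \<ge> 1/4" if "\<zeta> \<in> path_image ?g" for \<zeta>
  proof -
    have "\<bar>Re \<zeta>\<bar> = 1/2 \<or> \<bar>Im \<zeta>\<bar> = 1/2" using that by (auto simp: path_image_rectpath)
    then have "\<bar>Re (\<zeta> - z)\<bar> \<ge> 1/4 \<or> \<bar>Im (\<zeta> - z)\<bar> \<ge> 1/4" using z by (auto simp: abs_if split: if_splits)
    then show ?thesis using abs_Re_le_cmod[of "\<zeta> - z"] abs_Im_le_cmod[of "\<zeta> - z"] by linarith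
  qed
  define D where "D = (\<lambda>t::real. \<lambda>\<zeta>::complex. (norm (\<zeta> - z))\<^sup>2 + 2 * t\<^sup>2)"
  \<comment> \<open>Subtracting \<open>u z\<close> makes the numerator vanish at \<open>z\<close>.
    The antiholomorphic derivative of the kernel is
    \<open>2 * t\<^sup>2 / (D t \<zeta>)\<^sup>2\<close>, which concentrates at \<open>z\<close> as
    \<open>t\<close> tends to 0; against a Lipschitz numerator it contributes only a multiple of
    \<open>sqrt t\<close>.\<close>
  define \<psi> where "\<psi> = (\<lambda>t \<zeta>. (u \<zeta> - u z) * (cnj (\<zeta> - z) / of_real (D t \<zeta>)))"
  have key: "norm (contour_integral ?g (\<psi> t)) \<le> 2 * (\<mu> * E + (sqrt (B / \<mu>) + 2 * L * sqrt t) * 64)"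
    and int\<psi>: "\<psi> t contour_integrable_on ?g" if t: "t > 0" for t
  proof -
    have Dpos: "D t \<zeta> > 0" for \<zeta> using t by (simp add: D_def add_nonneg_pos)
    have cD: "continuous_on A (D t)" for A unfolding D_def by (intro continuous_intros)
    define PD where "PD = (\<lambda>\<zeta>. - cnj (\<zeta> - z) / (of_real (D t \<zeta>))\<^sup>2)"
    define QD where "QD = (\<lambda>\<zeta>. - (\<zeta> - z) / (of_real (D t \<zeta>))\<^sup>2)"
    have wD: "has_wirtinger (\<lambda>\<zeta>. 1 / of_real (D t \<zeta>)) (PD \<zeta>) (QD \<zeta>) \<zeta>" for \<zeta>
    proof -
      have h: "has_wirtinger (\<lambda>\<zeta>. \<zeta> - z) 1 0 \<zeta>"
        by (rule has_wirtinger_holomorphic) (auto intro!: derivative_eq_intros)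
      have "has_wirtinger (\<lambda>\<zeta>. (\<zeta> - z) * cnj (\<zeta> - z) + of_real (2 * t\<^sup>2)) (cnj (\<zeta> - z)) (\<zeta> - z) \<zeta>"
        using has_wirtinger_add[OF has_wirtinger_mult[OF h has_wirtinger_cnj[OF h]] has_wirtinger_const] by simp
      moreover have "(\<lambda>\<zeta>. (\<zeta> - z) * cnj (\<zeta> - z) + of_real (2 * t\<^sup>2)) = (\<lambda>\<zeta>. of_real (D t \<zeta>))"
        unfolding D_def of_real_add complex_norm_square by simp
      ultimately show ?thesis
        unfolding PD_def QD_def using Dpos[of \<zeta>]
        by (metis has_wirtinger_inverse_of_real less_irrefl)
    qed
    define Pk where "Pk = (\<lambda>\<zeta>. cnj (\<zeta> - z) * PD \<zeta>)"
    define Qk where "Qk = (\<lambda>\<zeta>. 1 / of_real (D t \<zeta>) + cnj (\<zeta> - z) * QD \<zeta>)"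
    have wk: "has_wirtinger (\<lambda>\<zeta>. cnj (\<zeta> - z) / of_real (D t \<zeta>)) (Pk \<zeta>) (Qk \<zeta>) \<zeta>" for \<zeta>
    proof -
      have h: "has_wirtinger (\<lambda>\<zeta>. \<zeta> - z) 1 0 \<zeta>"
        by (rule has_wirtinger_holomorphic) (auto intro!: derivative_eq_intros)
      show ?thesis
        using has_wirtinger_mult[OF has_wirtinger_cnj[OF h] wD] by (simp add: Pk_def Qk_def)
    qed
    have Qk: "Qk \<zeta> = of_real (2 * t\<^sup>2 / (D t \<zeta>)\<^sup>2)" for \<zeta>
    proof -
      have "cnj (\<zeta> - z) * (\<zeta> - z) = of_real (D t \<zeta> - 2 * t\<^sup>2)"
        unfolding D_def using complex_norm_square[of "\<zeta> - z"] by (simp add: mult.commute)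
      then have "cnj (\<zeta> - z) * QD \<zeta> = - (of_real (D t \<zeta> - 2 * t\<^sup>2)) / (of_real (D t \<zeta>))\<^sup>2"
        unfolding QD_def by (metis mult_minus_right times_divide_eq_right)
      then show ?thesis unfolding Qk_def using Dpos[of \<zeta>] by (simp add: field_simps power2_eq_square)
    qed
    have ccomp: "continuous_on A PD" "continuous_on A QD" "continuous_on A Pk" "continuous_on A Qk"
      "continuous_on A (\<lambda>\<zeta>. cnj (\<zeta> - z) / complex_of_real (D t \<zeta>))" for A
      unfolding Pk_def Qk_def PD_def QD_def
      by (intro continuous_intros cD; use Dpos in \<open>auto simp: less_imp_neq[symmetric]\<close>)+
    define P\<psi> where "P\<psi> = (\<lambda>\<zeta>. P \<zeta> * (cnj (\<zeta> - z) / of_real (D t \<zeta>)) + (u \<zeta> - u z) * Pk \<zeta>)"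
    define Q\<psi> where "Q\<psi> = (\<lambda>\<zeta>. Q \<zeta> * (cnj (\<zeta> - z) / of_real (D t \<zeta>)) + (u \<zeta> - u z) * Qk \<zeta>)"
    have w\<psi>: "has_wirtinger (\<psi> t) (P\<psi> \<zeta>) (Q\<psi> \<zeta>) \<zeta>" if "\<zeta> \<in> ?S" for \<zeta>
      using has_wirtinger_mult[OF has_wirtinger_diff[OF w[OF that] has_wirtinger_const] wk]
      by (simp add: \<psi>_def P\<psi>_def Q\<psi>_def)
    have cP\<psi>: "continuous_on ?S P\<psi>" and cQ\<psi>: "continuous_on ?S Q\<psi>"
      unfolding P\<psi>_def Q\<psi>_def by (intro continuous_intros cP cQ cu ccomp)+
    note G = green_rectpath[of "1/2", OF _ w\<psi> cP\<psi> cQ\<psi>]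
    show "\<psi> t contour_integrable_on ?g" using G(2) by simp
    have Dp: "continuous_on ?S (\<lambda>\<zeta>. D t \<zeta> powr (-3/4))"
      by (intro continuous_intros cD) (use Dpos in \<open>auto simp: less_imp_neq[symmetric]\<close>)
    have cn: "continuous_on ?S (\<lambda>\<zeta>. (norm (Q \<zeta>))\<^sup>2)" by (intro continuous_intros cQ)
    define c where "c = sqrt (B / \<mu>) + 2 * L * sqrt t"
    have pt: "norm (Q\<psi> \<zeta>) \<le> \<mu> * (norm (Q \<zeta>))\<^sup>2 + c * D t \<zeta> powr (-3/4)" if \<zeta>: "\<zeta> \<in> ?S" for \<zeta>
    proof -
      define W where "W = sqrt (D t \<zeta>)"
      have W: "W > 0" "W\<^sup>2 = D t \<zeta>" using Dpos[of \<zeta>] by (auto simp: W_def)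
      have nW: "norm (\<zeta> - z) \<le> W" unfolding W_def D_def by (rule real_le_rsqrt) simp
      have tW: "t \<le> W" unfolding W_def D_def using t by (intro real_le_rsqrt) simp
      have "norm (Q\<psi> \<zeta>) \<le> norm (Q \<zeta>) * (norm (\<zeta> - z) / D t \<zeta>) + norm (u \<zeta> - u z) * (2 * t\<^sup>2 / (D t \<zeta>)\<^sup>2)"
        unfolding Q\<psi>_def Qk using Dpos[of \<zeta>]
        by (intro norm_triangle_le add_mono) (auto simp: norm_mult norm_divide norm_power simp flip: complex_cnj_diff)
      also have "\<dots> \<le> norm (Q \<zeta>) * (W / W\<^sup>2) + (L * W) * (2 * t\<^sup>2 / (W\<^sup>2)\<^sup>2)"
        unfolding W(2)[symmetric] using W(1) nW L(1)
        by (intro add_mono mult_mono divide_right_mono order_trans[OF L(2)[OF \<zeta>]]) auto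
      also have "\<dots> = norm (Q \<zeta>) / W + 2 * L * (t\<^sup>2 / W ^ 3)"
        using W(1) by (simp add: power2_eq_square power3_eq_cube field_simps)
      also have "norm (Q \<zeta>) / W \<le> \<mu> * (norm (Q \<zeta>))\<^sup>2 + sqrt (B / \<mu>) * (W\<^sup>2) powr (-3/4)"
        by (rule kernel_split_le) (use QB \<zeta> W \<mu> in auto)
      \<comment> \<open>Writing \<open>t\<^sup>2\<close> as \<open>sqrt t * t powr (3/2)\<close> and
        spending the second factor on \<open>t \<le> W\<close> leaves the integrable singularity and
        a factor that vanishes in the limit.\<close>
      also have "2 * L * (t\<^sup>2 / W ^ 3) \<le> 2 * L * (sqrt t * (W\<^sup>2) powr (-3/4))"
      proof -
        have e: "(W\<^sup>2) powr (-3/4) = W powr (-3/2)" using W(1) by (simp add: powr_powr flip: powr_numeral)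
        have "t\<^sup>2 = sqrt t * t powr (3/2)" using t by (simp add: powr_half_sqrt[symmetric] flip: powr_add powr_numeral)
        also have "\<dots> \<le> sqrt t * W powr (3/2)" using t tW by (intro mult_left_mono powr_mono2) auto
        finally have "t\<^sup>2 / W ^ 3 \<le> sqrt t * W powr (3/2) / W powr 3"
          using W(1) by (simp add: divide_right_mono)
        also have "\<dots> = sqrt t * (W powr (3/2) / W powr 3)" by simp
        also have "W powr (3/2) / W powr 3 = W powr (-3/2)" by (simp flip: powr_diff)
        finally show ?thesis unfolding e using L(1) by (intro mult_left_mono) auto
      qed
      finally show ?thesis unfolding W(2) c_def by (simp add: algebra_simps)
    qed
    have "norm (contour_integral ?g (\<psi> t)) = 2 * norm (sq_integral (1/2) Q\<psi>)"
      using G(1) by (simp add: norm_mult)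
    also have "norm (sq_integral (1/2) Q\<psi>) \<le> sq_integral (1/2) (\<lambda>\<zeta>. \<mu> * (norm (Q \<zeta>))\<^sup>2 + c * D t \<zeta> powr (-3/4))"
      by (rule norm_sq_integral_le[OF cQ\<psi> _ pt]) (intro continuous_intros cn Dp)
    also have "\<dots> = \<mu> * E + c * sq_integral (1/2) (\<lambda>\<zeta>. D t \<zeta> powr (-3/4))"
      unfolding E_def sq_integral_cmult[symmetric]
      by (rule sq_integral_add) (intro continuous_intros cn Dp)+
    also have "\<dots> \<le> \<mu> * E + c * 64"
    proof -
      have "c \<ge> 0" unfolding c_def using L B \<mu> t by simp
      moreover have "sq_integral (1/2) (\<lambda>\<zeta>. D t \<zeta> powr (-3/4)) \<le> 64"
        unfolding D_def by (rule sq_integral_singularity_le) (use t z in auto)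
      ultimately show ?thesis by (intro add_left_mono mult_left_mono)
    qed
    finally show "norm (contour_integral ?g (\<psi> t)) \<le> 2 * (\<mu> * E + (sqrt (B / \<mu>) + 2 * L * sqrt t) * 64)"
      by (simp add: c_def)
  qed
  define T where "T = (\<lambda>n::nat. 1 / real (Suc n))"
  have T0: "T n > 0" for n by (simp add: T_def)
  have Tlim: "T \<longlonglongrightarrow> 0" unfolding T_def using LIMSEQ_inverse_real_of_nat by (simp add: inverse_eq_divide)
  have ul: "uniform_limit (path_image ?g) (\<lambda>n. \<psi> (T n)) (\<lambda>\<zeta>. (u \<zeta> - u z) / (\<zeta> - z)) sequentially"
  proof (rule uniform_limitI)
    fix e :: real assume "e > 0"
    have "(\<lambda>n. (L * 2) * (128 * (T n)\<^sup>2)) \<longlonglongrightarrow> (L * 2) * (128 * 0\<^sup>2)"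
      by (intro tendsto_intros Tlim)
    then have "eventually (\<lambda>n. (L * 2) * (128 * (T n)\<^sup>2) < e) sequentially"
      using \<open>e > 0\<close> by (intro order_tendstoD(2)) auto
    then show "\<forall>\<^sub>F n in sequentially. \<forall>\<zeta>\<in>path_image ?g. dist (\<psi> (T n) \<zeta>) ((u \<zeta> - u z) / (\<zeta> - z)) < e"
    proof eventually_elim
      case (elim n)
      show ?case
      proof
        fix \<zeta> assume \<zeta>: "\<zeta> \<in> path_image ?g"
        then have \<zeta>S: "\<zeta> \<in> ?S" using gS by blast
        have "norm (\<zeta> - z) \<le> \<bar>Re (\<zeta> - z)\<bar> + \<bar>Im (\<zeta> - z)\<bar>" by (rule cmod_le)
        also have "\<dots> \<le> 2" using \<zeta>S z by (auto simp: in_cbox_complex_iff abs_if split: if_splits)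
        finally have n2: "norm (\<zeta> - z) \<le> 2" .
        have "\<psi> (T n) \<zeta> - (u \<zeta> - u z) / (\<zeta> - z) = (u \<zeta> - u z) * (cnj (\<zeta> - z) / of_real ((norm (\<zeta> - z))\<^sup>2 + 2 * (T n)\<^sup>2) - 1 / (\<zeta> - z))"
          unfolding \<psi>_def D_def by (simp add: right_diff_distrib)
        then have "dist (\<psi> (T n) \<zeta>) ((u \<zeta> - u z) / (\<zeta> - z)) = norm (u \<zeta> - u z) * norm (cnj (\<zeta> - z) / of_real ((norm (\<zeta> - z))\<^sup>2 + 2 * (T n)\<^sup>2) - 1 / (\<zeta> - z))"
          by (simp add: dist_norm norm_mult)
        also have "\<dots> \<le> (L * 2) * (128 * (T n)\<^sup>2)"
          using L(1) n2 mult_left_mono[OF n2 L(1)] order_trans[OF L(2)[OF \<zeta>S]]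
          by (intro mult_mono norm_reg_kernel_diff_le gz \<zeta> T0) auto
        finally show "dist (\<psi> (T n) \<zeta>) ((u \<zeta> - u z) / (\<zeta> - z)) < e" using elim by simp
      qed
    qed
  qed
  obtain Bv where Bv: "\<And>t. t \<in> {0..1} \<Longrightarrow> norm (vector_derivative ?g (at t)) \<le> Bv"
    using vector_derivative_rectpath_bounded by blast
  have lim: "(\<lambda>n. contour_integral ?g (\<psi> (T n))) \<longlonglongrightarrow> contour_integral ?g (\<lambda>\<zeta>. (u \<zeta> - u z) / (\<zeta> - z))"
    by (rule contour_integral_uniform_limit(2)[OF _ ul Bv]) (use int\<psi> T0 in auto)
  have "norm (contour_integral ?g (\<lambda>\<zeta>. (u \<zeta> - u z) / (\<zeta> - z))) \<le> 2 * (\<mu> * E + (sqrt (B / \<mu>) + 2 * L * sqrt 0) * 64)"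
  proof (rule tendsto_le[OF _ _ tendsto_norm[OF lim]])
    show "(\<lambda>n. 2 * (\<mu> * E + (sqrt (B / \<mu>) + 2 * L * sqrt (T n)) * 64)) \<longlonglongrightarrow> 2 * (\<mu> * E + (sqrt (B / \<mu>) + 2 * L * sqrt 0) * 64)"
      by (intro tendsto_intros Tlim)
    show "\<forall>\<^sub>F n in sequentially. norm (contour_integral ?g (\<psi> (T n))) \<le> 2 * (\<mu> * E + (sqrt (B / \<mu>) + 2 * L * sqrt (T n)) * 64)"
      by (intro always_eventually allI key[OF T0])
  qed simp
  \<comment> \<open>The subtracted constant \<open>u z\<close> comes back through the winding number
    1 of the square around \<open>z\<close>.\<close>
  moreover have "contour_integral ?g (\<lambda>\<zeta>. (u \<zeta> - u z) / (\<zeta> - z)) = contour_integral ?g (\<lambda>\<zeta>. u \<zeta> / (\<zeta> - z)) - 2 * pi * \<i> * u z"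
  proof -
    have zg: "z \<notin> path_image ?g" using gz[of z] by auto
    have "(\<lambda>\<zeta>. u \<zeta> / (\<zeta> - z)) contour_integrable_on ?g"
      by (intro rectpath_contour_integrable continuous_intros continuous_on_subset[OF cu gS]) (use zg in auto)
    moreover have "((\<lambda>\<zeta>. 1 / (\<zeta> - z)) has_contour_integral 2 * pi * \<i> * winding_number ?g z) ?g"
      by (rule has_contour_integral_winding_number) (use zg in auto)
    moreover have "winding_number ?g z = 1"
      by (rule winding_number_rectpath) (use z in \<open>auto simp: in_box_complex_iff\<close>)
    ultimately have "((\<lambda>\<zeta>. u \<zeta> / (\<zeta> - z) - u z * (1 / (\<zeta> - z))) has_contour_integral (contour_integral ?g (\<lambda>\<zeta>. u \<zeta> / (\<zeta> - z)) - u z * (2 * pi * \<i>))) ?g"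
      by (intro has_contour_integral_diff has_contour_integral_lmul) (auto simp: has_contour_integral_integral)
    moreover have "(\<lambda>\<zeta>. u \<zeta> / (\<zeta> - z) - u z * (1 / (\<zeta> - z))) = (\<lambda>\<zeta>. (u \<zeta> - u z) / (\<zeta> - z))"
      by (auto simp: diff_divide_distrib)
    ultimately show ?thesis by (simp add: contour_integral_unique mult_ac)
  qed
  ultimately have n: "norm (contour_integral ?g (\<lambda>\<zeta>. u \<zeta> / (\<zeta> - z)) - 2 * pi * \<i> * u z) \<le> 2 * (\<mu> * E + 64 * sqrt (B / \<mu>))"
    by simp
  have "contour_integral ?g (\<lambda>\<zeta>. u \<zeta> / (\<zeta> - z)) / (2 * pi * \<i>) - u z
      = (contour_integral ?g (\<lambda>\<zeta>. u \<zeta> / (\<zeta> - z)) - 2 * pi * \<i> * u z) / (2 * pi * \<i>)"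
    by (simp add: diff_divide_distrib)
  then have "norm (contour_integral ?g (\<lambda>\<zeta>. u \<zeta> / (\<zeta> - z)) / (2 * pi * \<i>) - u z)
     = norm (contour_integral ?g (\<lambda>\<zeta>. u \<zeta> / (\<zeta> - z)) - 2 * pi * \<i> * u z) / (2 * pi)"
    by (simp add: norm_divide norm_mult)
  also have "\<dots> \<le> 2 * (\<mu> * E + 64 * sqrt (B / \<mu>)) / (2 * pi)"
    by (intro divide_right_mono n) simp
  also have "\<dots> = (\<mu> * E + 64 * sqrt (B / \<mu>)) / pi" by (rule mult_divide_mult_cancel_left) simp
  also have "\<dots> \<le> \<mu> * E + 64 * sqrt (B / \<mu>)"
  proof -
    have "2 * 0 \<le> 2 * (\<mu> * E + 64 * sqrt (B / \<mu>))" unfolding mult_zero_right by (rule order_trans[OF norm_ge_zero n])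
    then have "0 \<le> \<mu> * E + 64 * sqrt (B / \<mu>)" by (rule mult_left_le_imp_le) simp
    then have "(\<mu> * E + 64 * sqrt (B / \<mu>)) / pi \<le> (\<mu> * E + 64 * sqrt (B / \<mu>)) / 1"
      by (intro divide_left_mono) (use pi_ge_two in auto)
    then show ?thesis by simp
  qed
  finally show ?thesis unfolding E_def .
qed

section \<open>Approximate holomorphic division\<close>

lemma has_wirtinger_of_real:
  assumes "(f has_derivative (\<lambda>h. a * Re h + b * Im h)) (at z)"
  shows "has_wirtinger (\<lambda>z. of_real (f z)) (Complex a (-b) / 2) (Complex a b / 2) z"
proof -
  have "complex_of_real (a * Re h + b * Im h) = Complex a (-b) / 2 * h + Complex a b / 2 * cnj h" for h
    by (simp add: complex_eq_iff field_simps)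
  then show ?thesis
    unfolding has_wirtinger_def using has_derivative_of_real[OF assms, where 'a=complex] by simp
qed

lemma has_wirtinger_norm_square:
  assumes "(G has_field_derivative G') (at z)"
  shows "has_wirtinger (\<lambda>z. of_real ((norm (G z))\<^sup>2 + c)) (G' * cnj (G z)) (G z * cnj G') z"
proof -
  note h = has_wirtinger_holomorphic[OF assms]
  have "has_wirtinger (\<lambda>z. G z * cnj (G z) + of_real c) (G' * cnj (G z)) (G z * cnj G') z"
    using has_wirtinger_add[OF has_wirtinger_mult[OF h has_wirtinger_cnj[OF h]] has_wirtinger_const] by simp
  moreover have "(\<lambda>z. G z * cnj (G z) + of_real c) = (\<lambda>z. of_real ((norm (G z))\<^sup>2 + c))"
    unfolding of_real_add complex_norm_square by simp
  ultimately show ?thesis by simp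
qed

lemma sq_subset_ball: "s < 1.4 \<Longrightarrow> sq s \<subseteq> ball 0 2"
proof
  fix z assume s: "s < 1.4" and z: "z \<in> sq s"
  then have "\<bar>Re z\<bar> \<le> 1.4" "\<bar>Im z\<bar> \<le> 1.4" by (auto simp: in_cbox_complex_iff)
  then have "(Re z)\<^sup>2 \<le> 1.4\<^sup>2" "(Im z)\<^sup>2 \<le> 1.4\<^sup>2" by (metis power2_abs power_mono abs_ge_zero)+
  then have "(norm z)\<^sup>2 < 2\<^sup>2" unfolding cmod_power2 by (simp add: power2_eq_square)
  then have "norm z < 2" by (rule power_less_imp_less_base) simp
  then show "z \<in> ball 0 2" by simp
qed

text \<open>Green's formula for \<open>cut\<^sup>2 * G' * cnj G * N powr (-7/8)\<close>, where \<open>cut\<close> vanishes on the boundary. Any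
  exponent \<open>p - 1\<close> with small \<open>p > 0\<close> would do; \<open>p < 1/4\<close> is needed in the division below.\<close>

lemma caccioppoli:
  assumes hol: "G holomorphic_on ball 0 2" and bd: "\<And>z. z \<in> ball 0 2 \<Longrightarrow> norm (G z) \<le> K"
    and r: "0 < r" "r \<le> 1"
  defines "N \<equiv> \<lambda>z. (norm (G z))\<^sup>2 + r\<^sup>2"
  shows "sq_integral (1/2) (\<lambda>z. r\<^sup>2 * (norm (deriv G z))\<^sup>2 * N z powr (-15/8)) \<le> 256 * (K\<^sup>2 + 1)"
proof -
  have Npos: "N z > 0" for z using r by (simp add: N_def add_nonneg_pos)
  have sub: "sq 1 \<subseteq> ball 0 2" "sq (1/2) \<subseteq> ball 0 2" by (rule sq_subset_ball; simp)+
  have cG: "continuous_on (ball 0 2) G" using hol holomorphic_on_imp_continuous_on by blast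
  have hol': "deriv G holomorphic_on ball 0 2" using hol by (simp add: holomorphic_deriv)
  have cG': "continuous_on (ball 0 2) (deriv G)" using hol' holomorphic_on_imp_continuous_on by blast
  have cG'': "continuous_on (ball 0 2) (deriv (deriv G))"
    using hol' by (simp add: holomorphic_deriv holomorphic_on_imp_continuous_on)
  have dG: "(G has_field_derivative deriv G z) (at z)" if "z \<in> ball 0 2" for z
    using hol that by (simp add: holomorphic_derivI)
  have dG': "(deriv G has_field_derivative deriv (deriv G) z) (at z)" if "z \<in> ball 0 2" for z
    using hol' that by (simp add: holomorphic_derivI)
  have cN: "continuous_on (ball 0 2) N" unfolding N_def by (intro continuous_intros cG)
  have cNp: "continuous_on (ball 0 2) (\<lambda>z. N z powr a)" for a
    by (intro continuous_intros cN) (use Npos in \<open>auto simp: less_imp_neq[symmetric]\<close>)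
  define cut where "cut = (\<lambda>z::complex. (1 - (Re z)\<^sup>2) * (1 - (Im z)\<^sup>2))"
  define qx where "qx = (\<lambda>z::complex. - 2 * Re z * (1 - (Im z)\<^sup>2))"
  define qy where "qy = (\<lambda>z::complex. - 2 * Im z * (1 - (Re z)\<^sup>2))"
  define Pc where "Pc = (\<lambda>z. Complex (qx z) (- qy z) / 2)"
  define Qc where "Qc = (\<lambda>z. Complex (qx z) (qy z) / 2)"
  define c where "c = (\<lambda>z. complex_of_real (cut z))"
  define M where "M = (\<lambda>z. complex_of_real (N z powr (-7/8)))"
  define d where "d = (\<lambda>z. complex_of_real (-7/8 * N z powr (-15/8)))"
  have wc: "has_wirtinger c (Pc z) (Qc z) z" for z
    unfolding c_def Pc_def Qc_def
    by (rule has_wirtinger_of_real)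
       (auto simp: cut_def qx_def qy_def power2_eq_square algebra_simps fun_eq_iff intro!: derivative_eq_intros)
  have wM: "has_wirtinger M (d z * (deriv G z * cnj (G z))) (d z * (G z * cnj (deriv G z))) z" if "z \<in> ball 0 2" for z
  proof -
    have "((\<lambda>x. x powr (-7/8)) has_real_derivative (-7/8 * N z powr (-15/8))) (at (N z))"
      using Npos[of z] has_real_derivative_powr[of "N z" "-7/8"] by simp
    moreover have "has_wirtinger (\<lambda>z. of_real (N z)) (deriv G z * cnj (G z)) (G z * cnj (deriv G z)) z"
      unfolding N_def by (rule has_wirtinger_norm_square[OF dG[OF that]])
    ultimately have "has_wirtinger (\<lambda>z. of_real (N z powr (-7/8))) (of_real (-7/8 * N z powr (-15/8)) * (deriv G z * cnj (G z)))
       (of_real (-7/8 * N z powr (-15/8)) * (G z * cnj (deriv G z))) z"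
      by (intro has_wirtinger_of_real_comp)
    then
    show ?thesis unfolding M_def d_def .
  qed
  \<comment> \<open>The cutoff enters squared so that its derivative still carries a factor
    \<open>cut\<close>; only then can the error term be absorbed by the main term, which carries
    \<open>(cut z)\<^sup>2\<close>.\<close>
  define \<psi> where "\<psi> = (\<lambda>z. (c z * c z) * (deriv G z * (cnj (G z) * M z)))"
  define P where "P = (\<lambda>z. (Pc z * c z + c z * Pc z) * (deriv G z * (cnj (G z) * M z))
     + (c z * c z) * (deriv (deriv G) z * (cnj (G z) * M z) + deriv G z * (cnj 0 * M z + cnj (G z) * (d z * (deriv G z * cnj (G z))))))"
  define Q where "Q = (\<lambda>z. (Qc z * c z + c z * Qc z) * (deriv G z * (cnj (G z) * M z))
     + (c z * c z) * (0 * (cnj (G z) * M z) + deriv G z * (cnj (deriv G z) * M z + cnj (G z) * (d z * (G z * cnj (deriv G z))))))"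
  have w\<psi>: "has_wirtinger \<psi> (P z) (Q z) z" if "z \<in> ball 0 2" for z
    unfolding \<psi>_def P_def Q_def using that
    by (intro has_wirtinger_mult wc has_wirtinger_holomorphic[OF dG'] wM has_wirtinger_cnj[OF has_wirtinger_holomorphic[OF dG]])
  have cc: "continuous_on A c" "continuous_on A Pc" "continuous_on A Qc" for A
    unfolding c_def Pc_def Qc_def cut_def qx_def qy_def Complex_eq by (intro continuous_intros ballI; simp)+
  have cMd: "continuous_on (ball 0 2) M" "continuous_on (ball 0 2) d"
    unfolding M_def d_def by (intro continuous_intros cNp)+
  have cP: "continuous_on (ball 0 2) P" and cQ: "continuous_on (ball 0 2) Q"
    unfolding P_def Q_def by (intro continuous_intros cc cMd cG cG' cG'')+
  let ?g = "rectpath (Complex (-1) (-1)) (Complex 1 1)"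
  have "contour_integral ?g \<psi> = contour_integral ?g (\<lambda>_. 0)"
  proof (rule contour_integral_eq)
    fix z assume "z \<in> path_image ?g"
    then have "(Re z)\<^sup>2 = 1 \<or> (Im z)\<^sup>2 = 1" by (auto simp: path_image_rectpath power2_eq_1_iff)
    then have "cut z = 0" by (auto simp: cut_def)
    then show "\<psi> z = 0" by (simp add: \<psi>_def c_def)
  qed
  moreover have "contour_integral ?g \<psi> = 2 * \<i> * sq_integral 1 Q"
  proof (rule green_rectpath(1))
    show "has_wirtinger \<psi> (P z) (Q z) z" if "z \<in> sq 1" for z using that w\<psi> sub(1) by blast
    show "continuous_on (sq 1) P" "continuous_on (sq 1) Q"
      using continuous_on_subset[OF cP sub(1)] continuous_on_subset[OF cQ sub(1)] by blast+
  qed simp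
  ultimately have Q0: "sq_integral 1 Q = 0" by simp
  have ReQ: "sq_integral 1 (\<lambda>z. Re (Q z)) = 0"
  proof -
    have "sq_integral 1 (\<lambda>z. Re (Q z)) = Re (sq_integral 1 Q)"
    proof -
      have "Re \<circ> (\<lambda>(x, y). Q (Complex x y)) = (\<lambda>(x, y). Re (Q (Complex x y)))" by auto
      then show ?thesis
        unfolding sq_integral_def
        using integral_linear[OF sq_integrable[OF continuous_on_subset[OF cQ sub(1)]] bounded_linear_Re] by metis
    qed
    then show ?thesis using Q0 by simp
  qed
  define f where "f = (\<lambda>z. r\<^sup>2 * (norm (deriv G z))\<^sup>2 * N z powr (-15/8))"
  have cf: "continuous_on (ball 0 2) f" unfolding f_def by (intro continuous_intros cG' cNp)
  have ccut: "continuous_on A (\<lambda>z. (cut z)\<^sup>2)" for A unfolding cut_def by (intro continuous_intros)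
  have pt: "(cut z)\<^sup>2 * f z \<le> Re (Q z) + 16 * (K\<^sup>2 + 1)" if z: "z \<in> sq 1" for z
  proof -
    have zb: "z \<in> ball 0 2" using z sub by blast
    define m where "m = N z powr (-15/8)"
    have m: "m > 0" using Npos[of z] by (simp add: m_def)
    define g where "g = norm (G z)"
    define h where "h = norm (deriv G z)"
    define q where "q = norm (Qc z)"
    have M: "M z = of_real (m * N z)"
      unfolding M_def m_def using Npos[of z] powr_add[of "N z" "-15/8" 1] by simp
    \<comment> \<open>The identity behind this is
      \<open>N z - 7/8 * g\<^sup>2 = r\<^sup>2 + g\<^sup>2 / 8\<close>. The first summand yields the
      quantity to be estimated, the second is kept in reserve for the error term.\<close>
    have 1: "(c z * c z) * (0 * (cnj (G z) * M z) + deriv G z * (cnj (deriv G z) * M z + cnj (G z) * (d z * (G z * cnj (deriv G z)))))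
       = of_real ((cut z)\<^sup>2 * (h\<^sup>2 * m * (r\<^sup>2 + g\<^sup>2 / 8)))"
    proof -
      have hh: "deriv G z * cnj (deriv G z) = of_real (h\<^sup>2)" and gg: "G z * cnj (G z) = of_real (g\<^sup>2)"
        unfolding h_def g_def complex_norm_square by auto
      have "(c z * c z) * (0 * (cnj (G z) * M z) + deriv G z * (cnj (deriv G z) * M z + cnj (G z) * (d z * (G z * cnj (deriv G z)))))
        = c z * c z * ((deriv G z * cnj (deriv G z)) * (M z + d z * (G z * cnj (G z))))"
        by (simp add: algebra_simps)
      also have "\<dots> = of_real ((cut z)\<^sup>2 * (h\<^sup>2 * (m * N z + (-7/8 * m) * g\<^sup>2)))"
        unfolding hh gg c_def M d_def m_def by (simp add: power2_eq_square)
      also have "h\<^sup>2 * (m * N z + (-7/8 * m) * g\<^sup>2) = h\<^sup>2 * m * (r\<^sup>2 + g\<^sup>2 / 8)"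
        unfolding N_def g_def by (simp add: algebra_simps)
      finally show ?thesis .
    qed
    define E where "E = (Qc z * c z + c z * Qc z) * (deriv G z * (cnj (G z) * M z))"
    have ReQz: "Re (Q z) = Re E + (cut z)\<^sup>2 * (h\<^sup>2 * m * (r\<^sup>2 + g\<^sup>2 / 8))"
      unfolding Q_def 1 E_def by simp
    have "norm E = 2 * (q * \<bar>cut z\<bar>) * (h * (g * (m * N z)))"
      unfolding E_def M q_def h_def g_def c_def using m Npos[of z]
      by (simp add: norm_mult mult.commute[of _ "Qc z"] flip: mult_2)
    \<comment> \<open>The weight 8 in the completed square makes the term with \<open>h\<close>
      exactly the reserved \<open>g\<^sup>2 / 8\<close> part.\<close>
    also have "\<dots> \<le> (\<bar>cut z\<bar> * h * g)\<^sup>2 * m / 8 + 8 * q\<^sup>2 * (m * (N z)\<^sup>2)"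
    proof -
      have "0 \<le> m * ((\<bar>cut z\<bar> * h * g) - 8 * (q * N z))\<^sup>2" using m by simp
      then show ?thesis by (simp add: power2_eq_square algebra_simps)
    qed
    finally have nE: "norm E \<le> (\<bar>cut z\<bar> * h * g)\<^sup>2 * m / 8 + 8 * q\<^sup>2 * (m * (N z)\<^sup>2)" .
    \<comment> \<open>What remains of the cutoff error is \<open>N z\<close> to the positive power
      \<open>1/8\<close>, hence bounded independently of \<open>r\<close>.\<close>
    have "m * (N z)\<^sup>2 \<le> K\<^sup>2 + 1"
    proof -
      have NK: "N z \<le> K\<^sup>2 + 1"
        unfolding N_def using power_mono[OF bd[OF zb], of 2] power_mono[OF r(2), of 2] r by (intro add_mono) auto
      have "m * (N z)\<^sup>2 = N z powr (1/8)"
        unfolding m_def using Npos[of z] by (simp flip: powr_add powr_numeral)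
      also have "\<dots> \<le> (K\<^sup>2 + 1) powr (1/8)" using NK Npos[of z] by (intro powr_mono2) auto
      also have "\<dots> \<le> (K\<^sup>2 + 1) powr 1" by (intro powr_mono) auto
      finally show ?thesis by (simp add: add_nonneg_pos)
    qed
    moreover have "8 * q\<^sup>2 \<le> 16"
    proof -
      have "\<bar>Re z\<bar> \<le> 1" "\<bar>Im z\<bar> \<le> 1" using z by (auto simp: in_cbox_complex_iff)
      then have x2: "(Re z)\<^sup>2 \<le> 1" "(Im z)\<^sup>2 \<le> 1" by (auto simp: abs_square_le_1)
      then have "\<bar>1 - (Re z)\<^sup>2\<bar> \<le> 1" "\<bar>1 - (Im z)\<^sup>2\<bar> \<le> 1" by auto
      then have "\<bar>qx z\<bar> \<le> 2 * 1 * 1" "\<bar>qy z\<bar> \<le> 2 * 1 * 1"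
        unfolding qx_def qy_def abs_mult using \<open>\<bar>Re z\<bar> \<le> 1\<close> \<open>\<bar>Im z\<bar> \<le> 1\<close>
        by (intro mult_mono; simp)+
      then have "\<bar>qx z\<bar>\<^sup>2 \<le> 2\<^sup>2" "\<bar>qy z\<bar>\<^sup>2 \<le> 2\<^sup>2" by (intro power_mono; simp)+
      moreover have "q\<^sup>2 = ((qx z)\<^sup>2 + (qy z)\<^sup>2) / 4"
        unfolding q_def Qc_def by (simp add: norm_divide power_divide cmod_power2)
      ultimately show ?thesis by simp
    qed
    ultimately have "8 * q\<^sup>2 * (m * (N z)\<^sup>2) \<le> 16 * (K\<^sup>2 + 1)"
      using m by (intro mult_mono) auto
    with nE have "norm E \<le> (\<bar>cut z\<bar> * h * g)\<^sup>2 * m / 8 + 16 * (K\<^sup>2 + 1)" by linarith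
    moreover have "- norm E \<le> Re E" using abs_Re_le_cmod[of E] by linarith
    ultimately show ?thesis
      unfolding ReQz f_def m_def[symmetric] h_def[symmetric]
      by (simp add: power_mult_distrib algebra_simps)
  qed
  have "sq_integral (1/2) (\<lambda>z. f z / 4) \<le> sq_integral (1/2) (\<lambda>z. (cut z)\<^sup>2 * f z)"
  proof (rule sq_integral_mono)
    show "continuous_on (sq (1/2)) (\<lambda>z. f z / 4)" "continuous_on (sq (1/2)) (\<lambda>z. (cut z)\<^sup>2 * f z)"
      by (intro continuous_intros ccut continuous_on_subset[OF cf sub(2)]; simp)+
    fix z :: complex assume "z \<in> sq (1/2)"
    then have "\<bar>Re z\<bar> \<le> 1/2" "\<bar>Im z\<bar> \<le> 1/2" by (auto simp: in_cbox_complex_iff)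
    then have "\<bar>Re z\<bar>\<^sup>2 \<le> (1/2)\<^sup>2" "\<bar>Im z\<bar>\<^sup>2 \<le> (1/2)\<^sup>2" by (intro power_mono; simp)+
    then have "3/4 \<le> 1 - (Re z)\<^sup>2" "3/4 \<le> 1 - (Im z)\<^sup>2" by (auto simp: power2_eq_square)
    then have "(3/4) * (3/4) \<le> cut z" unfolding cut_def by (intro mult_mono) auto
    then have "(1/2)\<^sup>2 \<le> (cut z)\<^sup>2" by (intro power_mono) auto
    then have "1/4 \<le> (cut z)\<^sup>2" by (simp add: power2_eq_square)
    then show "f z / 4 \<le> (cut z)\<^sup>2 * f z"
      using mult_right_mono[of "1/4" "(cut z)\<^sup>2" "f z"] by (simp add: f_def)
  qed
  also have "\<dots> \<le> sq_integral 1 (\<lambda>z. (cut z)\<^sup>2 * f z)"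
  proof (rule sq_integral_mono_set)
    show "continuous_on (sq 1) (\<lambda>z. (cut z)\<^sup>2 * f z)"
      by (intro continuous_intros ccut continuous_on_subset[OF cf sub(1)])
  qed (auto simp: f_def)
  also have "\<dots> \<le> sq_integral 1 (\<lambda>z. Re (Q z) + 16 * (K\<^sup>2 + 1))"
    by (rule sq_integral_mono[OF _ _ pt])
       (intro continuous_intros ccut continuous_on_subset[OF cf sub(1)] continuous_on_subset[OF cQ sub(1)])+
  also have "\<dots> = sq_integral 1 (\<lambda>z. Re (Q z)) + sq_integral 1 (\<lambda>z. 16 * (K\<^sup>2 + 1))"
    by (rule sq_integral_add) (intro continuous_intros continuous_on_subset[OF cQ sub(1)])+
  also have "\<dots> = 64 * (K\<^sup>2 + 1)" unfolding ReQ by (simp add: sq_integral_const)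
  finally show ?thesis using sq_integral_cmult[of "1/2" "1/4" f] unfolding f_def by simp
qed

lemma holomorphic_on_rectpath_cauchy_integral:
  assumes "continuous_on (path_image (rectpath a b)) u"
  shows "(\<lambda>z. contour_integral (rectpath a b) (\<lambda>\<zeta>. u \<zeta> / (\<zeta> - z))) holomorphic_on - path_image (rectpath a b)"
proof -
  obtain B where B: "\<And>t. t \<in> {0..1} \<Longrightarrow> norm (vector_derivative (rectpath a b) (at t)) \<le> B"
    using vector_derivative_rectpath_bounded by blast
  have op: "open (- path_image (rectpath a b))"
    by (simp add: closed_path_image open_Compl)
  have "((\<lambda>z. contour_integral (rectpath a b) (\<lambda>\<zeta>. u \<zeta> / (\<zeta> - z))) has_field_derivative
      of_nat 1 * contour_integral (rectpath a b) (\<lambda>\<zeta>. u \<zeta> / (\<zeta> - z) ^ Suc 1)) (at z)"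
    if z: "z \<notin> path_image (rectpath a b)" for z
  proof (rule Cauchy_next_derivative(2)[OF assms B, where S = UNIV])
    fix w assume "w \<in> UNIV - path_image (rectpath a b)"
    then have "(\<lambda>\<zeta>. u \<zeta> / (\<zeta> - w)) contour_integrable_on rectpath a b"
      by (intro rectpath_contour_integrable continuous_intros assms) auto
    then show "((\<lambda>\<zeta>. u \<zeta> / (\<zeta> - w) ^ 1) has_contour_integral contour_integral (rectpath a b) (\<lambda>\<zeta>. u \<zeta> / (\<zeta> - w))) (rectpath a b)"
      by (simp add: has_contour_integral_integral)
  qed (use z in auto)
  then show ?thesis
    unfolding holomorphic_on_open[OF op] by blast
qed

text \<open>Both \<open>r ^ 3\<close> and \<open>norm (G z) ^ 3\<close> are at most
  \<open>N z powr (3/2)\<close>, so \<open>(norm (H z))\<^sup>2\<close> is of that order, even at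
  zeros of \<open>G\<close>. As the antiholomorphic derivative of the regularised quotient is
  \<open>H z * cnj (deriv G z) * r\<^sup>2 / (N z)\<^sup>2\<close>, its mean square is of order
  \<open>r powr (3/4)\<close>, while its supremum may grow like \<open>r powr (-1/2)\<close>. The
  decay outweighs the growth in \<open>pompeiu_estimate\<close>.\<close>

theorem approximate_quotient:
  assumes holG: "G holomorphic_on ball 0 2" and holH: "H holomorphic_on ball 0 2"
    and bG: "\<And>z. z \<in> ball 0 2 \<Longrightarrow> norm (G z) \<le> K"
    and GH: "\<And>z. z \<in> ball 0 2 \<Longrightarrow> norm ((H z)\<^sup>2 - (G z) ^ 3) \<le> K * r ^ 3"
    and r: "0 < r" "r \<le> 1"
  shows "\<exists>F. F holomorphic_on ball 0 (1/4) \<and>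
     (\<forall>z\<in>ball 0 (1/4). norm (F z - H z * cnj (G z) / of_real ((norm (G z))\<^sup>2 + r\<^sup>2))
        \<le> 320 * (1 + K) * (K\<^sup>2 + 1) * r powr (1/16))"
proof -
  have K: "K \<ge> 0" using order_trans[OF norm_ge_zero bG[of 0]] by simp
  define N where "N = (\<lambda>z. (norm (G z))\<^sup>2 + r\<^sup>2)"
  have Npos: "N z > 0" for z using r by (simp add: N_def add_nonneg_pos)
  have sub: "sq (1/2) \<subseteq> ball 0 2" by (rule sq_subset_ball) simp
  have cG: "continuous_on (ball 0 2) G" and cH: "continuous_on (ball 0 2) H"
    using holG holH holomorphic_on_imp_continuous_on by blast+
  have cG': "continuous_on (ball 0 2) (deriv G)" and cH': "continuous_on (ball 0 2) (deriv H)"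
    using holG holH by (auto intro!: holomorphic_on_imp_continuous_on holomorphic_deriv)
  have dG: "(G has_field_derivative deriv G z) (at z)" and dH: "(H has_field_derivative deriv H z) (at z)"
    if "z \<in> ball 0 2" for z
    using holG holH that by (auto intro: holomorphic_derivI)
  have cN: "continuous_on (ball 0 2) N" unfolding N_def by (intro continuous_intros cG)
  have cNp: "continuous_on (ball 0 2) (\<lambda>z. N z powr a)" for a
    by (intro continuous_intros cN) (use Npos in \<open>auto simp: less_imp_neq[symmetric]\<close>)
  have wN: "has_wirtinger (\<lambda>z. of_real (N z)) (deriv G z * cnj (G z)) (G z * cnj (deriv G z)) z" if "z \<in> ball 0 2" for z
    unfolding N_def by (rule has_wirtinger_norm_square[OF dG[OF that]])
  define u where "u = (\<lambda>z. H z * (cnj (G z) * (1 / of_real (N z))))"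
  define P where "P = (\<lambda>z. deriv H z * (cnj (G z) * (1 / of_real (N z))) +
     H z * (cnj 0 * (1 / of_real (N z)) + cnj (G z) * (- (deriv G z * cnj (G z)) / (of_real (N z))\<^sup>2)))"
  define Q where "Q = (\<lambda>z. 0 * (cnj (G z) * (1 / of_real (N z))) +
     H z * (cnj (deriv G z) * (1 / of_real (N z)) + cnj (G z) * (- (G z * cnj (deriv G z)) / (of_real (N z))\<^sup>2)))"
  have wu: "has_wirtinger u (P z) (Q z) z" if z: "z \<in> ball 0 2" for z
    unfolding u_def P_def Q_def
    by (intro has_wirtinger_mult has_wirtinger_holomorphic[OF dH] has_wirtinger_cnj[OF has_wirtinger_holomorphic[OF dG]]
         has_wirtinger_inverse_of_real wN z)
       (use Npos[of z] in auto)
  have cP: "continuous_on (ball 0 2) P" and cQ: "continuous_on (ball 0 2) Q"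
    unfolding P_def Q_def by (intro continuous_intros cG cG' cH cH' cN; use Npos in \<open>auto simp: less_imp_neq[symmetric]\<close>)+
  have Q: "Q z = H z * cnj (deriv G z) * of_real (r\<^sup>2 / (N z)\<^sup>2)" for z
  proof -
    have "Q z = H z * cnj (deriv G z) * (1 / of_real (N z) - (G z * cnj (G z)) / (of_real (N z))\<^sup>2)"
      unfolding Q_def by (simp add: algebra_simps)
    also have "G z * cnj (G z) = of_real (N z - r\<^sup>2)"
      unfolding N_def by (simp only: complex_norm_square[symmetric]) simp
    also have "1 / of_real (N z) - of_real (N z - r\<^sup>2) / (of_real (N z))\<^sup>2 = complex_of_real (r\<^sup>2 / (N z)\<^sup>2)"
      using Npos[of z] by (simp add: field_simps power2_eq_square)
    finally show ?thesis .
  qed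
  have H2: "(norm (H z))\<^sup>2 \<le> (1 + K) * N z powr (3/2)" if z: "z \<in> ball 0 2" for z
  proof -
    have "(norm (H z))\<^sup>2 = norm (((H z)\<^sup>2 - (G z) ^ 3) + (G z) ^ 3)" by (simp add: norm_power)
    also have "\<dots> \<le> K * r ^ 3 + (norm (G z)) ^ 3"
      using GH[OF z] norm_triangle_ineq[of "(H z)\<^sup>2 - (G z) ^ 3" "(G z) ^ 3"] by (simp add: norm_power)
    also have "\<dots> \<le> K * N z powr (3/2) + N z powr (3/2)"
    proof -
      have e: "a ^ 3 \<le> N z powr (3/2)" if "0 \<le> a" "a\<^sup>2 \<le> N z" for a
      proof (cases "a = 0")
        case False
        then have "a ^ 3 = (a\<^sup>2) powr (3/2)" using that by (simp add: powr_powr flip: powr_numeral)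
        also have "\<dots> \<le> N z powr (3/2)" using that by (intro powr_mono2) auto
        finally show ?thesis .
      qed (use Npos[of z] in simp)
      show ?thesis using e[of r] e[of "norm (G z)"] r K
        by (intro add_mono mult_left_mono) (auto simp: N_def)
    qed
    finally show ?thesis by (simp add: algebra_simps)
  qed
  have G'K: "norm (deriv G z) \<le> K" if z: "z \<in> sq (1/2)" for z
  proof -
    have b: "cball z 1 \<subseteq> ball 0 2"
    proof
      fix w assume w: "w \<in> cball z 1"
      have "(norm z)\<^sup>2 < 1\<^sup>2"
      proof -
        have "\<bar>Re z\<bar>\<^sup>2 \<le> (1/2)\<^sup>2" "\<bar>Im z\<bar>\<^sup>2 \<le> (1/2)\<^sup>2"
          using z by (intro power_mono; auto simp: in_cbox_complex_iff)+
        then show ?thesis unfolding cmod_power2 by (simp add: power2_eq_square)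
      qed
      then have "norm z < 1" by (rule power_less_imp_less_base) simp
      moreover have "norm (w - z) \<le> 1" using w by (simp add: dist_norm norm_minus_commute)
      ultimately have "norm w < 2" using norm_triangle_ineq2[of w z] by linarith
      then show "w \<in> ball 0 2" by simp
    qed
    have "norm ((deriv ^^ 1) G z) \<le> fact 1 * K / 1 ^ 1"
    proof (rule Cauchy_inequality)
      show "G holomorphic_on ball z 1" "continuous_on (cball z 1) G"
        using holomorphic_on_subset[OF holG subset_trans[OF ball_subset_cball b]] continuous_on_subset[OF cG b] by auto
      show "norm (G x) \<le> K" if "norm (z - x) = 1" for x
      proof (rule bG)
        have "x \<in> cball z 1" using that by (simp add: dist_norm)
        then show "x \<in> ball 0 2" using b by blast
      qed
    qed simp
    then show ?thesis by simp
  qed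
  define f where "f = (\<lambda>z. r\<^sup>2 * (norm (deriv G z))\<^sup>2 * N z powr (-15/8))"
  have cf: "continuous_on (ball 0 2) f" unfolding f_def by (intro continuous_intros cG' cNp)
  have Nr: "N z powr (-a) \<le> r powr (-2*a)" if "a > 0" for z a
  proof -
    have "N z powr (-a) \<le> (r\<^sup>2) powr (-a)"
      by (rule powr_mono2') (use that r in \<open>auto simp: N_def\<close>)
    then show ?thesis using r by (simp add: powr_powr flip: powr_numeral)
  qed
  have Q2: "(norm (Q z))\<^sup>2 \<le> (1 + K) * r powr (3/4) * f z" if z: "z \<in> ball 0 2" for z
  proof -
    define h where "h = norm (deriv G z)"
    have n: "norm (Q z) = norm (H z) * h * (r\<^sup>2 / (N z)\<^sup>2)"
      unfolding Q h_def norm_mult norm_of_real by simp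
    have "(norm (Q z))\<^sup>2 = (norm (H z))\<^sup>2 * (h\<^sup>2 * r\<^sup>2 * (r\<^sup>2 / (N z) ^ 4))"
      unfolding n by (simp add: power_mult_distrib power_divide flip: power_mult) 
    also have "\<dots> \<le> ((1 + K) * N z powr (3/2)) * (h\<^sup>2 * r\<^sup>2 * (r\<^sup>2 / (N z) ^ 4))"
      using H2[OF z] by (intro mult_right_mono) auto
    also have "\<dots> = (1 + K) * (h\<^sup>2 * r\<^sup>2) * (r\<^sup>2 * (N z powr (3/2) / (N z) ^ 4))" by simp
    \<comment> \<open>Of the total exponent \<open>-5/2\<close>, the part \<open>-15/8\<close>
      matches the integrand of \<open>caccioppoli\<close>; the rest is estimated by
      \<open>N z \<ge> r\<^sup>2\<close> and costs \<open>r powr (-5/4)\<close>.\<close>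
    also have "N z powr (3/2) / (N z) ^ 4 = N z powr (-15/8) * N z powr (-(5/8))"
      using Npos[of z] by (simp flip: powr_add powr_diff powr_numeral)
    also have "(1 + K) * (h\<^sup>2 * r\<^sup>2) * (r\<^sup>2 * (N z powr (-15/8) * N z powr (-(5/8))))
       = (1 + K) * (r\<^sup>2 * N z powr (-(5/8))) * f z"
      unfolding f_def h_def by simp
    also have "\<dots> \<le> (1 + K) * (r\<^sup>2 * r powr (-2*(5/8))) * f z"
      using Nr[of "5/8" z] K by (intro mult_right_mono mult_left_mono) (auto simp: f_def)
    also have "r\<^sup>2 * r powr (-2*(5/8)) = r powr (3/4)" using r by (simp flip: powr_add powr_numeral)
    finally show ?thesis .
  qed
  have E: "sq_integral (1/2) (\<lambda>z. (norm (Q z))\<^sup>2) \<le> (1 + K) * r powr (3/4) * (256 * (K\<^sup>2 + 1))"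
  proof -
    have "sq_integral (1/2) (\<lambda>z. (norm (Q z))\<^sup>2) \<le> sq_integral (1/2) (\<lambda>z. (1 + K) * r powr (3/4) * f z)"
      by (rule sq_integral_mono) (use Q2 sub in \<open>auto intro!: continuous_intros continuous_on_subset[OF cQ sub] continuous_on_subset[OF cf sub]\<close>)
    also have "\<dots> = (1 + K) * r powr (3/4) * sq_integral (1/2) f" by (rule sq_integral_cmult)
    also have "\<dots> \<le> (1 + K) * r powr (3/4) * (256 * (K\<^sup>2 + 1))"
      using caccioppoli[OF holG bG r] K unfolding f_def N_def by (intro mult_left_mono) auto
    finally show ?thesis .
  qed
  have QB: "norm (Q z) \<le> (1 + K)\<^sup>2 * r powr (-1/2)" if z: "z \<in> sq (1/2)" for z
  proof -
    have zb: "z \<in> ball 0 2" using z sub by blast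
    have "norm (H z) = sqrt ((norm (H z))\<^sup>2)" by simp
    also have "\<dots> \<le> sqrt ((1 + K) * N z powr (3/2))" by (rule real_sqrt_le_mono[OF H2[OF zb]])
    also have "\<dots> = sqrt (1 + K) * N z powr (3/4)"
      using Npos[of z] by (simp add: real_sqrt_mult powr_half_sqrt[symmetric] powr_powr)
    also have "\<dots> \<le> (1 + K) * N z powr (3/4)"
      using K by (intro mult_right_mono) (auto simp: real_sqrt_le_iff' intro!: real_le_lsqrt simp: power2_eq_square)
    finally have "norm (Q z) \<le> ((1 + K) * N z powr (3/4)) * (1 + K) * (r\<^sup>2 / (N z)\<^sup>2)"
      unfolding Q norm_mult norm_of_real using G'K[OF z] K
      by (intro mult_mono) auto
    also have "\<dots> = (1 + K)\<^sup>2 * (r\<^sup>2 * (N z powr (3/4) / (N z)\<^sup>2))" by (simp add: power2_eq_square)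
    also have "N z powr (3/4) / (N z)\<^sup>2 = N z powr (-(5/4))"
      using Npos[of z] by (simp flip: powr_diff powr_numeral)
    also have "(1 + K)\<^sup>2 * (r\<^sup>2 * N z powr (-(5/4))) \<le> (1 + K)\<^sup>2 * (r\<^sup>2 * r powr (-2*(5/4)))"
      using Nr[of "5/4" z] by (intro mult_left_mono) auto
    also have "r\<^sup>2 * r powr (-2*(5/4)) = r powr (-1/2)" using r by (simp flip: powr_add powr_numeral)
    finally show ?thesis .
  qed
  let ?g = "rectpath (Complex (-(1/2)) (-(1/2))) (Complex (1/2) (1/2))"
  define F where "F = (\<lambda>z. contour_integral ?g (\<lambda>\<zeta>. u \<zeta> / (\<zeta> - z)) / (2 * pi * \<i>))"
  have gS: "path_image ?g \<subseteq> sq (1/2)" by (rule path_image_rectpath_subset_cbox) auto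
  have cu: "continuous_on (ball 0 2) u"
    using wu unfolding has_wirtinger_def
    by (meson continuous_at_imp_continuous_on has_derivative_continuous)
  have re: "\<bar>Re z\<bar> \<le> 1/4" "\<bar>Im z\<bar> \<le> 1/4" if "z \<in> ball 0 (1/4)" for z
    using that abs_Re_le_cmod[of z] abs_Im_le_cmod[of z] by auto
  have "F holomorphic_on ball 0 (1/4)"
    unfolding F_def
  proof (intro holomorphic_intros holomorphic_on_subset[OF holomorphic_on_rectpath_cauchy_integral])
    show "continuous_on (path_image ?g) u" using cu gS sub continuous_on_subset by blast
    show "ball 0 (1/4) \<subseteq> - path_image ?g"
    proof
      fix z :: complex assume "z \<in> ball 0 (1/4)"
      from re[OF this] show "z \<in> - path_image ?g" by (auto simp: path_image_rectpath)
    qed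
  qed auto
  moreover have "norm (F z - u z) \<le> 320 * (1 + K) * (K\<^sup>2 + 1) * r powr (1/16)" if z: "z \<in> ball 0 (1/4)" for z
  proof -
    \<comment> \<open>The two terms of the estimate get the exponents \<open>3/4 - 5/8\<close> and
      \<open>(5/8 - 1/2) / 2\<close>; \<open>5/8\<close> is the midpoint of the admissible range
      from \<open>1/2\<close> to \<open>3/4\<close>. The smaller exponent \<open>1/16\<close>
      survives.\<close>
    define \<mu> where "\<mu> = r powr (-5/8)"
    define B where "B = (1 + K)\<^sup>2 * r powr (-1/2)"
    have "norm (F z - u z) \<le> \<mu> * sq_integral (1/2) (\<lambda>\<zeta>. (norm (Q \<zeta>))\<^sup>2) + 64 * sqrt (B / \<mu>)"
      unfolding F_def
      by (rule pompeiu_estimate[of u P Q])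
         (use wu sub cP cQ continuous_on_subset QB re[OF z] r in \<open>auto simp: \<mu>_def B_def\<close>)
    also have "\<mu> * sq_integral (1/2) (\<lambda>\<zeta>. (norm (Q \<zeta>))\<^sup>2) \<le> \<mu> * ((1 + K) * r powr (3/4) * (256 * (K\<^sup>2 + 1)))"
      by (intro mult_left_mono E) (simp add: \<mu>_def)
    also have "\<dots> = (\<mu> * r powr (3/4)) * (256 * (1 + K) * (K\<^sup>2 + 1))" by (simp only: mult_ac)
    also have "\<mu> * r powr (3/4) = r powr (1/8)" unfolding \<mu>_def using r by (simp flip: powr_add)
    also have "r powr (1/8) * (256 * (1 + K) * (K\<^sup>2 + 1)) \<le> r powr (1/16) * (256 * (1 + K) * (K\<^sup>2 + 1))"
      using r K by (intro mult_right_mono powr_mono') auto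
    also have "sqrt (B / \<mu>) = (1 + K) * r powr (1/16)"
    proof -
      have "B / \<mu> = (1 + K)\<^sup>2 * r powr (1/8)" 
      proof -
        have "r powr (-1/2) / r powr (-5/8) = r powr (1/8)" by (simp flip: powr_diff)
        then show ?thesis unfolding B_def \<mu>_def by (metis times_divide_eq_right)
      qed
      then show ?thesis using r K by (simp add: real_sqrt_mult powr_half_sqrt[symmetric] powr_powr)
    qed
    finally have "norm (F z - u z) \<le> r powr (1/16) * (256 * (1 + K) * (K\<^sup>2 + 1)) + 64 * ((1 + K) * r powr (1/16))" by simp
    moreover have "64 * ((1 + K) * r powr (1/16)) * 1 \<le> 64 * ((1 + K) * r powr (1/16)) * (K\<^sup>2 + 1)"
      using K by (intro mult_left_mono) auto
    ultimately show ?thesis by (simp add: algebra_simps)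
  qed
  moreover have "u z = H z * cnj (G z) / of_real ((norm (G z))\<^sup>2 + r\<^sup>2)" for z by (simp add: u_def N_def)
  ultimately show ?thesis by metis
qed

section \<open>Functions approximable by holomorphic ones\<close>

text \<open>Abstracts the errors \<open>exp (- conj_weight (a * \<epsilon>) / b)\<close> as
  functions of the disc radius; the algebra of approximable functions needs no more about
  them.\<close>

definition decay_gauge :: "(real \<Rightarrow> real) \<Rightarrow> bool" where
  "decay_gauge \<delta> \<longleftrightarrow> (\<forall>\<epsilon>>0. 0 < \<delta> \<epsilon> \<and> \<delta> \<epsilon> \<le> 1) \<and> (\<forall>\<epsilon> \<epsilon>'. 0 < \<epsilon> \<longrightarrow> \<epsilon> \<le> \<epsilon>' \<longrightarrow> \<delta> \<epsilon> \<le> \<delta> \<epsilon>')"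

text \<open>One constant \<open>K\<close> bounds \<open>F\<close> and scales the error, which is the
  normalisation of \<open>two_constants\<close>. Since \<open>f\<close> lives on the real axis,
  \<open>F\<close> is compared with it only there.\<close>

definition disc_approx :: "(real \<Rightarrow> complex) \<Rightarrow> real \<Rightarrow> real \<Rightarrow> real \<Rightarrow> real \<Rightarrow> (complex \<Rightarrow> complex) \<Rightarrow> bool" where
  "disc_approx f K \<eta> x \<epsilon> F \<longleftrightarrow> F holomorphic_on ball (of_real x) \<epsilon> \<and>
     (\<forall>z\<in>ball (of_real x) \<epsilon>. norm (F z) \<le> K) \<and>
     (\<forall>y. \<bar>y - x\<bar> < \<epsilon> \<longrightarrow> norm (F (of_real y) - f y) \<le> K * \<eta>)"

text \<open>Only \<open>K\<close> and \<open>e\<close> are uniform; the approximants for different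
  centres and radii are unrelated by definition, and \<open>two_constants\<close> forces them to be
  close where their discs overlap.\<close>

definition holo_approx :: "(real \<Rightarrow> real) \<Rightarrow> real \<Rightarrow> (real \<Rightarrow> complex) \<Rightarrow> bool" where
  "holo_approx \<delta> R f \<longleftrightarrow> (\<exists>K\<ge>0. \<exists>e>0. \<forall>x \<epsilon>. \<bar>x\<bar> < R \<longrightarrow> 0 < \<epsilon> \<longrightarrow> \<epsilon> < e \<longrightarrow>
     (\<exists>F. disc_approx f K (\<delta> \<epsilon>) x \<epsilon> F))"

lemma of_real_in_ball: "\<bar>y - x\<bar> < \<epsilon> \<Longrightarrow> of_real y \<in> ball (complex_of_real x) \<epsilon>"
  by (simp add: dist_norm norm_minus_commute flip: of_real_diff)

lemma disc_approx_mono: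
  assumes F: "disc_approx f K \<eta> x \<epsilon> F" and "K \<le> K'" "\<eta> \<le> \<eta>'" "K \<ge> 0" "\<eta> \<ge> 0"
  shows "disc_approx f K' \<eta>' x \<epsilon> F"
proof -
  have "K * \<eta> \<le> K' * \<eta>'" using assms by (intro mult_mono) auto
  with assms show ?thesis unfolding disc_approx_def by (meson order_trans)
qed

lemma disc_approx_norm_le:
  assumes "disc_approx f K \<eta> x \<epsilon> F" "\<bar>y - x\<bar> < \<epsilon>" "\<eta> \<le> 1" "K \<ge> 0"
  shows "norm (f y) \<le> 2 * K"
proof -
  have "norm (f y) \<le> norm (F (of_real y)) + norm (F (of_real y) - f y)"
    using norm_triangle_ineq4[of "F (of_real y)" "F (of_real y) - f y"] by simp
  also have "\<dots> \<le> K + K * \<eta>"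
    using assms of_real_in_ball[OF assms(2)] unfolding disc_approx_def by (intro add_mono) auto
  also have "\<dots> \<le> K + K * 1" using assms by (intro add_left_mono mult_left_mono) auto
  finally show ?thesis by simp
qed

lemma holo_approx_mono:
  assumes "holo_approx \<delta> R f" "\<And>\<epsilon>. \<epsilon> > 0 \<Longrightarrow> 0 \<le> \<delta> \<epsilon> \<and> \<delta> \<epsilon> \<le> \<delta>' \<epsilon>"
  shows "holo_approx \<delta>' R f"
proof -
  obtain K e where "K \<ge> 0" "e > 0" and
    h: "\<And>x \<epsilon>. \<bar>x\<bar> < R \<Longrightarrow> 0 < \<epsilon> \<Longrightarrow> \<epsilon> < e \<Longrightarrow> \<exists>F. disc_approx f K (\<delta> \<epsilon>) x \<epsilon> F"
    using assms(1) unfolding holo_approx_def by blast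
  moreover have "\<exists>F. disc_approx f K (\<delta>' \<epsilon>) x \<epsilon> F" if "\<bar>x\<bar> < R" "0 < \<epsilon>" "\<epsilon> < e" for x \<epsilon>
    using h[OF that] assms(2)[OF that(2)] disc_approx_mono[of f K "\<delta> \<epsilon>" x \<epsilon> _ K "\<delta>' \<epsilon>"] \<open>K \<ge> 0\<close> by blast
  ultimately show ?thesis unfolding holo_approx_def by blast
qed

lemma holo_approx_common_constants:
  assumes \<delta>: "decay_gauge \<delta>" and "holo_approx \<delta> R f" "holo_approx \<delta> R g"
  obtains K e where "K \<ge> 1" "e > 0"
    "\<And>x \<epsilon>. \<bar>x\<bar> < R \<Longrightarrow> 0 < \<epsilon> \<Longrightarrow> \<epsilon> < e \<Longrightarrow> \<exists>F. disc_approx f K (\<delta> \<epsilon>) x \<epsilon> F"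
    "\<And>x \<epsilon>. \<bar>x\<bar> < R \<Longrightarrow> 0 < \<epsilon> \<Longrightarrow> \<epsilon> < e \<Longrightarrow> \<exists>F. disc_approx g K (\<delta> \<epsilon>) x \<epsilon> F"
proof -
  obtain K1 e1 where 1: "K1 \<ge> 0" "e1 > 0" 
    "\<And>x \<epsilon>. \<bar>x\<bar> < R \<Longrightarrow> 0 < \<epsilon> \<Longrightarrow> \<epsilon> < e1 \<Longrightarrow> \<exists>F. disc_approx f K1 (\<delta> \<epsilon>) x \<epsilon> F"
    using assms(2) unfolding holo_approx_def by blast
  obtain K2 e2 where 2: "K2 \<ge> 0" "e2 > 0" 
    "\<And>x \<epsilon>. \<bar>x\<bar> < R \<Longrightarrow> 0 < \<epsilon> \<Longrightarrow> \<epsilon> < e2 \<Longrightarrow> \<exists>F. disc_approx g K2 (\<delta> \<epsilon>) x \<epsilon> F"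
    using assms(3) unfolding holo_approx_def by blast
  have d: "0 \<le> \<delta> \<epsilon>" if "\<epsilon> > 0" for \<epsilon> using \<delta> that by (simp add: decay_gauge_def less_imp_le)
  show thesis
  proof (rule that[of "max 1 (max K1 K2)" "min e1 e2"])
    fix x \<epsilon> :: real assume a: "\<bar>x\<bar> < R" "0 < \<epsilon>" "\<epsilon> < min e1 e2"
    show "\<exists>F. disc_approx f (max 1 (max K1 K2)) (\<delta> \<epsilon>) x \<epsilon> F"
    proof -
      obtain F where "disc_approx f K1 (\<delta> \<epsilon>) x \<epsilon> F" using 1(3)[of x \<epsilon>] a by auto
      then have "disc_approx f (max 1 (max K1 K2)) (\<delta> \<epsilon>) x \<epsilon> F"
        by (rule disc_approx_mono) (use 1(1) d[OF a(2)] in auto)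
      then show ?thesis by blast
    qed
    show "\<exists>F. disc_approx g (max 1 (max K1 K2)) (\<delta> \<epsilon>) x \<epsilon> F"
    proof -
      obtain F where "disc_approx g K2 (\<delta> \<epsilon>) x \<epsilon> F" using 2(3)[of x \<epsilon>] a by auto
      then have "disc_approx g (max 1 (max K1 K2)) (\<delta> \<epsilon>) x \<epsilon> F"
        by (rule disc_approx_mono) (use 2(1) d[OF a(2)] in auto)
      then show ?thesis by blast
    qed
  qed (use 1 2 in auto)
qed

section \<open>Products and powers of approximable functions\<close>

lemma disc_approx_mult:
  assumes F: "disc_approx f K \<eta> x \<epsilon> F" and G: "disc_approx g K \<eta> x \<epsilon> G" and K: "K \<ge> 0" and \<eta>: "0 \<le> \<eta>" "\<eta> \<le> 1"
  shows "disc_approx (\<lambda>x. f x * g x) (3 * K\<^sup>2) \<eta> x \<epsilon> (\<lambda>z. F z * G z)"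
  unfolding disc_approx_def
proof (intro conjI ballI allI impI)
  show "(\<lambda>z. F z * G z) holomorphic_on ball (of_real x) \<epsilon>"
    using F G by (auto simp: disc_approx_def intro!: holomorphic_intros)
  fix z :: complex assume "z \<in> ball (of_real x) \<epsilon>"
  then have "norm (F z * G z) \<le> K * K" unfolding norm_mult
    using F G K by (intro mult_mono) (auto simp: disc_approx_def)
  moreover have "K * K \<ge> 0" using K by simp
  ultimately show "norm (F z * G z) \<le> 3 * K\<^sup>2" unfolding power2_eq_square by linarith
next
  fix y assume y: "\<bar>y - x\<bar> < \<epsilon>"
  note b = of_real_in_ball[OF y]
  have "F y * G y - f y * g y = F y * (G y - g y) + (F y - f y) * g y" by (simp add: algebra_simps)
  then have "norm (F y * G y - f y * g y) \<le> norm (F y) * norm (G y - g y) + norm (F y - f y) * norm (g y)"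
    by (metis norm_triangle_ineq norm_mult)
  also have "\<dots> \<le> K * (K * \<eta>) + (K * \<eta>) * (2 * K)"
    using F G K \<eta> b y disc_approx_norm_le[OF G y \<eta>(2) K] unfolding disc_approx_def
    by (intro add_mono mult_mono) auto
  finally show "norm (F y * G y - f y * g y) \<le> 3 * K\<^sup>2 * \<eta>" by (simp add: power2_eq_square algebra_simps)
qed

lemma holo_approx_mult:
  assumes \<delta>: "decay_gauge \<delta>" and f: "holo_approx \<delta> R f" and g: "holo_approx \<delta> R g"
  shows "holo_approx \<delta> R (\<lambda>x. f x * g x)"
proof -
  obtain K e where K: "K \<ge> 1" "e > 0"
    and 1: "\<And>x \<epsilon>. \<bar>x\<bar> < R \<Longrightarrow> 0 < \<epsilon> \<Longrightarrow> \<epsilon> < e \<Longrightarrow> \<exists>F. disc_approx f K (\<delta> \<epsilon>) x \<epsilon> F"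
    and 2: "\<And>x \<epsilon>. \<bar>x\<bar> < R \<Longrightarrow> 0 < \<epsilon> \<Longrightarrow> \<epsilon> < e \<Longrightarrow> \<exists>F. disc_approx g K (\<delta> \<epsilon>) x \<epsilon> F"
    using holo_approx_common_constants[OF assms] by metis
  have "\<exists>F. disc_approx (\<lambda>x. f x * g x) (3 * K\<^sup>2) (\<delta> \<epsilon>) x \<epsilon> F" if a: "\<bar>x\<bar> < R" "0 < \<epsilon>" "\<epsilon> < e" for x \<epsilon>
  proof -
    have "0 \<le> \<delta> \<epsilon>" "\<delta> \<epsilon> \<le> 1" using \<delta> a(2) by (auto simp: decay_gauge_def less_imp_le)
    moreover obtain F G where "disc_approx f K (\<delta> \<epsilon>) x \<epsilon> F" "disc_approx g K (\<delta> \<epsilon>) x \<epsilon> G"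
      using 1[OF a] 2[OF a] by blast
    moreover have "K \<ge> 0" using K by simp
    ultimately show ?thesis using disc_approx_mult by blast
  qed
  then show ?thesis unfolding holo_approx_def using K by (intro exI[of _ "3 * K\<^sup>2"] exI[of _ e] conjI) auto
qed

lemma holo_approx_power:
  assumes "decay_gauge \<delta>" "holo_approx \<delta> R f"
  shows "holo_approx \<delta> R (\<lambda>x. f x ^ n)"
proof (induction n)
  case 0
  have "disc_approx (\<lambda>x. f x ^ 0) 1 (\<delta> \<epsilon>) x \<epsilon> (\<lambda>_. 1)" if "\<epsilon> > 0" for x \<epsilon>
    using assms(1) that by (auto simp: disc_approx_def decay_gauge_def less_imp_le)
  then have "\<forall>x \<epsilon>. \<bar>x\<bar> < R \<longrightarrow> 0 < \<epsilon> \<longrightarrow> \<epsilon> < 1 \<longrightarrow> (\<exists>F. disc_approx (\<lambda>x. f x ^ 0) 1 (\<delta> \<epsilon>) x \<epsilon> F)" by blast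
  then show ?case unfolding holo_approx_def by (intro exI[of _ "1::real"] conjI) auto
next
  case (Suc n)
  show ?case using holo_approx_mult[OF assms Suc.IH] by simp
qed

text \<open>After multiplication by the denominator N the error splits into three parts. Those
  coming from \<open>g\<close> and \<open>h\<close> have size \<open>r ^ 6\<close>, which survives
  division by N, at least \<open>r\<^sup>2\<close>. The regularisation part
  \<open>f * r\<^sup>2 / N\<close> is small because \<open>(norm f)\<^sup>2\<close> is at most a
  multiple of the square root of N: where the denominator is small, so is \<open>f\<close>. This
  gives order \<open>sqrt r\<close>.\<close>

lemma regularised_quotient_error:
  fixes f g h :: complex
  assumes g: "norm (g - f\<^sup>2) \<le> K * r ^ 6" "norm g \<le> K" and h: "norm (h - f ^ 3) \<le> K * r ^ 6"
    and K: "K \<ge> 1" and r: "0 < r" "r \<le> 1"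
  shows "norm (h * cnj g / of_real ((norm g)\<^sup>2 + r\<^sup>2) - f) \<le> (3 * K ^ 3 + 1 + K) * r powr (1/16)"
proof -
  define N where "N = (norm g)\<^sup>2 + r\<^sup>2"
  define M where "M = sqrt N"
  have N: "N > 0" "r\<^sup>2 \<le> N" using r by (auto simp: N_def add_nonneg_pos)
  have M: "M > 0" "M\<^sup>2 = N" "r \<le> M" "norm g \<le> M" using N r by (auto simp: M_def real_le_rsqrt N_def)
  have rp: "r ^ n \<le> r" if "n > 0" for n using r that by (metis less_imp_le power_decreasing power_one_right Suc_leI One_nat_def)
  have fM: "(norm f)\<^sup>2 \<le> (1 + K) * M"
  proof -
    have "(norm f)\<^sup>2 \<le> norm g + norm (g - f\<^sup>2)"
      by (metis norm_power norm_triangle_sub norm_minus_commute)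
    also have "\<dots> \<le> M + K * M"
      using g(1) M K rp[of 6] by (intro add_mono order_trans[OF g(1)] mult_left_mono) auto
    finally show ?thesis by (simp add: algebra_simps)
  qed
  have fK: "norm f \<le> 2 * K"
  proof -
    have "(norm f)\<^sup>2 \<le> norm g + norm (g - f\<^sup>2)"
      by (metis norm_power norm_triangle_sub norm_minus_commute)
    also have "\<dots> \<le> K + K * 1"
      using g(2) r K rp[of 6] by (intro add_mono order_trans[OF g(1)] mult_left_mono) auto
    also have "\<dots> \<le> (2 * K)\<^sup>2" using K by (simp add: power2_eq_square)
    finally show ?thesis by (rule power2_le_imp_le) (use K in simp)
  qed
  have "h * cnj g - f * of_real N = (h - f ^ 3) * cnj g + f * (f\<^sup>2 - g) * cnj g - f * of_real (r\<^sup>2)"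
    unfolding N_def of_real_add complex_norm_square by (simp add: algebra_simps power2_eq_square power3_eq_cube)
  also have "norm \<dots> \<le> norm ((h - f ^ 3) * cnj g) + norm (f * (f\<^sup>2 - g) * cnj g) + norm (f * of_real (r\<^sup>2))"
    by (meson add_right_mono norm_triangle_ineq norm_triangle_ineq4 order_trans)
  also have "\<dots> = norm (h - f ^ 3) * norm g + norm f * norm (g - f\<^sup>2) * norm g + norm f * r\<^sup>2"
    by (simp add: norm_mult norm_minus_commute norm_power)
  also have "\<dots> \<le> (K * r ^ 6) * K + (2 * K) * (K * r ^ 6) * K + norm f * r\<^sup>2"
    using g h fK K r by (intro add_mono mult_mono) auto
  finally have n: "norm (h * cnj g - f * of_real N) \<le> (K * r ^ 6) * K + (2 * K) * (K * r ^ 6) * K + norm f * r\<^sup>2" .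
  have r16: "r \<le> r powr (1/16)" "sqrt r \<le> r powr (1/16)"
    using r powr_mono'[of "1/16" 1 r] powr_mono'[of "1/16" "1/2" r] by (auto simp: powr_half_sqrt)
  have "h * cnj g / of_real N - f = (h * cnj g - f * of_real N) / of_real N" using N by (simp add: field_simps)
  then have "norm (h * cnj g / of_real N - f) = norm (h * cnj g - f * of_real N) / N"
    using N by (simp add: norm_divide)
  also have "\<dots> \<le> ((K * r ^ 6) * K + (2 * K) * (K * r ^ 6) * K + norm f * r\<^sup>2) / N"
    using n N by (simp add: divide_right_mono)
  also have "\<dots> = (K * r ^ 6) * K / N + (2 * K) * (K * r ^ 6) * K / N + norm f * r\<^sup>2 / N"
    by (simp add: add_divide_distrib)
  also have "(K * r ^ 6) * K / N + (2 * K) * (K * r ^ 6) * K / N = (K\<^sup>2 + 2 * K ^ 3) * (r ^ 6 / N)"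
    by (simp add: power2_eq_square power3_eq_cube algebra_simps add_divide_distrib)
  also have "(K\<^sup>2 + 2 * K ^ 3) * (r ^ 6 / N) \<le> (3 * K ^ 3) * r powr (1/16)"
  proof (intro mult_mono)
    have "K\<^sup>2 \<le> K ^ 3" using K by (intro power_increasing) auto
    then show "K\<^sup>2 + 2 * K ^ 3 \<le> 3 * K ^ 3" by simp
    have "r ^ 6 / N \<le> r ^ 6 / r\<^sup>2" using N r by (intro divide_left_mono) auto
    also have "\<dots> = r ^ 4" using r by (simp add: field_simps flip: power_add)
    finally show "r ^ 6 / N \<le> r powr (1/16)" using rp[of 4] r16 by linarith
  qed (use K N r in auto)
  also have "norm f * r\<^sup>2 / N \<le> (1 + K) * r powr (1/16)"
  proof -
    have "(norm f * r\<^sup>2 / N)\<^sup>2 = (norm f)\<^sup>2 * (r ^ 4 / M ^ 4)"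
      using M(2)[symmetric] by (simp add: power_divide power_mult_distrib flip: power_mult)
    also have "\<dots> \<le> ((1 + K) * M) * (r ^ 4 / M ^ 4)" using fM M r by (intro mult_right_mono) auto
    also have "\<dots> = (1 + K) * (r ^ 4 / M ^ 3)" using M by (simp add: field_simps power3_eq_cube power4_eq_xxxx)
    also have "\<dots> \<le> (1 + K) * (r ^ 4 / r ^ 3)"
      using M r K by (intro mult_left_mono divide_left_mono power_mono mult_pos_pos) auto
    also have "r ^ 4 / r ^ 3 = r" using r by (simp add: power3_eq_cube power4_eq_xxxx)
    also have "(1 + K) * r \<le> (1 + K)\<^sup>2 * r"
      using K r by (intro mult_right_mono) (auto simp: power2_eq_square)
    also have "\<dots> = ((1 + K) * sqrt r)\<^sup>2" using r by (simp add: power_mult_distrib)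
    finally have "norm f * r\<^sup>2 / N \<le> (1 + K) * sqrt r" by (rule power2_le_imp_le) (use K r in simp)
    also have "\<dots> \<le> (1 + K) * r powr (1/16)" using r16 K by (intro mult_left_mono) auto
    finally show ?thesis .
  qed
  finally show ?thesis by (simp add: N_def algebra_simps)
qed

text \<open>With M the square root of the denominator, \<open>(norm h)\<^sup>2\<close> is of order
  M^3 and \<open>norm g\<close> at most M, so the quotient is of order \<open>sqrt M\<close>. No
  value of \<open>f\<close> is involved, so the bound is available off the real axis.\<close>

lemma regularised_quotient_bound:
  fixes g h :: complex
  assumes "norm (h\<^sup>2 - g ^ 3) \<le> L * r ^ 3" "norm g \<le> L" and L: "L \<ge> 0" and r: "0 < r" "r \<le> 1"
  shows "norm (h * cnj g / of_real ((norm g)\<^sup>2 + r\<^sup>2)) \<le> (1 + L)"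
proof -
  define N where "N = (norm g)\<^sup>2 + r\<^sup>2"
  define M where "M = sqrt N"
  have N: "N > 0" "r\<^sup>2 \<le> N" using r by (auto simp: N_def add_nonneg_pos)
  have M: "M > 0" "M\<^sup>2 = N" "r \<le> M" "norm g \<le> M" using N r by (auto simp: M_def real_le_rsqrt N_def)
  have "M\<^sup>2 \<le> (1 + L)\<^sup>2"
    unfolding M(2) N_def using power_mono[OF assms(2), of 2] power_mono[OF r(2), of 2] r L by (simp add: power2_eq_square algebra_simps)
  then have M_le: "M \<le> 1 + L" by (rule power2_le_imp_le) (use L in simp)
  have "(norm h)\<^sup>2 \<le> norm (h\<^sup>2 - g ^ 3) + norm (g ^ 3)"
    by (metis norm_power norm_triangle_sub add.commute)
  also have "\<dots> \<le> L * M ^ 3 + M ^ 3"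
    using assms(1) M r L by (intro add_mono order_trans[OF assms(1)] mult_left_mono) (auto simp: norm_power power_mono)
  finally have h: "(norm h)\<^sup>2 \<le> (1 + L) * M ^ 3" by (simp add: algebra_simps)
  have "(norm (h * cnj g / of_real N))\<^sup>2 = (norm h)\<^sup>2 * ((norm g)\<^sup>2 / M ^ 4)"
    using N(1) M(2)[symmetric] by (simp add: norm_mult norm_divide norm_power power_divide power_mult_distrib flip: power_mult)
  also have "\<dots> \<le> ((1 + L) * M ^ 3) * (M\<^sup>2 / M ^ 4)"
    using h M L by (intro mult_mono divide_right_mono power_mono) auto
  also have "\<dots> = (1 + L) * M" using M(1) by (simp add: field_simps power2_eq_square power3_eq_cube power4_eq_xxxx)
  also have "\<dots> \<le> (1 + L) * (1 + L)" using M_le L by (intro mult_left_mono) auto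
  finally have "(norm (h * cnj g / of_real N))\<^sup>2 \<le> (1 + L)\<^sup>2" by (simp add: power2_eq_square)
  then show ?thesis unfolding N_def by (rule power2_le_imp_le) (use L in simp)
qed

text \<open>Origin of the constants: from radius \<open>32 * \<epsilon>\<close>,
  \<open>two_constants\<close> passes to \<open>8 * \<epsilon>\<close>, which is the disc
  \<open>ball 0 2\<close> in units of \<open>4 * \<epsilon>\<close>, and
  \<open>approximate_quotient\<close> passes to a disc of radius \<open>1/4\<close> in these units,
  that is \<open>\<epsilon>\<close>. The exponent \<open>1/96\<close> is \<open>1/6 * 1/16\<close>:
  taking \<open>r\<close> as the sixth root of the error turns the loss of
  \<open>two_constants\<close> into the required \<open>r ^ 3\<close>, and the quotient is accurate
  to \<open>r powr (1/16)\<close>.\<close>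

lemma holo_approx_of_square_and_cube:
  assumes \<delta>: "decay_gauge \<delta>" and f2: "holo_approx \<delta> R (\<lambda>x. (f x)\<^sup>2)" and f3: "holo_approx \<delta> R (\<lambda>x. f x ^ 3)"
  shows "holo_approx (\<lambda>\<epsilon>. \<delta> (32 * \<epsilon>) powr (1/96)) R f"
proof -
  obtain K e where K: "K \<ge> 1" "e > 0"
    and 2: "\<And>x \<epsilon>. \<bar>x\<bar> < R \<Longrightarrow> 0 < \<epsilon> \<Longrightarrow> \<epsilon> < e \<Longrightarrow> \<exists>F. disc_approx (\<lambda>x. (f x)\<^sup>2) K (\<delta> \<epsilon>) x \<epsilon> F"
    and 3: "\<And>x \<epsilon>. \<bar>x\<bar> < R \<Longrightarrow> 0 < \<epsilon> \<Longrightarrow> \<epsilon> < e \<Longrightarrow> \<exists>F. disc_approx (\<lambda>x. f x ^ 3) K (\<delta> \<epsilon>) x \<epsilon> F"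
    using holo_approx_common_constants[OF \<delta> f2 f3] by metis
  define L where "L = 10 * K ^ 3"
  have KL: "K \<le> L" "L \<ge> 0"
  proof -
    have "K ^ 1 \<le> K ^ 3" using K by (intro power_increasing) auto
    then show "K \<le> L" "L \<ge> 0" using K by (auto simp: L_def)
  qed
  define C where "C = 320 * (1 + L) * (L\<^sup>2 + 1)"
  have C: "C \<ge> 0" using KL by (simp add: C_def)
  define K' where "K' = C + (3 * K ^ 3 + 1 + K) + (1 + L)"
  have "\<exists>F. disc_approx f K' (\<delta> (32 * \<epsilon>) powr (1/96)) x \<epsilon> F" if x: "\<bar>x\<bar> < R" and \<epsilon>: "0 < \<epsilon>" "\<epsilon> < e / 32" for x \<epsilon>
  proof -
    define \<eta> where "\<eta> = 32 * \<epsilon>"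
    define d where "d = \<delta> \<eta>"
    have \<eta>: "\<eta> > 0" "\<eta> < e" using \<epsilon> by (auto simp: \<eta>_def)
    have d: "0 < d" "d \<le> 1" using \<delta> \<eta> by (auto simp: d_def decay_gauge_def)
    define r where "r = d powr (1/6)"
    have r: "0 < r" "r \<le> 1" using d powr_mono2[of "1/6" d 1] by (auto simp: r_def)
    have r6: "r ^ 6 = d" and r3: "r ^ 3 = sqrt d" and r16: "r powr (1/16) = d powr (1/96)"
      unfolding r_def using d by (auto simp: powr_powr powr_half_sqrt[symmetric] simp flip: powr_realpow)
    obtain G where G: "disc_approx (\<lambda>x. (f x)\<^sup>2) K d x \<eta> G" using 2[OF x \<eta>] d_def by auto
    obtain H where H: "disc_approx (\<lambda>x. f x ^ 3) K d x \<eta> H" using 3[OF x \<eta>] d_def by auto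
    have holG: "G holomorphic_on ball (of_real x) \<eta>" and holH: "H holomorphic_on ball (of_real x) \<eta>"
      and bG: "\<And>z. z \<in> ball (of_real x) \<eta> \<Longrightarrow> norm (G z) \<le> K" and bH: "\<And>z. z \<in> ball (of_real x) \<eta> \<Longrightarrow> norm (H z) \<le> K"
      and aG: "\<And>y. \<bar>y - x\<bar> < \<eta> \<Longrightarrow> norm (G (of_real y) - (f y)\<^sup>2) \<le> K * d"
      and aH: "\<And>y. \<bar>y - x\<bar> < \<eta> \<Longrightarrow> norm (H (of_real y) - f y ^ 3) \<le> K * d"
      using G H by (auto simp: disc_approx_def)
    have GH: "norm ((H z)\<^sup>2 - (G z) ^ 3) \<le> L * r ^ 3" if z: "z \<in> cball (of_real x) (\<eta> / 4)" for z
      unfolding r3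
    proof (rule two_constants[OF _ \<eta>(1) _ _ d z])
      show "(\<lambda>z. (H z)\<^sup>2 - (G z) ^ 3) holomorphic_on ball (of_real x) \<eta>"
        by (intro holomorphic_intros holG holH)
      fix w :: complex assume w: "w \<in> ball (of_real x) \<eta>"
      have "norm ((H w)\<^sup>2 - (G w) ^ 3) \<le> norm (H w) ^ 2 + norm (G w) ^ 3"
        by (metis norm_power norm_triangle_ineq4)
      also have "\<dots> \<le> K ^ 2 + K ^ 3" using bG[OF w] bH[OF w] by (intro add_mono power_mono) auto
      also have "K ^ 2 \<le> K ^ 3" using K by (intro power_increasing) auto
      finally show "norm ((H w)\<^sup>2 - (G w) ^ 3) \<le> L" using K zero_le_power[of K 3] unfolding L_def by linarith
    next
      fix y assume y: "\<bar>y - x\<bar> < \<eta>"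
      define a b c where "a = G (of_real y)" and "b = H (of_real y)" and "c = f y"
      have n: "norm a \<le> K" "norm b \<le> K" "norm (a - c\<^sup>2) \<le> K * d" "norm (b - c ^ 3) \<le> K * d"
        using bG bH of_real_in_ball[OF y] aG[OF y] aH[OF y] by (auto simp: a_def b_def c_def)
      have c2: "norm (c\<^sup>2) \<le> 2 * K" and c3: "norm (c ^ 3) \<le> 2 * K"
        using disc_approx_norm_le[OF G y d(2)] disc_approx_norm_le[OF H y d(2)] K by (auto simp: c_def)
      \<comment> \<open>Both \<open>(c ^ 3)\<^sup>2\<close> and \<open>(c\<^sup>2) ^ 3\<close> are
        \<open>c ^ 6\<close>, so the difference is governed by the two approximation errors. The
        remaining factors are bounded through \<open>c\<^sup>2\<close> and \<open>c ^ 3\<close>,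
        never through \<open>c\<close>.\<close>
      have "b\<^sup>2 - a ^ 3 = (b - c ^ 3) * (b + c ^ 3) - (a - c\<^sup>2) * (a * a + a * c\<^sup>2 + c\<^sup>2 * c\<^sup>2)"
        by (simp add: power2_eq_square power3_eq_cube algebra_simps)
      then have "norm (b\<^sup>2 - a ^ 3) \<le> norm (b - c ^ 3) * norm (b + c ^ 3) + norm (a - c\<^sup>2) * norm (a * a + a * c\<^sup>2 + c\<^sup>2 * c\<^sup>2)"
        by (metis norm_triangle_ineq4 norm_mult)
      also have "\<dots> \<le> (K * d) * (K + 2 * K) + (K * d) * (K * K + K * (2 * K) + (2 * K) * (2 * K))"
      proof (intro add_mono mult_mono n)
        show "norm (b + c ^ 3) \<le> K + 2 * K" using n c3 by (intro norm_triangle_le add_mono)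
        show "norm (a * a + a * c\<^sup>2 + c\<^sup>2 * c\<^sup>2) \<le> K * K + K * (2 * K) + (2 * K) * (2 * K)"
          using n c2 K by (intro norm_triangle_le add_mono order_trans[OF norm_mult_ineq] mult_mono) auto
      qed (use K d in auto)
      also have "\<dots> = (3 * K\<^sup>2 + 7 * K ^ 3) * d" by (simp add: power2_eq_square power3_eq_cube algebra_simps)
      also have "\<dots> \<le> L * d"
      proof (intro mult_right_mono)
        have "K\<^sup>2 \<le> K ^ 3" using K by (intro power_increasing) auto
        then show "3 * K\<^sup>2 + 7 * K ^ 3 \<le> L" by (simp add: L_def)
      qed (use d in simp)
      finally show "norm ((H (of_real y))\<^sup>2 - (G (of_real y)) ^ 3) \<le> L * d" by (simp add: a_def b_def)
    qed
    define A where "A = (\<lambda>w::complex. of_real x + of_real (4 * \<epsilon>) * w)"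
    have Ab: "A w \<in> cball (of_real x) (\<eta> / 4)" if "w \<in> ball 0 2" for w
    proof -
      have "dist (of_real x) (A w) = 4 * \<epsilon> * norm w" using \<epsilon> by (simp add: A_def dist_norm norm_mult)
      then show ?thesis using that \<epsilon> by (simp add: \<eta>_def)
    qed
    have Ab': "A w \<in> ball (of_real x) \<eta>" if "w \<in> ball 0 2" for w using Ab[OF that] \<eta> by auto
    have hA: "A holomorphic_on ball 0 2" unfolding A_def by (intro holomorphic_intros)
    have holA: "(\<lambda>w. \<Phi> (A w)) holomorphic_on ball 0 2" if "\<Phi> holomorphic_on ball (of_real x) \<eta>" for \<Phi>
      using holomorphic_on_compose_gen[OF hA that] Ab' by (simp only: o_def image_subset_iff) blast
    obtain \<Phi> where \<Phi>: "\<Phi> holomorphic_on ball 0 (1/4)" and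
      \<Phi>u: "\<And>w. w \<in> ball 0 (1/4) \<Longrightarrow> norm (\<Phi> w - H (A w) * cnj (G (A w)) / of_real ((norm (G (A w)))\<^sup>2 + r\<^sup>2))
        \<le> C * r powr (1/16)"
    proof -
      have "norm (G (A w)) \<le> L" if "w \<in> ball 0 2" for w using bG[OF Ab'[OF that]] KL by linarith
      from approximate_quotient[OF holA[OF holG] holA[OF holH] this GH[OF Ab] r] show thesis
        using that unfolding C_def by blast
    qed
    define F where "F = (\<lambda>z. \<Phi> ((z - of_real x) / of_real (4 * \<epsilon>)))"
    have w: "(z - of_real x) / of_real (4 * \<epsilon>) \<in> ball 0 (1/4)" if "z \<in> ball (of_real x) \<epsilon>" for z :: complex
      using that \<epsilon> by (simp add: dist_norm norm_divide norm_mult norm_minus_commute field_simps)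
    have Aw: "A ((z - of_real x) / of_real (4 * \<epsilon>)) = z" for z using \<epsilon> by (simp add: A_def)
    have Fu: "norm (F z - H z * cnj (G z) / of_real ((norm (G z))\<^sup>2 + r\<^sup>2)) \<le> C * r powr (1/16)"
      if "z \<in> ball (of_real x) \<epsilon>" for z
      using \<Phi>u[OF w[OF that]] unfolding Aw F_def .
    have sub: "ball (of_real x) \<epsilon> \<subseteq> cball (complex_of_real x) (\<eta> / 4)" "ball (of_real x) \<epsilon> \<subseteq> ball (complex_of_real x) \<eta>"
      using \<epsilon> by (auto simp: \<eta>_def)
    have rp: "0 \<le> r powr (1/16)" "r powr (1/16) \<le> 1" using r powr_mono2[of "1/16" r 1] by auto
    have "disc_approx f K' (d powr (1/96)) x \<epsilon> F"
      unfolding disc_approx_def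
    proof (intro conjI ballI allI impI)
      show "F holomorphic_on ball (of_real x) \<epsilon>"
      proof -
        have "(\<lambda>z. (z - of_real x) / of_real (4 * \<epsilon>)) holomorphic_on ball (of_real x) \<epsilon>"
          using \<epsilon> by (intro holomorphic_intros) auto
        from holomorphic_on_compose_gen[OF this \<Phi>] w show ?thesis
          unfolding F_def by (simp only: o_def image_subset_iff) blast
      qed
      fix z :: complex assume z: "z \<in> ball (of_real x) \<epsilon>"
      have "norm (H z * cnj (G z) / of_real ((norm (G z))\<^sup>2 + r\<^sup>2)) \<le> 1 + L"
      proof (rule regularised_quotient_bound[OF GH _ KL(2) r])
        show "z \<in> cball (of_real x) (\<eta> / 4)" using z sub(1) by blast
        have "z \<in> ball (of_real x) \<eta>" using z sub(2) by blast
        from bG[OF this] KL(1) show "norm (G z) \<le> L" by linarith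
      qed
      moreover have "C * r powr (1/16) \<le> C * 1" using rp C by (intro mult_left_mono)
      ultimately have "norm (F z) \<le> C + (1 + L)"
        using Fu[OF z] norm_triangle_ineq2[of "F z" "H z * cnj (G z) / of_real ((norm (G z))\<^sup>2 + r\<^sup>2)"] by linarith
      then show "norm (F z) \<le> K'" using K zero_le_power[of K 3] unfolding K'_def by linarith
    next
      fix y assume y: "\<bar>y - x\<bar> < \<epsilon>"
      then have y\<eta>: "\<bar>y - x\<bar> < \<eta>" using \<epsilon> by (simp add: \<eta>_def)
      define q where "q = H (of_real y) * cnj (G (of_real y)) / of_real ((norm (G (of_real y)))\<^sup>2 + r\<^sup>2)"
      have "norm (q - f y) \<le> (3 * K ^ 3 + 1 + K) * r powr (1/16)"
        unfolding q_def by (rule regularised_quotient_error)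
          (use aG[OF y\<eta>] aH[OF y\<eta>] bG[OF of_real_in_ball[OF y\<eta>]] r6 K r in auto)
      moreover have "norm (F (of_real y) - q) \<le> C * r powr (1/16)"
        unfolding q_def by (rule Fu[OF of_real_in_ball[OF y]])
      ultimately have "norm (F (of_real y) - f y) \<le> (C + (3 * K ^ 3 + 1 + K)) * r powr (1/16)"
        using norm_triangle_ineq[of "F (of_real y) - q" "q - f y"] by (simp add: distrib_right)
      also have "\<dots> \<le> K' * r powr (1/16)"
        using KL rp unfolding K'_def by (intro mult_right_mono) auto
      finally show "norm (F (of_real y) - f y) \<le> K' * d powr (1/96)" unfolding r16 .
    qed
    then show ?thesis unfolding d_def \<eta>_def by blast
  qed
  moreover have "K' \<ge> 0" unfolding K'_def using C K KL by simp
  ultimately show ?thesis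
    unfolding holo_approx_def using K by (intro exI[of _ K'] exI[of _ "e / 32"] conjI) auto
qed

section \<open>Descent from high powers to the function itself\<close>

lemma decay_gauge_rescale:
  assumes "decay_gauge \<delta>" "A > 0" "k > 0"
  shows "decay_gauge (\<lambda>\<epsilon>. \<delta> (A * \<epsilon>) powr k)"
  unfolding decay_gauge_def
proof (intro conjI allI impI)
  have \<delta>: "0 < \<delta> (A * \<epsilon>)" "\<delta> (A * \<epsilon>) \<le> 1" if "\<epsilon> > 0" for \<epsilon>
    using assms that by (simp_all add: decay_gauge_def)
  show "0 < \<delta> (A * \<epsilon>) powr k" "\<delta> (A * \<epsilon>) powr k \<le> 1" if "\<epsilon> > 0" for \<epsilon>
    using \<delta>[OF that] assms(3) powr_mono2[of k "\<delta> (A * \<epsilon>)" 1] by auto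
  fix \<epsilon> \<epsilon>' :: real assume e: "0 < \<epsilon>" "\<epsilon> \<le> \<epsilon>'"
  then have "\<delta> (A * \<epsilon>) \<le> \<delta> (A * \<epsilon>')" using assms by (simp add: decay_gauge_def)
  then show "\<delta> (A * \<epsilon>) powr k \<le> \<delta> (A * \<epsilon>') powr k"
    using \<delta>[OF e(1)] assms(3) by (intro powr_mono2) auto
qed

text \<open>The largest exponent still missing is q = p; its multiples 2q and 3q exceed q, so
  \<open>f ^ q\<close> is recovered from its square and cube. The powers already available carry
  over because the new gauge is larger than the old one.\<close>

lemma holo_approx_descent:
  assumes "decay_gauge \<delta>" "\<And>m. m > p \<Longrightarrow> holo_approx \<delta> R (\<lambda>x. f x ^ m)"
  shows "holo_approx (\<lambda>\<epsilon>. \<delta> (32 ^ p * \<epsilon>) powr ((1/96) ^ p)) R f"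
  using assms
proof (induction p arbitrary: \<delta>)
  case 0
  then have "holo_approx \<delta> R f" using "0.prems"(2)[of 1] by simp
  then show ?case
    by (rule holo_approx_mono) (use "0.prems"(1) in \<open>auto simp: decay_gauge_def less_imp_le\<close>)
next
  case (Suc p)
  define \<delta>' where "\<delta>' = (\<lambda>\<epsilon>. \<delta> (32 * \<epsilon>) powr (1/96))"
  have \<delta>': "decay_gauge \<delta>'" unfolding \<delta>'_def using Suc.prems(1) by (rule decay_gauge_rescale) auto
  have "holo_approx \<delta>' R (\<lambda>x. f x ^ m)" if m: "m > p" for m
  proof (cases "m = Suc p")
    case False
    have "holo_approx \<delta> R (\<lambda>x. f x ^ m)" using False m by (intro Suc.prems(2)) simp
    then show ?thesis
    proof (rule holo_approx_mono)
      fix \<epsilon> :: real assume \<epsilon>: "\<epsilon> > 0"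
      have a: "0 < \<delta> \<epsilon>" "\<delta> \<epsilon> \<le> \<delta> (32 * \<epsilon>)" "0 < \<delta> (32 * \<epsilon>)" "\<delta> (32 * \<epsilon>) \<le> 1"
        using Suc.prems(1) \<epsilon> by (auto simp: decay_gauge_def)
      then have "\<delta> (32 * \<epsilon>) powr 1 \<le> \<delta> (32 * \<epsilon>) powr (1/96)" by (intro powr_mono') auto
      then show "0 \<le> \<delta> \<epsilon> \<and> \<delta> \<epsilon> \<le> \<delta>' \<epsilon>" using a by (simp add: \<delta>'_def)
    qed
  next
    case True
    have "holo_approx \<delta> R (\<lambda>x. (f x ^ m)\<^sup>2)" "holo_approx \<delta> R (\<lambda>x. (f x ^ m) ^ 3)"
      unfolding power_mult[symmetric] by (rule Suc.prems(2); simp add: True)+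
    then show ?thesis unfolding \<delta>'_def by (rule holo_approx_of_square_and_cube[OF Suc.prems(1)])
  qed
  from Suc.IH[OF \<delta>' this] show ?case unfolding \<delta>'_def by (simp add: powr_powr mult_ac)
qed

text \<open>An exponent m is \<open>j * a + (j + 1) * b\<close> with \<open>b = m mod j\<close> as
  soon as b does not exceed \<open>m div j\<close>. Beyond \<open>j * j\<close> this always holds,
  so the number of descent steps depends on \<open>j\<close> alone.\<close>

theorem holo_approx_of_consecutive_powers:
  assumes \<delta>: "decay_gauge \<delta>" and "holo_approx \<delta> R (\<lambda>x. f x ^ j)" "holo_approx \<delta> R (\<lambda>x. f x ^ (j + 1))" "j \<ge> 1"
  shows "holo_approx (\<lambda>\<epsilon>. \<delta> (32 ^ (j * j) * \<epsilon>) powr ((1/96) ^ (j * j))) R f"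
proof (rule holo_approx_descent[OF \<delta>])
  fix m assume m: "m > j * j"
  define b where "b = m mod j"
  define a where "a = m div j - b"
  have "b < j" using assms(4) by (simp add: b_def)
  moreover have "j \<le> m div j" using m assms(4) by (simp add: less_eq_div_iff_mult_less_eq)
  ultimately have ab: "a + b = m div j" by (simp add: a_def)
  have "m = j * (m div j) + b" by (simp add: b_def)
  also have "\<dots> = j * a + (j + 1) * b" unfolding ab[symmetric] by (simp add: algebra_simps)
  finally have "(\<lambda>x. f x ^ m) = (\<lambda>x. (f x ^ j) ^ a * (f x ^ (j + 1)) ^ b)"
    by (simp only: power_add[of _ "j * a"] power_mult)
  then show "holo_approx \<delta> R (\<lambda>x. f x ^ m)"
    using holo_approx_mult[OF \<delta> holo_approx_power[OF \<delta> assms(2), of a] holo_approx_power[OF \<delta> assms(3), of b]] by simp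
qed

section \<open>From approximation to derivative bounds\<close>

lemma geometric_telescope:
  fixes a :: "nat \<Rightarrow> complex"
  assumes "\<And>k. norm (a (Suc k) - a k) \<le> M * (1/4) ^ k"
  shows "\<exists>l. a \<longlonglongrightarrow> l \<and> (\<forall>k. norm (l - a k) \<le> 2 * M * (1/4) ^ k)"
proof -
  have M: "M \<ge> 0" using order_trans[OF norm_ge_zero assms[of 0]] by simp
  have d: "norm (a (k + m) - a k) \<le> (4/3) * (M * (1/4) ^ k) * (1 - (1/4) ^ m)" for k m
  proof (induction m)
    case (Suc m)
    have "norm (a (k + Suc m) - a k) \<le> norm (a (Suc (k + m)) - a (k + m)) + norm (a (k + m) - a k)"
      using norm_triangle_ineq[of "a (Suc (k + m)) - a (k + m)" "a (k + m) - a k"] by simp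
    also have "\<dots> \<le> M * (1/4) ^ (k + m) + (4/3) * (M * (1/4) ^ k) * (1 - (1/4) ^ m)"
      by (intro add_mono assms Suc.IH)
    also have "\<dots> = (4/3) * (M * (1/4) ^ k) * (1 - (1/4) ^ Suc m)"
      by (simp add: power_add field_simps)
    finally show ?case .
  qed simp
  have d2: "norm (a (k + m) - a k) \<le> 2 * M * (1/4) ^ k" for k m
  proof -
    have "(4/3) * (M * (1/4) ^ k) * (1 - (1/4) ^ m) \<le> (4/3) * (M * (1/4) ^ k) * 1"
      using M by (intro mult_left_mono) auto
    also have "\<dots> \<le> 2 * M * (1/4) ^ k" using M by simp
    finally show ?thesis using d[of k m] by linarith
  qed
  have "Cauchy a"
  proof (rule metric_CauchyI)
    fix e :: real assume "e > 0"
    have "(\<lambda>k. 4 * M * (1/4) ^ k) \<longlonglongrightarrow> 4 * M * 0" by (intro tendsto_intros LIMSEQ_power_zero) auto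
    then have "eventually (\<lambda>k. 4 * M * (1/4) ^ k < e) sequentially"
      using \<open>e > 0\<close> by (intro order_tendstoD(2)) auto
    then obtain k where k: "4 * M * (1/4) ^ k < e" by (auto simp: eventually_sequentially)
    have "dist (a m) (a n) < e" if "m \<ge> k" "n \<ge> k" for m n
    proof -
      have "dist (a m) (a n) \<le> norm (a m - a k) + norm (a n - a k)"
        by (metis dist_norm dist_triangle2)
      also have "\<dots> \<le> 2 * M * (1/4) ^ k + 2 * M * (1/4) ^ k"
        using d2[of k "m - k"] d2[of k "n - k"] that by (intro add_mono) auto
      finally show ?thesis using k by simp
    qed
    then show "\<exists>k. \<forall>m\<ge>k. \<forall>n\<ge>k. dist (a m) (a n) < e" by blast
  qed
  then obtain l where l: "a \<longlonglongrightarrow> l" using Cauchy_convergent_iff convergent_def by blast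
  have "norm (l - a k) \<le> 2 * M * (1/4) ^ k" for k
  proof (rule tendsto_upperbound)
    have "(\<lambda>m. a (m + k)) \<longlonglongrightarrow> l" using l by (rule LIMSEQ_ignore_initial_segment)
    then show "(\<lambda>m. norm (a (m + k) - a k)) \<longlonglongrightarrow> norm (l - a k)" by (intro tendsto_intros)
    show "\<forall>\<^sub>F m in sequentially. norm (a (m + k) - a k) \<le> 2 * M * (1/4) ^ k"
      using d2[of k] by (simp add: add.commute)
  qed simp
  with l show ?thesis by blast
qed

lemma has_vector_derivative_of_quadratic_error:
  fixes g :: "real \<Rightarrow> complex"
  assumes "h > 0" and e: "\<And>y. \<bar>y - x\<bar> \<le> h \<Longrightarrow> norm (g y - g x - of_real (y - x) * L) \<le> C * (y - x)\<^sup>2"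
  shows "(g has_vector_derivative L) (at x)"
  unfolding has_vector_derivative_def has_derivative_at_within
proof (intro conjI)
  show "bounded_linear (\<lambda>x. x *\<^sub>R L)" by (rule bounded_linear_scaleR_left)
  have "((\<lambda>y. C * \<bar>y - x\<bar>) \<longlongrightarrow> C * \<bar>x - x\<bar>) (at x)" by (intro tendsto_intros)
  then have lim: "((\<lambda>y. C * \<bar>y - x\<bar>) \<longlongrightarrow> 0) (at x)" by simp
  show "((\<lambda>y. (g y - g x - (y - x) *\<^sub>R L) /\<^sub>R norm (y - x)) \<longlongrightarrow> 0) (at x)"
  proof (rule Lim_null_comparison[OF _ lim])
    have "\<forall>\<^sub>F y in at x. dist y x < h" using assms(1) eventually_at_ball'[of h x UNIV] by (auto simp: eventually_at dist_commute intro!: exI[of _ h])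
    then show "\<forall>\<^sub>F y in at x. norm ((g y - g x - (y - x) *\<^sub>R L) /\<^sub>R norm (y - x)) \<le> C * \<bar>y - x\<bar>"
    proof eventually_elim
      case (elim y)
      have "norm (g y - g x - (y - x) *\<^sub>R L) \<le> C * (y - x)\<^sup>2"
        using e[of y] elim by (simp add: dist_norm scaleR_conv_of_real)
      also have "\<dots> = C * \<bar>y - x\<bar> * \<bar>y - x\<bar>" by (simp add: power2_eq_square)
      finally have *: "norm (g y - g x - (y - x) *\<^sub>R L) \<le> C * \<bar>y - x\<bar> * \<bar>y - x\<bar>" .
      have "norm ((g y - g x - (y - x) *\<^sub>R L) /\<^sub>R norm (y - x)) = norm (g y - g x - (y - x) *\<^sub>R L) / \<bar>y - x\<bar>"
        by (simp only: norm_scaleR real_norm_def abs_inverse abs_idempotent divide_inverse mult.commute)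
      also have "\<dots> \<le> C * \<bar>y - x\<bar> * \<bar>y - x\<bar> / \<bar>y - x\<bar>" by (intro divide_right_mono *) simp
      also have "\<dots> = C * \<bar>y - x\<bar>" by (cases "y = x") auto
      finally show ?case .
    qed
  qed
qed

lemma dyadic_scale_exists:
  fixes h e :: real
  assumes "0 < h" "h \<le> e"
  shows "\<exists>k. h \<le> e / 2 ^ k \<and> e / 2 ^ k < 2 * h"
proof -
  have "\<exists>k. e / 2 ^ k < 2 * h"
  proof -
    obtain k where "e / (2 * h) < 2 ^ k" using real_arch_pow[of 2 "e / (2 * h)"] by auto
    then show ?thesis using assms by (intro exI[of _ k]) (simp add: field_simps)
  qed
  define k where "k = (LEAST k. e / 2 ^ k < 2 * h)"
  have k: "e / 2 ^ k < 2 * h" unfolding k_def using \<open>\<exists>k. _\<close> by (rule LeastI_ex)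
  have "h \<le> e / 2 ^ k"
  proof (cases k)
    case (Suc m)
    then have "\<not> e / 2 ^ m < 2 * h" unfolding k_def using not_less_Least[of m] by (metis lessI)
    then show ?thesis using Suc by simp
  qed (use assms in simp)
  with k show ?thesis by blast
qed

text \<open>Both functions approximate the same \<open>f\<close> on the real diameter of the disc of
  radius \<open>\<epsilon> / 2\<close> about \<open>y\<close>. \<open>two_constants\<close> makes
  their difference small on radius \<open>\<epsilon> / 8\<close>, with \<open>sqrt d\<close> in
  place of \<open>d\<close>, and Cauchy's inequality on radius \<open>\<epsilon> / 16\<close> gives
  the factor \<open>16 / \<epsilon>\<close> per derivative.\<close>

lemma disc_approx_deriv_diff_le:
  assumes F: "disc_approx f K d x \<epsilon> F" and G: "disc_approx f K d' y \<epsilon>' G"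
    and xy: "\<bar>x - y\<bar> \<le> \<epsilon> / 2" and \<epsilon>: "\<epsilon> > 0" "\<epsilon> / 2 \<le> \<epsilon>'" and d: "0 < d" "d' \<le> d" "d \<le> 1" and K: "K \<ge> 0"
  shows "norm ((deriv ^^ n) F (of_real y) - (deriv ^^ n) G (of_real y)) \<le> 2 * K * (fact n * (16 / \<epsilon>) ^ n * sqrt d)"
proof -
  have sF: "ball (of_real y) (\<epsilon> / 2) \<subseteq> ball (complex_of_real x) \<epsilon>"
  proof
    fix z :: complex assume "z \<in> ball (of_real y) (\<epsilon> / 2)"
    moreover have "dist (complex_of_real x) (of_real y) \<le> \<epsilon> / 2" using xy by (simp add: dist_norm flip: of_real_diff)
    ultimately show "z \<in> ball (of_real x) \<epsilon>" using dist_triangle[of "complex_of_real x" z "of_real y"] by simp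
  qed
  have sG: "ball (of_real y) (\<epsilon> / 2) \<subseteq> ball (complex_of_real y) \<epsilon>'" using \<epsilon> by auto
  have holF: "F holomorphic_on ball (of_real y) (\<epsilon> / 2)" and holG: "G holomorphic_on ball (of_real y) (\<epsilon> / 2)"
    using F G sF sG by (auto simp: disc_approx_def intro: holomorphic_on_subset)
  have b: "norm (F z - G z) \<le> 2 * K * sqrt d" if "z \<in> cball (of_real y) (\<epsilon> / 2 / 4)" for z
  proof (rule two_constants[OF _ _ _ _ d(1,3) that])
    show "(\<lambda>z. F z - G z) holomorphic_on ball (of_real y) (\<epsilon> / 2)" by (intro holomorphic_intros holF holG)
    fix z :: complex assume z: "z \<in> ball (of_real y) (\<epsilon> / 2)"
    then have "norm (F z) \<le> K" "norm (G z) \<le> K" using F G sF sG by (auto simp: disc_approx_def)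
    then show "norm (F z - G z) \<le> 2 * K" using norm_triangle_ineq4[of "F z" "G z"] by linarith
  next
    fix t assume t: "\<bar>t - y\<bar> < \<epsilon> / 2"
    then have "\<bar>t - x\<bar> < \<epsilon>" "\<bar>t - y\<bar> < \<epsilon>'" using xy \<epsilon> by linarith+
    then have "norm (F (of_real t) - f t) \<le> K * d" "norm (G (of_real t) - f t) \<le> K * d'"
      using F G by (auto simp: disc_approx_def)
    moreover have "K * d' \<le> K * d" using d K by (intro mult_left_mono) auto
    ultimately show "norm (F (of_real t) - G (of_real t)) \<le> 2 * K * d"
      using norm_triangle_ineq4[of "F (of_real t) - f t" "G (of_real t) - f t"] by simp
  qed (use \<epsilon> in simp)
  have sub: "cball (of_real y) (\<epsilon> / 16) \<subseteq> ball (complex_of_real y) (\<epsilon> / 2)" using \<epsilon> by auto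
  have "norm ((deriv ^^ n) (\<lambda>z. F z - G z) (of_real y)) \<le> fact n * (2 * K * sqrt d) / (\<epsilon> / 16) ^ n"
  proof (rule Cauchy_inequality)
    show "(\<lambda>z. F z - G z) holomorphic_on ball (of_real y) (\<epsilon> / 16)"
      by (rule holomorphic_on_subset[of _ "ball (of_real y) (\<epsilon> / 2)"]) (use \<epsilon> in \<open>auto intro!: holomorphic_intros holF holG\<close>)
    show "continuous_on (cball (of_real y) (\<epsilon> / 16)) (\<lambda>z. F z - G z)"
      by (intro holomorphic_on_imp_continuous_on holomorphic_intros holomorphic_on_subset[OF holF sub] holomorphic_on_subset[OF holG sub])
    show "norm (F z - G z) \<le> 2 * K * sqrt d" if "norm (of_real y - z) = \<epsilon> / 16" for z
      by (rule b) (use that \<epsilon> in \<open>simp add: dist_norm\<close>)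
  qed (use \<epsilon> in simp)
  also have "(deriv ^^ n) (\<lambda>z. F z - G z) (of_real y) = (deriv ^^ n) F (of_real y) - (deriv ^^ n) G (of_real y)"
    by (rule higher_deriv_diff[OF holF holG]) (use \<epsilon> in auto)
  also have "fact n * (2 * K * sqrt d) / (\<epsilon> / 16) ^ n = 2 * K * (fact n * (16 / \<epsilon>) ^ n * sqrt d)"
    using \<epsilon> by (simp add: power_divide field_simps)
  finally show ?thesis .
qed

text \<open>The n-th derivative is defined as the limit of the n-th derivatives of the approximants
  at dyadic radii. The factor \<open>\<epsilon>\<^sup>2\<close> in the hypothesis has two uses: it
  makes the telescoping series geometric, and it makes all comparison errors quadratic in the
  increment when the limits are shown to be derivatives of each other.\<close>

theorem holo_approx_imp_derivs:
  assumes \<delta>: "decay_gauge \<delta>" and f: "holo_approx \<delta> R f" and e0: "e0 > 0"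
    and c: "\<And>n \<epsilon>. 0 < \<epsilon> \<Longrightarrow> \<epsilon> \<le> e0 \<Longrightarrow> fact n * (16 / \<epsilon>) ^ n * sqrt (\<delta> \<epsilon>) \<le> c n * \<epsilon>\<^sup>2"
  shows "\<exists>D C. derivs_on (ball 0 R) f D \<and> (\<forall>x\<in>ball 0 R. \<forall>n. norm (D n x) \<le> C * c n)"
proof -
  obtain K e where K: "K \<ge> 0" "e > 0"
    and ex: "\<And>x \<epsilon>. \<bar>x\<bar> < R \<Longrightarrow> 0 < \<epsilon> \<Longrightarrow> \<epsilon> < e \<Longrightarrow> \<exists>F. disc_approx f K (\<delta> \<epsilon>) x \<epsilon> F"
    using f unfolding holo_approx_def by blast
  define F where "F = (\<lambda>x \<epsilon>. SOME F. disc_approx f K (\<delta> \<epsilon>) x \<epsilon> F)"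
  define e1 where "e1 = min e e0 / 2"
  have e1: "e1 > 0" "e1 < e" "e1 \<le> e0" using K e0 by (auto simp: e1_def)
  have F: "disc_approx f K (\<delta> \<epsilon>) x \<epsilon> (F x \<epsilon>)" if "\<bar>x\<bar> < R" "0 < \<epsilon>" "\<epsilon> \<le> e1" for x \<epsilon>
    unfolding F_def by (rule someI_ex[OF ex]) (use that e1 in auto)
  have dpos: "0 < \<delta> \<epsilon>" "\<delta> \<epsilon> \<le> 1" if "0 < \<epsilon>" for \<epsilon> using \<delta> that by (auto simp: decay_gauge_def)
  have dmono: "\<delta> \<epsilon> \<le> \<delta> \<epsilon>'" if "0 < \<epsilon>" "\<epsilon> \<le> \<epsilon>'" for \<epsilon> \<epsilon>' using \<delta> that by (auto simp: decay_gauge_def)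
  have c0: "c n > 0" for n
  proof -
    have "0 < fact n * (16 / e1) ^ n * sqrt (\<delta> e1)" using e1 dpos[of e1] by simp
    also have "\<dots> \<le> c n * e1\<^sup>2" using e1 by (intro c) auto
    finally show ?thesis using e1 by (simp add: zero_less_mult_iff)
  qed
  have comp: "norm ((deriv ^^ n) (F x \<epsilon>) (of_real y) - (deriv ^^ n) (F y \<epsilon>') (of_real y)) \<le> 2 * K * c n * \<epsilon>\<^sup>2"
    if "\<bar>x\<bar> < R" "\<bar>y\<bar> < R" "0 < \<epsilon>" "\<epsilon> \<le> e1" "\<bar>x - y\<bar> \<le> \<epsilon> / 2" "\<epsilon> / 2 \<le> \<epsilon>'" "\<epsilon>' \<le> \<epsilon>" for n x y \<epsilon> \<epsilon>'
  proof -
    have "norm ((deriv ^^ n) (F x \<epsilon>) (of_real y) - (deriv ^^ n) (F y \<epsilon>') (of_real y)) \<le> 2 * K * (fact n * (16 / \<epsilon>) ^ n * sqrt (\<delta> \<epsilon>))"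
      by (rule disc_approx_deriv_diff_le[OF F F]) (use that dpos dmono K in auto)
    also have "\<dots> \<le> 2 * K * (c n * \<epsilon>\<^sup>2)" using that e1 K by (intro mult_left_mono c) auto
    finally show ?thesis by simp
  qed
  define E where "E = (\<lambda>k::nat. e1 / 2 ^ k)"
  have E: "0 < E k" "E k \<le> e1" "E (Suc k) = E k / 2" "(E k)\<^sup>2 = e1\<^sup>2 * (1/4) ^ k" for k
  proof -
    have "((2::real) ^ k)\<^sup>2 = 4 ^ k" by (simp add: power2_eq_square flip: power_mult_distrib)
    then show "(E k)\<^sup>2 = e1\<^sup>2 * (1/4) ^ k" by (simp add: E_def power_divide)
  qed (use e1 in \<open>auto simp: E_def divide_le_eq\<close>)
  define d where "d = (\<lambda>n k x. (deriv ^^ n) (F x (E k)) (complex_of_real x))"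
  have tel: "\<exists>l. (\<lambda>k. d n k x) \<longlonglongrightarrow> l \<and> (\<forall>k. norm (l - d n k x) \<le> 2 * (2 * K * c n * e1\<^sup>2) * (1/4) ^ k)" if x: "\<bar>x\<bar> < R" for n x
  proof (rule geometric_telescope)
    fix k
    have "norm (d n k x - d n (Suc k) x) \<le> 2 * K * c n * (E k)\<^sup>2"
      unfolding d_def by (rule comp) (use x E[of k] in auto)
    then show "norm (d n (Suc k) x - d n k x) \<le> 2 * K * c n * e1\<^sup>2 * (1/4) ^ k"
      unfolding E(4) by (simp add: norm_minus_commute mult.assoc)
  qed
  define D where "D = (\<lambda>n x. SOME l. (\<lambda>k. d n k x) \<longlonglongrightarrow> l \<and> (\<forall>k. norm (l - d n k x) \<le> 2 * (2 * K * c n * e1\<^sup>2) * (1/4) ^ k))"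
  have D: "(\<lambda>k. d n k x) \<longlonglongrightarrow> D n x" "norm (D n x - d n k x) \<le> 4 * K * c n * (E k)\<^sup>2" if "\<bar>x\<bar> < R" for n x k
    using someI_ex[OF tel[OF that, of n]] unfolding D_def E(4) by (auto simp: mult_ac)
  have d0: "norm (d n 0 x) \<le> K * (fact n * (2 / e1) ^ n)" if x: "\<bar>x\<bar> < R" for n x
  proof -
    have Fx: "disc_approx f K (\<delta> e1) x e1 (F x e1)" using F[OF x] e1 by simp
    have sub: "ball (of_real x) (e1 / 2) \<subseteq> ball (complex_of_real x) e1" "cball (of_real x) (e1 / 2) \<subseteq> ball (complex_of_real x) e1"
      using e1 by auto
    have hol: "F x e1 holomorphic_on ball (of_real x) e1" using Fx by (simp add: disc_approx_def)
    have "norm ((deriv ^^ n) (F x e1) (of_real x)) \<le> fact n * K / (e1 / 2) ^ n"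
    proof (rule Cauchy_inequality)
      show "F x e1 holomorphic_on ball (of_real x) (e1 / 2)" by (rule holomorphic_on_subset[OF hol sub(1)])
      show "continuous_on (cball (of_real x) (e1 / 2)) (F x e1)"
        by (rule holomorphic_on_imp_continuous_on[OF holomorphic_on_subset[OF hol sub(2)]])
      show "norm (F x e1 z) \<le> K" if "norm (of_real x - z) = e1 / 2" for z
        using Fx that e1 by (auto simp: disc_approx_def dist_norm)
    qed (use e1 in simp)
    then show ?thesis unfolding d_def E_def using e1 by (simp add: power_divide field_simps)
  qed
  define C where "C = K * e1\<^sup>2 / sqrt (\<delta> e1) + 4 * K * e1\<^sup>2"
  have bound: "norm (D n x) \<le> C * c n" if x: "\<bar>x\<bar> < R" for n x
  proof -
    have s: "sqrt (\<delta> e1) > 0" using dpos[OF e1(1)] by simp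
    have "fact n * (2 / e1) ^ n \<le> fact n * (16 / e1) ^ n"
      using e1 by (intro mult_left_mono power_mono divide_right_mono) auto
    also have "\<dots> \<le> c n * e1\<^sup>2 / sqrt (\<delta> e1)" using c[of e1 n] e1 s by (simp add: field_simps)
    finally have "K * (fact n * (2 / e1) ^ n) \<le> K * (c n * e1\<^sup>2 / sqrt (\<delta> e1))" using K by (intro mult_left_mono)
    with d0[OF x, of n] D(2)[OF x, of n 0] norm_triangle_ineq[of "D n x - d n 0 x" "d n 0 x"]
    have "norm (D n x) \<le> K * (c n * e1\<^sup>2 / sqrt (\<delta> e1)) + 4 * K * c n * e1\<^sup>2"
      by (simp add: E_def)
    then show ?thesis unfolding C_def by (simp add: algebra_simps)
  qed
  have "(D n has_vector_derivative D (Suc n) x) (at x)" if x: "\<bar>x\<bar> < R" for n x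
  proof -
    define h where "h = min (e1 / 2) (R - \<bar>x\<bar>) / 2"
    have h: "h > 0" "2 * h \<le> e1" using e1 x by (auto simp: h_def)
    define B where "B = C * c (n + 2) + 4 * K * c (n + 2) * e1\<^sup>2 + 2 * K * c (n + 2) * e1\<^sup>2"
    define A where "A = 16 * (10 * K * c n) + 64 * K * c (Suc n) * e1 + B"
    have "norm (D n y - D n x - of_real (y - x) * D (Suc n) x) \<le> A * (y - x)\<^sup>2" if y: "\<bar>y - x\<bar> \<le> h" for y
    proof (cases "y = x")
      case False
      have yR: "\<bar>w\<bar> < R" if "\<bar>w - x\<bar> \<le> h" for w
      proof -
        have "h \<le> (R - \<bar>x\<bar>) / 2" unfolding h_def by (intro divide_right_mono) auto
        moreover have "\<bar>w\<bar> \<le> \<bar>x\<bar> + \<bar>w - x\<bar>" by simp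
        ultimately show ?thesis using that x by argo
      qed
      define t where "t = \<bar>y - x\<bar>"
      have t: "t > 0" "2 * t \<le> e1" "t \<le> e1" using False y h by (auto simp: t_def)
      \<comment> \<open>The radius is matched to the increment. At least \<open>2 * t\<close> lets
        the approximant at \<open>x\<close> be compared at every point of the segment, as
        \<open>comp\<close> asks for distance at most half the radius; below \<open>4 * t\<close>
        turns errors of order \<open>(E k)\<^sup>2\<close> into errors of order
        \<open>t\<^sup>2\<close>.\<close>
      obtain k where k: "2 * t \<le> E k" "E k < 2 * (2 * t)" using dyadic_scale_exists[of "2 * t" e1] t by (auto simp: E_def)
      have Ek: "(E k)\<^sup>2 \<le> 16 * t\<^sup>2" "(E k)\<^sup>2 \<le> e1\<^sup>2"
        using power_mono[of "E k" "4 * t" 2] power_mono[of "E k" e1 2] k E[of k] t by (auto simp: power_mult_distrib)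
      define \<Phi> where "\<Phi> = F x (E k)"
      define S where "S = closed_segment (complex_of_real x) (of_real y)"
      have FE: "disc_approx f K (\<delta> (E k)) x (E k) \<Phi>" unfolding \<Phi>_def using F[OF x] E by blast
      have hol\<Phi>: "\<Phi> holomorphic_on ball (of_real x) (E k)" using FE by (simp add: disc_approx_def)
      have Sw: "\<exists>w::real. z = of_real w \<and> \<bar>w - x\<bar> \<le> t" if "z \<in> S" for z
      proof -
        obtain u where u: "0 \<le> u" "u \<le> 1" "z = (1 - u) *\<^sub>R of_real x + u *\<^sub>R of_real y"
          using \<open>z \<in> S\<close> unfolding S_def in_segment by blast
        have "z = of_real (x + u * (y - x))" unfolding u(3) by (simp add: scaleR_conv_of_real algebra_simps)
        moreover have "\<bar>x + u * (y - x) - x\<bar> \<le> t"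
          using u mult_right_mono[of u 1 "\<bar>y - x\<bar>"] by (simp add: t_def abs_mult)
        ultimately show ?thesis by blast
      qed
      have SB: "S \<subseteq> ball (of_real x) (E k)"
      proof
        fix z assume "z \<in> S"
        then obtain w :: real where w: "z = of_real w" "\<bar>w - x\<bar> \<le> t" using Sw by blast
        show "z \<in> ball (of_real x) (E k)" unfolding w(1) by (rule of_real_in_ball) (use w k t in linarith)
      qed
      \<comment> \<open>The second order Taylor term needs a bound uniform in \<open>k\<close>. It
        comes from comparing with \<open>D (n + 2)\<close>, which is already known to be bounded,
        and not from Cauchy's inequality on the shrinking disc.\<close>
      have Bd: "norm ((deriv ^^ (n + 2)) \<Phi> z) \<le> B" if zS: "z \<in> S" for z
      proof -
        obtain w :: real where w: "z = of_real w" "\<bar>w - x\<bar> \<le> t" using Sw[OF zS] by blast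
        have wR: "\<bar>w\<bar> < R" using yR w y by (simp add: t_def)
        have "norm ((deriv ^^ (n + 2)) (F x (E k)) (of_real w) - d (n + 2) k w) \<le> 2 * K * c (n + 2) * (E k)\<^sup>2"
          unfolding d_def by (rule comp) (use x wR E k t w in \<open>auto simp: abs_minus_commute\<close>)
        moreover have "2 * K * c (n + 2) * (E k)\<^sup>2 \<le> 2 * K * c (n + 2) * e1\<^sup>2" "4 * K * c (n + 2) * (E k)\<^sup>2 \<le> 4 * K * c (n + 2) * e1\<^sup>2"
          using Ek K c0[of "n + 2"] by (auto intro!: mult_left_mono)
        moreover have "norm (D (n + 2) w) \<le> C * c (n + 2)" by (rule bound[OF wR])
        moreover have "norm (D (n + 2) w - d (n + 2) k w) \<le> 4 * K * c (n + 2) * (E k)\<^sup>2" by (rule D(2)[OF wR])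
        moreover have "norm ((deriv ^^ (n + 2)) \<Phi> z) \<le> norm ((deriv ^^ (n + 2)) (F x (E k)) (of_real w) - d (n + 2) k w)
            + norm (D (n + 2) w - d (n + 2) k w) + norm (D (n + 2) w)"
        proof -
          have "norm (p :: complex) \<le> norm (p - q) + norm (s - q) + norm s" for p q s
            using norm_triangle_ineq4[of "p - q" "s - q"] norm_triangle_ineq[of "p - s" s] by simp
          then show ?thesis unfolding \<Phi>_def w(1) by blast
        qed
        ultimately show ?thesis unfolding B_def by linarith
      qed
      have T: "norm ((deriv ^^ n) \<Phi> (of_real y) - (deriv ^^ n) \<Phi> (of_real x) - of_real (y - x) * (deriv ^^ Suc n) \<Phi> (of_real x)) \<le> B * t\<^sup>2"
      proof -
        have "norm ((deriv ^^ n) \<Phi> (of_real y) - (\<Sum>i\<le>1. (deriv ^^ (n + i)) \<Phi> (of_real x) * (of_real y - of_real x) ^ i / fact i))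
            \<le> B * norm (complex_of_real y - of_real x) ^ Suc 1 / fact 1"
          using field_Taylor[of S 1 "\<lambda>i. (deriv ^^ (n + i)) \<Phi>" B "of_real x" "of_real y"]
        proof -
          have "((deriv ^^ (n + i)) \<Phi> has_field_derivative (deriv ^^ (n + Suc i)) \<Phi> z) (at z within S)" if "z \<in> S" for z i
          proof -
            have "(deriv ^^ (n + i)) \<Phi> holomorphic_on ball (of_real x) (E k)"
              by (rule holomorphic_higher_deriv[OF hol\<Phi>]) simp
            then have "((deriv ^^ (n + i)) \<Phi> has_field_derivative deriv ((deriv ^^ (n + i)) \<Phi>) z) (at z)"
              using that SB by (intro holomorphic_derivI[of _ "ball (of_real x) (E k)"]) auto
            then show ?thesis by (simp add: has_field_derivative_at_within)
          qed
          then show ?thesis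
            using field_Taylor[of S 1 "\<lambda>i. (deriv ^^ (n + i)) \<Phi>" B "of_real x" "of_real y"] Bd
            by (auto simp: S_def)
        qed
        moreover have "norm (complex_of_real y - of_real x) = t" by (simp add: t_def flip: of_real_diff)
        ultimately show ?thesis by (simp add: algebra_simps power2_eq_square)
      qed
      have 1: "norm (D n y - (deriv ^^ n) \<Phi> (of_real y)) \<le> 6 * K * c n * (E k)\<^sup>2"
      proof -
        have yy: "\<bar>y\<bar> < R" using yR y by blast
        have "norm ((deriv ^^ n) (F x (E k)) (of_real y) - d n k y) \<le> 2 * K * c n * (E k)\<^sup>2"
          unfolding d_def by (rule comp) (use x yy E k t in \<open>auto simp: t_def abs_minus_commute\<close>)
        with D(2)[OF yy, of n k] show ?thesis
          using norm_triangle_ineq4[of "D n y - d n k y" "(deriv ^^ n) \<Phi> (of_real y) - d n k y"]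
          unfolding \<Phi>_def by simp
      qed
      have 2: "norm ((deriv ^^ n) \<Phi> (of_real x) - D n x) \<le> 4 * K * c n * (E k)\<^sup>2"
        and 3: "norm ((deriv ^^ Suc n) \<Phi> (of_real x) - D (Suc n) x) \<le> 4 * K * c (Suc n) * (E k)\<^sup>2"
        using D(2)[OF x, of n k] D(2)[OF x, of "Suc n" k] unfolding d_def \<Phi>_def by (auto simp: norm_minus_commute)
      have split: "norm (a - b - s * g :: complex) \<le> norm (a - a') + norm (b' - b) + norm s * norm (g' - g) + norm (a' - b' - s * g')"
        for a b s g a' b' g'
      proof -
        have "a - b - s * g = (a - a') + (b' - b) + s * (g' - g) + (a' - b' - s * g')" by (simp add: algebra_simps)
        then show ?thesis by (smt (verit) norm_triangle_ineq norm_mult)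
      qed
      have "norm (D n y - D n x - of_real (y - x) * D (Suc n) x) \<le> 6 * K * c n * (E k)\<^sup>2 + 4 * K * c n * (E k)\<^sup>2
          + t * (4 * K * c (Suc n) * (E k)\<^sup>2) + B * t\<^sup>2"
      proof (rule order_trans[OF split[of "D n y" "D n x" "of_real (y - x)" "D (Suc n) x" "(deriv ^^ n) \<Phi> (of_real y)" "(deriv ^^ n) \<Phi> (of_real x)" "(deriv ^^ Suc n) \<Phi> (of_real x)"]])
        have nt: "norm (complex_of_real (y - x)) = t" unfolding norm_of_real t_def ..
        have "t * norm ((deriv ^^ Suc n) \<Phi> (of_real x) - D (Suc n) x) \<le> t * (4 * K * c (Suc n) * (E k)\<^sup>2)"
          using t by (intro mult_left_mono[OF 3]) simp
        then show "norm (D n y - (deriv ^^ n) \<Phi> (of_real y)) + norm ((deriv ^^ n) \<Phi> (of_real x) - D n x)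
            + norm (complex_of_real (y - x)) * norm ((deriv ^^ Suc n) \<Phi> (of_real x) - D (Suc n) x)
            + norm ((deriv ^^ n) \<Phi> (of_real y) - (deriv ^^ n) \<Phi> (of_real x) - of_real (y - x) * (deriv ^^ Suc n) \<Phi> (of_real x))
          \<le> 6 * K * c n * (E k)\<^sup>2 + 4 * K * c n * (E k)\<^sup>2 + t * (4 * K * c (Suc n) * (E k)\<^sup>2) + B * t\<^sup>2"
          unfolding nt by (intro add_mono 1 2 T)
      qed
      also have "\<dots> = 10 * K * c n * (E k)\<^sup>2 + t * (4 * K * c (Suc n)) * (E k)\<^sup>2 + B * t\<^sup>2" by (simp add: algebra_simps)
      also have "\<dots> \<le> 10 * K * c n * (16 * t\<^sup>2) + e1 * (4 * K * c (Suc n)) * (16 * t\<^sup>2) + B * t\<^sup>2"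
        using Ek K c0[of n] c0[of "Suc n"] t by (intro order_refl add_mono mult_mono) auto
      also have "\<dots> = A * (y - x)\<^sup>2" by (simp add: A_def t_def algebra_simps)
      finally show ?thesis .
    qed simp
    then show ?thesis by (rule has_vector_derivative_of_quadratic_error[OF h(1)])
  qed
  moreover have "D 0 x = f x" if x: "\<bar>x\<bar> < R" for x
  proof -
    \<comment> \<open>The hypothesis \<open>c\<close> at order 0 bounds
      \<open>sqrt (\<delta> \<epsilon>)\<close> by a multiple of \<open>\<epsilon>\<^sup>2\<close>;
      this forces the approximation error itself to tend to 0.\<close>
    have "(\<lambda>k. d 0 k x) \<longlonglongrightarrow> f x"
    proof (rule LIM_zero_cancel, rule Lim_null_comparison)
      show "\<forall>\<^sub>F k in sequentially. norm (d 0 k x - f x) \<le> K * ((c 0 * (E k)\<^sup>2) * (c 0 * (E k)\<^sup>2))"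
      proof (intro always_eventually allI)
        fix k
        have "norm (d 0 k x - f x) \<le> K * \<delta> (E k)"
          using F[OF x E(1,2)[of k]] E(1)[of k] by (simp add: d_def disc_approx_def)
        also have "\<delta> (E k) = sqrt (\<delta> (E k)) * sqrt (\<delta> (E k))" using dpos[OF E(1)[of k]] by simp
        also have "K * (sqrt (\<delta> (E k)) * sqrt (\<delta> (E k))) \<le> K * ((c 0 * (E k)\<^sup>2) * (c 0 * (E k)\<^sup>2))"
          using c[of "E k" 0] E[of k] e1 K dpos[OF E(1)[of k]] c0[of 0] by (intro mult_left_mono mult_mono) auto
        finally show "norm (d 0 k x - f x) \<le> K * ((c 0 * (E k)\<^sup>2) * (c 0 * (E k)\<^sup>2))" .
      qed
      have "(\<lambda>k. K * ((c 0 * (e1\<^sup>2 * (1/4) ^ k)) * (c 0 * (e1\<^sup>2 * (1/4) ^ k)))) \<longlonglongrightarrow> K * ((c 0 * (e1\<^sup>2 * 0)) * (c 0 * (e1\<^sup>2 * 0)))"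
        by (intro tendsto_intros LIMSEQ_power_zero) auto
      then show "(\<lambda>k. K * ((c 0 * (E k)\<^sup>2) * (c 0 * (E k)\<^sup>2))) \<longlonglongrightarrow> 0" unfolding E(4) by simp
    qed
    then show ?thesis using D(1)[OF x] LIMSEQ_unique by blast
  qed
  ultimately have "derivs_on (ball 0 R) f D" unfolding derivs_on_def by (simp add: dist_norm)
  moreover have "\<forall>x\<in>ball 0 R. \<forall>n. norm (D n x) \<le> C * c n" using bound by (simp add: dist_norm)
  ultimately show ?thesis by blast
qed

section \<open>Concave weights\<close>

text \<open>Complex values rule out a mean value form of the remainder, so the integral form is
  used, after pulling the segment back to the unit interval; this also treats both orders of
  \<open>x\<close> and \<open>y\<close> at once.\<close>

lemma derivs_on_taylor_le:
  fixes x y :: real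
  assumes D: "derivs_on U f D" and seg: "closed_segment x y \<subseteq> U"
    and M: "\<And>t. t \<in> closed_segment x y \<Longrightarrow> norm (D n t) \<le> M"
  shows "norm (f y - (\<Sum>k<n. D k x / fact k * of_real (y - x) ^ k)) \<le> M * \<bar>y - x\<bar> ^ n / fact n"
proof (cases "n = 0")
  case True
  have "y \<in> U" using seg by auto
  then show ?thesis using M[of y] D True by (auto simp: derivs_on_def)
next
  case False
  define p where "p = (\<lambda>t. x + t * (y - x))"
  have pin: "p t \<in> closed_segment x y" if "t \<in> {0..1}" for t
    using that unfolding p_def in_segment by (intro exI[of _ t]) (auto simp: algebra_simps)
  define Df where "Df = (\<lambda>k t. of_real (y - x) ^ k * D k (p t))"
  have Df: "(Df k has_vector_derivative Df (Suc k) t) (at t within {0..1})" if "t \<in> {0..1}" for k t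
  proof -
    have "p t \<in> U" using pin[OF that] seg by blast
    then have "(D k has_vector_derivative D (Suc k) (p t)) (at (p t))" using D by (simp add: derivs_on_def)
    moreover have "(p has_vector_derivative (y - x)) (at t)"
      unfolding p_def by (auto simp flip: has_real_derivative_iff_has_vector_derivative intro!: derivative_eq_intros)
    ultimately have "((D k \<circ> p) has_vector_derivative (y - x) *\<^sub>R D (Suc k) (p t)) (at t)"
      by (intro vector_diff_chain_at)
    then have "((\<lambda>t. of_real (y - x) ^ k * (D k \<circ> p) t) has_vector_derivative of_real (y - x) ^ k * ((y - x) *\<^sub>R D (Suc k) (p t))) (at t)"
      by (rule has_vector_derivative_mult_right)
    then show ?thesis unfolding Df_def by (simp add: o_def scaleR_conv_of_real mult_ac has_vector_derivative_at_within)
  qed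
  define g where "g = (\<lambda>t. ((1 - t) ^ (n - 1) / fact (n - 1)) *\<^sub>R Df n t)"
  have I: "(g has_integral Df 0 1 - (\<Sum>i<n. ((1 - 0) ^ i / fact i) *\<^sub>R Df i 0)) {0..1}"
    unfolding g_def by (rule Taylor_has_integral) (use False Df in auto)
  have J: "((\<lambda>t. (1 - t) ^ (n - 1) / fact (n - 1) * (\<bar>y - x\<bar> ^ n * M)) has_integral 1 / fact n * (\<bar>y - x\<bar> ^ n * M)) {0..1}"
  proof (rule has_integral_mult_left)
    have "((\<lambda>t. (1 - t) ^ (n - 1) / fact (n - 1)) has_integral (- ((1 - 1) ^ n / fact n) - (- ((1 - 0) ^ n / fact n)))) {0..1::real}"
    proof (rule fundamental_theorem_of_calculus)
      fix t :: real
      have "fact n = real n * fact (n - 1)" using False by (simp add: fact_reduce)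
      then show "((\<lambda>t. - ((1 - t) ^ n / fact n)) has_vector_derivative (1 - t) ^ (n - 1) / fact (n - 1)) (at t within {0..1})"
        using False unfolding has_real_derivative_iff_has_vector_derivative[symmetric]
        by (auto intro!: derivative_eq_intros simp: field_simps)
    qed simp
    then show "((\<lambda>t. (1 - t) ^ (n - 1) / fact (n - 1)) has_integral 1 / fact n) {0..1::real}" using False by (simp add: zero_power)
  qed
  have "norm (Df 0 1 - (\<Sum>i<n. ((1 - 0) ^ i / fact i) *\<^sub>R Df i 0)) \<le> 1 / fact n * (\<bar>y - x\<bar> ^ n * M)"
    unfolding integral_unique[OF I, symmetric] integral_unique[OF J, symmetric]
  proof (rule integral_norm_bound_integral)
    show "g integrable_on {0..1}" "(\<lambda>t. (1 - t) ^ (n - 1) / fact (n - 1) * (\<bar>y - x\<bar> ^ n * M)) integrable_on {0..1}"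
      using I J by (auto simp: has_integral_integrable)
    fix t :: real assume "t \<in> {0..1}"
    then have t: "0 \<le> t" "t \<le> 1" and M': "norm (D n (p t)) \<le> M" using M[OF pin] by auto
    have "norm (Df n t) = \<bar>y - x\<bar> ^ n * norm (D n (p t))"
      unfolding Df_def norm_mult norm_power norm_of_real ..
    also have "\<dots> \<le> \<bar>y - x\<bar> ^ n * M" using M' by (intro mult_left_mono) auto
    finally show "norm (g t) \<le> (1 - t) ^ (n - 1) / fact (n - 1) * (\<bar>y - x\<bar> ^ n * M)"
      unfolding g_def using t by (simp add: mult_left_mono divide_right_mono)
  qed
  moreover have "Df 0 1 = f y" using D seg by (auto simp: Df_def p_def derivs_on_def)
  moreover have "(\<Sum>i<n. ((1 - 0) ^ i / fact i) *\<^sub>R Df i 0) = (\<Sum>k<n. D k x / fact k * of_real (y - x) ^ k)"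
    by (rule sum.cong) (auto simp: Df_def p_def scaleR_conv_of_real)
  ultimately show ?thesis by (simp add: mult_ac)
qed

locale concave_weight =
  fixes \<omega> :: "real \<Rightarrow> real"
  assumes weight: "weight_function \<omega>" and concave: "concave_on {0..} \<omega>"
begin

lemma nonneg: "t \<ge> 0 \<Longrightarrow> \<omega> t \<ge> 0"
  and mono: "0 \<le> s \<Longrightarrow> s \<le> t \<Longrightarrow> \<omega> s \<le> \<omega> t"
  and cont: "continuous_on {0..} \<omega>"
  and convex_exp: "convex_on {0..} (\<lambda>t. \<omega> (exp t))"
  using weight unfolding weight_function_def by (auto simp: mono_on_def)

section \<open>Growth conditions in quantitative form\<close>

lemma sublinear:
  assumes "c > 0"
  obtains T where "T > 0" "\<And>t. t \<ge> T \<Longrightarrow> \<omega> t \<le> c * t"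
proof -
  have "\<omega> \<in> o[at_top](\<lambda>t. t)" using weight by (simp add: weight_function_def)
  from landau_o.smallD[OF this assms] obtain T where T: "\<And>t. t \<ge> T \<Longrightarrow> norm (\<omega> t) \<le> c * norm t"
    by (auto simp: eventually_at_top_linorder)
  show thesis
  proof (rule that[of "max T 1"])
    fix t assume "t \<ge> max T 1"
    then show "\<omega> t \<le> c * t" using T[of t] by simp
  qed simp
qed

lemma dominates_ln:
  assumes "A > 0"
  obtains T where "T \<ge> 1" "\<And>t. t \<ge> T \<Longrightarrow> A * ln t \<le> \<omega> t"
proof -
  have "(\<lambda>t. ln t) \<in> o[at_top](\<omega>)" using weight by (simp add: weight_function_def)
  from landau_o.smallD[OF this, of "1 / A"] assms obtain T where T: "\<And>t. t \<ge> T \<Longrightarrow> norm (ln t) \<le> 1 / A * norm (\<omega> t)"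
    by (auto simp: eventually_at_top_linorder)
  show thesis
  proof (rule that[of "max T 1"])
    fix t assume t: "t \<ge> max T 1"
    then have "ln t \<le> 1 / A * \<omega> t" using T[of t] nonneg[of t] ln_ge_zero[of t] by simp
    then show "A * ln t \<le> \<omega> t" using assms by (simp add: field_simps)
  qed simp
qed

lemma doubling:
  obtains H H' where "H \<ge> 1" "H' \<ge> 0" "\<And>t. t \<ge> 0 \<Longrightarrow> \<omega> (2 * t) \<le> H * \<omega> t + H'"
proof -
  have "(\<lambda>t. \<omega> (2 * t)) \<in> O[at_top](\<omega>)" using weight by (simp add: weight_function_def)
  then obtain c where "c > 0" "\<forall>\<^sub>F t in at_top. norm (\<omega> (2 * t)) \<le> c * norm (\<omega> t)" by (rule landau_o.bigE)
  then obtain T where c: "c > 0" and T: "\<And>t. t \<ge> T \<Longrightarrow> norm (\<omega> (2 * t)) \<le> c * norm (\<omega> t)"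
    by (auto simp: eventually_at_top_linorder)
  define T' where "T' = max T 0"
  show thesis
  \<comment> \<open>The additive constant covers \<open>t < T'\<close>, where the Landau bound says
    nothing.\<close>
  proof (rule that[of "max 1 c" "\<omega> (2 * T')"])
    fix t :: real assume t: "t \<ge> 0"
    show "\<omega> (2 * t) \<le> max 1 c * \<omega> t + \<omega> (2 * T')"
    proof (cases "t \<ge> T'")
      case True
      then have "\<omega> (2 * t) \<le> c * \<omega> t" using T[of t] nonneg[of t] nonneg[of "2 * t"] t by (auto simp: T'_def)
      also have "\<dots> \<le> max 1 c * \<omega> t" using nonneg[OF t] by (intro mult_right_mono) auto
      finally show ?thesis using nonneg[of "2 * T'"] by (simp add: T'_def)
    next
      case False
      then have "\<omega> (2 * t) \<le> \<omega> (2 * T')" using t by (intro mono) auto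
      moreover have "0 \<le> max 1 c * \<omega> t" using nonneg[OF t] c by simp
      ultimately show ?thesis by linarith
    qed
  qed (auto simp: T'_def intro!: nonneg)
qed

lemma doubling_power: "\<exists>H H'. H \<ge> 1 \<and> (\<forall>t\<ge>0. \<omega> (2 ^ q * t) \<le> H * \<omega> t + H')"
proof (induction q)
  case (Suc q)
  then obtain H H' where H: "H \<ge> 1" "\<And>t. t \<ge> 0 \<Longrightarrow> \<omega> (2 ^ q * t) \<le> H * \<omega> t + H'" by blast
  obtain J J' where J: "J \<ge> 1" "\<And>t. t \<ge> 0 \<Longrightarrow> \<omega> (2 * t) \<le> J * \<omega> t + J'" using doubling by metis
  have "\<omega> (2 ^ Suc q * t) \<le> (J * H) * \<omega> t + (J * H' + J')" if "t \<ge> 0" for t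
  proof -
    have "\<omega> (2 ^ Suc q * t) \<le> J * \<omega> (2 ^ q * t) + J'" using J(2)[of "2 ^ q * t"] that by (simp add: mult_ac)
    also have "\<dots> \<le> J * (H * \<omega> t + H') + J'" using H(2)[OF that] J(1) by (intro add_right_mono mult_left_mono) auto
    finally show ?thesis by (simp add: algebra_simps)
  qed
  moreover have "J * H \<ge> 1" using J(1) H(1) mult_mono[of 1 J 1 H] by simp
  ultimately show ?case by blast
next
  case 0
  show ?case by (rule exI[of _ 1], rule exI[of _ 0]) simp
qed

text \<open>A conjugate of \<open>\<omega>\<close> itself, unlike \<open>phi_w_star\<close>, which
  is the Young conjugate of \<open>\<omega>\<close> composed with \<open>exp\<close>. It is finite
  for positive \<open>s\<close> because \<open>\<omega>\<close> is sublinear, and grows without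
  bound as \<open>s\<close> tends to 0; it measures the decay of approximation errors in the disc
  radius.\<close>

definition conj_weight :: "real \<Rightarrow> real" where
  "conj_weight s = (SUP t\<in>{0..}. \<omega> t - s * t)"

lemma conj_weight_attained:
  assumes s: "s > 0"
  obtains Y where "Y \<ge> 0" "\<And>t. t \<ge> 0 \<Longrightarrow> \<omega> t - s * t \<le> \<omega> Y - s * Y"
proof -
  obtain T where T: "T > 0" "\<And>t. t \<ge> T \<Longrightarrow> \<omega> t \<le> s * t" using sublinear[OF s] by metis
  have "continuous_on {0..T} (\<lambda>t. \<omega> t - s * t)"
    by (intro continuous_intros continuous_on_subset[OF cont]) auto
  then obtain Y where Y: "Y \<in> {0..T}" "\<And>t. t \<in> {0..T} \<Longrightarrow> \<omega> t - s * t \<le> \<omega> Y - s * Y"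
    using continuous_attains_sup[of "{0..T}" "\<lambda>t. \<omega> t - s * t"] T(1) by auto
  show thesis
  proof (rule that[of Y])
    fix t :: real assume t: "t \<ge> 0"
    show "\<omega> t - s * t \<le> \<omega> Y - s * Y"
    proof (cases "t \<le> T")
      case False
      then have "\<omega> t - s * t \<le> 0" using T(2)[of t] by simp
      also have "0 \<le> \<omega> 0 - s * 0" using nonneg[of 0] by simp
      also have "\<dots> \<le> \<omega> Y - s * Y" using T(1) by (intro Y(2)) auto
      finally show ?thesis .
    qed (use Y(2) t in auto)
  qed (use Y in auto)
qed

lemma conj_weight_eq:
  assumes "Y \<ge> 0" "\<And>t. t \<ge> 0 \<Longrightarrow> \<omega> t - s * t \<le> \<omega> Y - s * Y"
  shows "conj_weight s = \<omega> Y - s * Y"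
  unfolding conj_weight_def by (rule cSup_eq_maximum) (use assms in auto)

lemma conj_weight_ge:
  assumes "s > 0" "t \<ge> 0"
  shows "\<omega> t - s * t \<le> conj_weight s"
  using conj_weight_attained[OF assms(1)] conj_weight_eq assms(2) by metis

lemma conj_weight_nonneg: "s > 0 \<Longrightarrow> conj_weight s \<ge> 0"
  using conj_weight_ge[of s 0] nonneg[of 0] by simp

lemma conj_weight_antimono:
  assumes "0 < s" "s \<le> s'" shows "conj_weight s' \<le> conj_weight s"
proof -
  obtain Y where Y: "Y \<ge> 0" "\<And>t. t \<ge> 0 \<Longrightarrow> \<omega> t - s' * t \<le> \<omega> Y - s' * Y"
    using conj_weight_attained[of s'] assms by auto
  have "conj_weight s' = \<omega> Y - s' * Y" by (rule conj_weight_eq[OF Y])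
  also have "\<dots> \<le> \<omega> Y - s * Y" using assms Y by (simp add: mult_right_mono)
  also have "\<dots> \<le> conj_weight s" by (rule conj_weight_ge[OF assms(1) Y(1)])
  finally show ?thesis .
qed

text \<open>Test the supremum at \<open>t = 1 / s\<close>, where the linear term is 1. Starting from
  the coefficient \<open>A + 1\<close> leaves one spare \<open>ln (1 / s)\<close>, at least 1, to
  absorb it.\<close>

lemma conj_weight_ge_ln:
  assumes A: "A > 0"
  obtains s0 where "s0 > 0" "\<And>s. 0 < s \<Longrightarrow> s \<le> s0 \<Longrightarrow> A * ln (1 / s) \<le> conj_weight s"
proof -
  obtain T where T: "T \<ge> 1" "\<And>t. t \<ge> T \<Longrightarrow> (A + 1) * ln t \<le> \<omega> t" using dominates_ln[of "A + 1"] A by auto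
  show thesis
  proof (rule that[of "min (1 / T) (exp (-1))"])
    fix s :: real assume s: "0 < s" "s \<le> min (1 / T) (exp (-1))"
    have "T \<le> 1 / s" using s T(1) by (simp add: field_simps)
    then have "(A + 1) * ln (1 / s) \<le> \<omega> (1 / s)" by (rule T(2))
    moreover have "ln (1 / s) \<ge> 1"
    proof -
      have "ln s \<le> -1" using s by (metis ln_exp ln_le_cancel_iff exp_gt_zero min.boundedE)
      then show ?thesis using s by (simp add: ln_div)
    qed
    moreover have "\<omega> (1 / s) - s * (1 / s) \<le> conj_weight s" using s by (intro conj_weight_ge) auto
    ultimately show "A * ln (1 / s) \<le> conj_weight s" using s by (simp add: algebra_simps)
  qed (use T in auto)
qed

text \<open>The errors are flat: they beat every power of the radius, so a fixed part of the
  exponent can always be traded for powers of \<open>\<epsilon>\<close>.\<close>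

lemma exp_conj_weight_le_powr:
  assumes "b > 0" "m > 0"
  obtains s0 where "s0 > 0" "\<And>s. 0 < s \<Longrightarrow> s \<le> s0 \<Longrightarrow> exp (- b * conj_weight s) \<le> s powr m"
proof -
  obtain s0 where s0: "s0 > 0" "\<And>s. 0 < s \<Longrightarrow> s \<le> s0 \<Longrightarrow> m / b * ln (1 / s) \<le> conj_weight s"
    using conj_weight_ge_ln[of "m / b"] assms by auto
  show thesis
  proof (rule that[OF s0(1)])
    fix s assume s: "0 < s" "s \<le> s0"
    have "m * ln (1 / s) \<le> b * conj_weight s" using s0(2)[OF s] assms by (simp add: field_simps)
    then have "- b * conj_weight s \<le> m * ln s" using s by (simp add: ln_div)
    then show "exp (- b * conj_weight s) \<le> s powr m" using s by (simp add: powr_def)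
  qed
qed

lemma phi_star_bdd:
  "bdd_above ((\<lambda>t. s * t - phi_w \<omega> t) ` {0..})"
proof -
  define A where "A = \<bar>s\<bar> + 1"
  obtain T where T: "T \<ge> 1" "\<And>t. t \<ge> T \<Longrightarrow> A * ln t \<le> \<omega> t" 
    using dominates_ln[of A] by (metis A_def abs_ge_zero add_nonneg_pos zero_less_one)
  have "s * t - \<omega> (exp t) \<le> \<bar>s\<bar> * ln T" if "t \<ge> 0" for t
  proof (cases "exp t \<ge> T")
    case True
    then have "\<bar>s\<bar> * t + t \<le> \<omega> (exp t)" using T(2)[of "exp t"] by (simp add: A_def algebra_simps)
    moreover have "s * t \<le> \<bar>s\<bar> * t" using that by (intro mult_right_mono) auto
    moreover have "0 \<le> \<bar>s\<bar> * ln T" using T(1) by simp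
    ultimately show ?thesis using that by linarith
  next
    case False
    then have "t \<le> ln T" using T(1) by (metis exp_gt_zero less_imp_le linorder_not_le ln_exp ln_le_cancel_iff less_le_trans zero_less_one)
    then have "\<bar>s\<bar> * t \<le> \<bar>s\<bar> * ln T" by (intro mult_left_mono) auto
    moreover have "s * t \<le> \<bar>s\<bar> * t" using that by (intro mult_right_mono) auto
    moreover have "\<omega> (exp t) \<ge> 0" by (rule nonneg) simp
    ultimately show ?thesis by linarith
  qed
  then show ?thesis unfolding phi_w_def by (intro bdd_aboveI2[of _ _ "\<bar>s\<bar> * ln T"]) auto
qed

text \<open>With y = exp t, the derivative bound
  \<open>exp (phi_w_star \<omega> (\<rho> * real n) / \<rho>)\<close> is the supremum of
  \<open>y ^ n * exp (- \<omega> y / \<rho>)\<close> over \<open>y \<ge> 1\<close>. This lemma and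
  \<open>phi_star_le\<close> are the two halves of that description, the only form used
  afterwards.\<close>

lemma phi_star_ge:
  assumes "\<rho> > 0" "y \<ge> 1"
  shows "real n * ln y - \<omega> y / \<rho> \<le> phi_w_star \<omega> (\<rho> * real n) / \<rho>"
proof -
  have "(\<rho> * real n) * ln y - phi_w \<omega> (ln y) \<le> phi_w_star \<omega> (\<rho> * real n)"
    unfolding phi_w_star_def by (rule cSUP_upper[OF _ phi_star_bdd]) (use assms in auto)
  then have "((\<rho> * real n) * ln y - \<omega> y) / \<rho> \<le> phi_w_star \<omega> (\<rho> * real n) / \<rho>"
    using assms by (intro divide_right_mono) (auto simp: phi_w_def)
  then show ?thesis using assms by (simp add: diff_divide_distrib)
qed

lemma phi_star_le:
  assumes "\<rho> > 0" "\<And>y. y \<ge> 1 \<Longrightarrow> real n * ln y - \<omega> y / \<rho> \<le> b"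
  shows "phi_w_star \<omega> (\<rho> * real n) / \<rho> \<le> b"
proof -
  have "phi_w_star \<omega> (\<rho> * real n) \<le> \<rho> * b"
    unfolding phi_w_star_def
  proof (rule cSUP_least)
    fix t :: real assume "t \<in> {0..}"
    then have "real n * t - \<omega> (exp t) / \<rho> \<le> b" using assms(2)[of "exp t"] by simp
    then have "\<rho> * (real n * t - \<omega> (exp t) / \<rho>) \<le> \<rho> * b" using assms(1) by (intro mult_left_mono) auto
    then show "\<rho> * real n * t - phi_w \<omega> t \<le> \<rho> * b" using assms(1) by (simp add: phi_w_def right_diff_distrib)
  qed simp
  then show ?thesis using assms(1) by (simp add: divide_le_eq mult.commute)
qed

lemma B_omega_mono:
  assumes "B_omega \<omega> \<rho> U f" "0 < \<rho>" "\<rho> \<le> \<rho>'" "U' \<subseteq> U"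
  shows "B_omega \<omega> \<rho>' U' f"
proof -
  obtain D C where D: "derivs_on U f D" and C: "\<And>x n. x \<in> U \<Longrightarrow> norm (D n x) * exp (- phi_w_star \<omega> (\<rho> * real n) / \<rho>) \<le> C"
    using assms(1) unfolding B_omega_def by blast
  have "phi_w_star \<omega> (\<rho> * real n) / \<rho> \<le> phi_w_star \<omega> (\<rho>' * real n) / \<rho>'" for n
  proof (rule phi_star_le[OF assms(2)])
    fix y :: real assume y: "y \<ge> 1"
    have "\<omega> y / \<rho>' \<le> \<omega> y / \<rho>" using assms y nonneg[of y] by (intro divide_left_mono) auto
    then show "real n * ln y - \<omega> y / \<rho> \<le> phi_w_star \<omega> (\<rho>' * real n) / \<rho>'"
      using phi_star_ge[of \<rho>' y n] assms y by linarith
  qed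
  then have "norm (D n x) * exp (- phi_w_star \<omega> (\<rho>' * real n) / \<rho>') \<le> norm (D n x) * exp (- phi_w_star \<omega> (\<rho> * real n) / \<rho>)" for n x
    by (intro mult_left_mono) auto
  then have "\<forall>x\<in>U'. \<forall>n. norm (D n x) * exp (- phi_w_star \<omega> (\<rho>' * real n) / \<rho>') \<le> C"
    using C assms(4) by (meson order_trans subsetD)
  moreover have "derivs_on U' f D" using D assms(4) unfolding derivs_on_def by blast
  ultimately show ?thesis unfolding B_omega_def by blast
qed

text \<open>The maximiser \<open>Y\<close> makes \<open>\<omega>\<close> lie below the line of slope \<open>s\<close> through \<open>(Y, \<omega> Y)\<close>; since \<open>\<omega>\<close> is
  convex in \<open>ln y\<close>, it lies above the corresponding tangent in the variable \<open>ln y\<close>.\<close>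

lemma log_tangent:
  assumes Y: "Y > 1" "\<And>t. t \<ge> 0 \<Longrightarrow> \<omega> t - s * t \<le> \<omega> Y - s * Y" and y: "y \<ge> 1"
  shows "\<omega> Y + Y * s * (ln y - ln Y) \<le> \<omega> y"
proof -
  define T where "T = ln Y"
  define t where "t = ln y"
  have T: "T > 0" "exp T = Y" and t: "t \<ge> 0" "exp t = y" using Y y by (auto simp: T_def t_def)
  \<comment> \<open>No differentiability of \<open>\<omega>\<close> is available. \<open>T\<close>
    is written as a convex combination of \<open>t\<close> and a point \<open>T'\<close> slightly on
    the other side; at \<open>T'\<close> the line of slope \<open>s\<close> bounds
    \<open>\<omega>\<close> from above, and letting \<open>h\<close> tend to 0 produces the tangent.
    The smallness of \<open>h\<close> keeps \<open>T'\<close> where convexity is assumed.\<close>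
  have step: "s * Y * (1 - exp (- h * (t - T))) / h \<le> \<omega> y - \<omega> Y" if h: "h > 0" "h * \<bar>t - T\<bar> \<le> T" for h
  proof -
    define T' where "T' = T - h * (t - T)"
    have "h * (t - T) \<le> h * \<bar>t - T\<bar>" using h by (intro mult_left_mono) auto
    then have T': "T' \<ge> 0" using h unfolding T'_def by linarith
    have u: "0 \<le> h / (1 + h)" "0 \<le> 1 / (1 + h)" "h / (1 + h) + 1 / (1 + h) = 1" using h by (auto simp: field_simps)
    have "(h / (1 + h)) *\<^sub>R t + (1 / (1 + h)) *\<^sub>R T' = T"
    proof -
      have "h * t + T' = T * (1 + h)" by (simp add: T'_def algebra_simps)
      then have "(h * t + T') / (1 + h) = T" using h by simp
      then show ?thesis by (simp add: add_divide_distrib)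
    qed
    then have "\<omega> (exp T) \<le> h / (1 + h) * \<omega> (exp t) + 1 / (1 + h) * \<omega> (exp T')"
    proof -
      have "\<omega> (exp (p *\<^sub>R a + r *\<^sub>R b)) \<le> p * \<omega> (exp a) + r * \<omega> (exp b)"
        if "a \<ge> 0" "b \<ge> 0" "p \<ge> 0" "r \<ge> 0" "p + r = 1" for a b p r
        using convex_exp that unfolding convex_on_def by (metis atLeast_iff)
      from this[OF t(1) T' u] show ?thesis by (simp only: \<open>_ = T\<close>)
    qed
    then have "\<omega> Y \<le> (h * \<omega> y + \<omega> (exp T')) / (1 + h)" unfolding T(2) t(2) by (simp add: add_divide_distrib)
    then have "(1 + h) * \<omega> Y \<le> h * \<omega> y + \<omega> (exp T')" using h by (simp add: pos_le_divide_eq mult.commute)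
    moreover have "\<omega> (exp T') \<le> \<omega> Y - s * Y + s * exp T'" using Y(2)[of "exp T'"] by simp
    moreover have "exp T' = Y * exp (- h * (t - T))" by (simp add: T'_def T(2)[symmetric] flip: exp_add)
    ultimately have "s * Y * (1 - exp (- h * (t - T))) \<le> h * (\<omega> y - \<omega> Y)" by (simp add: algebra_simps)
    then show ?thesis using h by (simp add: divide_le_eq mult.commute)
  qed
  have lim: "((\<lambda>h. s * Y * ((1 - exp (- h * (t - T))) / h)) \<longlongrightarrow> s * Y * (t - T)) (at_right 0)"
  proof (intro tendsto_intros)
    have "((\<lambda>h. 1 - exp (- h * (t - T))) has_real_derivative (t - T)) (at 0)"
      by (auto intro!: derivative_eq_intros)
    then have "((\<lambda>h. (1 - exp (- h * (t - T))) / h) \<longlongrightarrow> t - T) (at 0)" by (simp add: DERIV_def)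
    then show "((\<lambda>h. (1 - exp (- h * (t - T))) / h) \<longlongrightarrow> t - T) (at_right 0)"
      by (rule filterlim_mono) (auto simp: at_within_le_at)
  qed
  have "s * Y * (t - T) \<le> \<omega> y - \<omega> Y"
  proof (rule tendsto_upperbound[OF lim])
    define h0 where "h0 = T / (\<bar>t - T\<bar> + 1)"
    have "\<forall>\<^sub>F h in at_right 0. h \<in> {0<..<h0}"
      by (rule eventually_at_right_real) (use T in \<open>simp add: h0_def add_nonneg_pos\<close>)
    then show "\<forall>\<^sub>F h in at_right 0. s * Y * ((1 - exp (- h * (t - T))) / h) \<le> \<omega> y - \<omega> Y"
    proof eventually_elim
      case (elim h)
      then have "h * (\<bar>t - T\<bar> + 1) \<le> T" by (auto simp: h0_def field_simps add_nonneg_pos)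
      then have "h * \<bar>t - T\<bar> \<le> T" using elim by (simp add: distrib_left)
      with step[of h] elim show ?case by simp
    qed
  qed simp
  then show ?thesis by (simp add: T_def t_def algebra_simps)
qed

text \<open>Optimality against \<open>t = 0\<close> gives \<open>s * Y \<le> \<omega> Y\<close>, and
  concavity keeps \<open>\<omega>\<close> above the chord from 0 to \<open>Y\<close>. This is the
  only use of concavity.\<close>

lemma below_maximiser:
  assumes Y: "Y > 0" "\<And>t. t \<ge> 0 \<Longrightarrow> \<omega> t - s * t \<le> \<omega> Y - s * Y" and y: "0 \<le> y" "y \<le> Y"
  shows "s * y \<le> \<omega> y"
proof -
  have "concave_on {0..} \<omega>" by (rule concave)
  then have "(1 - y / Y) * \<omega> 0 + y / Y * \<omega> Y \<le> \<omega> ((1 - y / Y) *\<^sub>R 0 + (y / Y) *\<^sub>R Y)"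
    using Y y by (intro concave_onD) auto
  then have "(1 - y / Y) * \<omega> 0 + y / Y * \<omega> Y \<le> \<omega> y" using Y by simp
  moreover have "(1 - y / Y) * \<omega> 0 \<ge> 0" using nonneg[of 0] Y y by (intro mult_nonneg_nonneg) auto
  moreover have "y / Y * (s * Y) \<le> y / Y * \<omega> Y"
    using Y(2)[of 0] nonneg[of 0] y Y(1) by (intro mult_left_mono) auto
  moreover have "y / Y * (s * Y) = s * y" using Y(1) by simp
  ultimately show ?thesis by linarith
qed

end

section \<open>Taylor polynomials up to the critical order\<close>

lemma power_div_fact_le_exp:
  fixes x :: real
  assumes "x \<ge> 0"
  shows "x ^ n / fact n \<le> exp x"
proof -
  have "(\<lambda>n. x ^ n / fact n) sums exp x"
    using exp_converges[of x] by (simp add: scaleR_conv_of_real divide_inverse mult.commute)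
  then have "sum (\<lambda>n. x ^ n / fact n) {n} \<le> exp x"
    using sum_le_suminf[of "\<lambda>n. x ^ n / fact n" "{n}"] assms by (auto simp: sums_iff)
  then show ?thesis by simp
qed

context concave_weight
begin

text \<open>For \<open>s = 2 * \<rho> * \<epsilon>\<close> with maximiser \<open>Y\<close>, the number \<open>2 * \<epsilon> * Y\<close> is the critical order of differentiation:
  the Taylor terms on the disc of radius \<open>\<epsilon>\<close> decay geometrically up to it, and there they have reached
  the size of \<open>exp (- conj_weight s / \<rho>)\<close>.\<close>

lemma phi_star_le_low_order:
  assumes \<rho>: "\<rho> > 0" and \<epsilon>: "\<epsilon> > 0" and Y: "Y > 1" "\<And>t. t \<ge> 0 \<Longrightarrow> \<omega> t - 2 * \<rho> * \<epsilon> * t \<le> \<omega> Y - 2 * \<rho> * \<epsilon> * Y"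
    and k: "real k \<le> 2 * \<epsilon> * Y"
  shows "exp (phi_w_star \<omega> (\<rho> * real k) / \<rho>) * \<epsilon> ^ k \<le> fact k * (1/2) ^ k"
proof -
  define b where "b = ln (fact k) - real k * ln (2 * \<epsilon>)"
  \<comment> \<open>Up to \<open>Y\<close>, \<open>below_maximiser\<close> gives
    \<open>\<omega> y / \<rho> \<ge> 2 * \<epsilon> * y\<close>, and one term of the exponential
    series at \<open>2 * \<epsilon> * y\<close> produces the factorial.\<close>
  have low: "real k * ln y - \<omega> y / \<rho> \<le> b" if y: "1 \<le> y" "y \<le> Y" for y
  proof -
    have "2 * \<rho> * \<epsilon> * y \<le> \<omega> y" by (rule below_maximiser[of Y]) (use Y y in auto)
    then have "2 * \<epsilon> * y \<le> \<omega> y / \<rho>" using \<rho> by (simp add: field_simps)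
    moreover have "real k * ln (2 * \<epsilon> * y) - ln (fact k) \<le> 2 * \<epsilon> * y"
    proof -
      have "(2 * \<epsilon> * y) ^ k / fact k \<le> exp (2 * \<epsilon> * y)" by (rule power_div_fact_le_exp) (use \<epsilon> y in auto)
      then have "ln ((2 * \<epsilon> * y) ^ k / fact k) \<le> ln (exp (2 * \<epsilon> * y))"
        using \<epsilon> y by (subst ln_le_cancel_iff) auto
      then show ?thesis using \<epsilon> y by (simp add: ln_div ln_realpow)
    qed
    moreover have "ln (2 * \<epsilon> * y) = ln (2 * \<epsilon>) + ln y" using \<epsilon> y by (simp add: ln_mult)
    ultimately show ?thesis by (simp add: b_def algebra_simps)
  qed
  have "phi_w_star \<omega> (\<rho> * real k) / \<rho> \<le> b"
  proof (rule phi_star_le[OF \<rho>])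
    fix y :: real assume y: "y \<ge> 1"
    show "real k * ln y - \<omega> y / \<rho> \<le> b"
    proof (cases "y \<le> Y")
      \<comment> \<open>Beyond \<open>Y\<close> the tangent in \<open>ln y\<close> has slope
        \<open>2 * \<epsilon> * Y\<close>, at least \<open>k\<close>, so the expression does not
        exceed its value at \<open>Y\<close>.\<close>
      case False
      have "\<omega> Y + Y * (2 * \<rho> * \<epsilon>) * (ln y - ln Y) \<le> \<omega> y" by (rule log_tangent[OF Y y])
      then have "(\<omega> Y + Y * (2 * \<rho> * \<epsilon>) * (ln y - ln Y)) / \<rho> \<le> \<omega> y / \<rho>" using \<rho> by (intro divide_right_mono) auto
      then have "\<omega> Y / \<rho> + 2 * \<epsilon> * Y * (ln y - ln Y) \<le> \<omega> y / \<rho>" using \<rho> by (simp add: add_divide_distrib mult_ac)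
      moreover have "real k * (ln y - ln Y) \<le> 2 * \<epsilon> * Y * (ln y - ln Y)"
        using False Y(1) by (intro mult_right_mono k) auto
      ultimately show ?thesis using low[of Y] Y(1) by (simp add: algebra_simps)
    qed (use low y in auto)
  qed
  then have "exp (phi_w_star \<omega> (\<rho> * real k) / \<rho>) \<le> exp b" by simp
  also have "exp b = fact k / (2 * \<epsilon>) ^ k"
    unfolding b_def using \<epsilon> by (simp add: exp_diff exp_of_nat_mult)
  finally have "exp (phi_w_star \<omega> (\<rho> * real k) / \<rho>) * \<epsilon> ^ k \<le> fact k / (2 * \<epsilon>) ^ k * \<epsilon> ^ k"
    using \<epsilon> by (intro mult_right_mono) auto
  also have "\<dots> = fact k * (1/2) ^ k" using \<epsilon> by (simp add: power_mult_distrib power_divide)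
  finally show ?thesis .
qed

text \<open>\<open>n\<close> is the integer part of the tangent slope
  \<open>2 * \<epsilon> * Y\<close>; rounding costs at most a factor \<open>Y\<close>. Writing
  \<open>\<epsilon> ^ n\<close> as \<open>(2 * \<epsilon>) ^ n * (1/2) ^ n\<close> uses the first
  factor to reach \<open>exp (2 * \<epsilon> * Y)\<close>, which completes the conjugate, and the
  second to reduce \<open>Y\<close> to \<open>1 / (2 * \<epsilon>)\<close>, since
  \<open>2 ^ n \<ge> n + 1\<close>.\<close>

lemma phi_star_le_critical_order:
  assumes \<rho>: "\<rho> > 0" and \<epsilon>: "\<epsilon> > 0" and Y: "Y > 1" "\<And>t. t \<ge> 0 \<Longrightarrow> \<omega> t - 2 * \<rho> * \<epsilon> * t \<le> \<omega> Y - 2 * \<rho> * \<epsilon> * Y"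
    and n: "real n \<le> 2 * \<epsilon> * Y" "2 * \<epsilon> * Y < real n + 1"
  shows "exp (phi_w_star \<omega> (\<rho> * real n) / \<rho>) * \<epsilon> ^ n / fact n \<le> exp (- conj_weight (2 * \<rho> * \<epsilon>) / \<rho>) / (2 * \<epsilon>)"
proof -
  define b where "b = (real n + 1) * ln Y - \<omega> Y / \<rho>"
  have "phi_w_star \<omega> (\<rho> * real n) / \<rho> \<le> b"
  proof (rule phi_star_le[OF \<rho>])
    fix y :: real assume y: "y \<ge> 1"
    have "\<omega> Y + Y * (2 * \<rho> * \<epsilon>) * (ln y - ln Y) \<le> \<omega> y" by (rule log_tangent[OF Y y])
    then have "(\<omega> Y + Y * (2 * \<rho> * \<epsilon>) * (ln y - ln Y)) / \<rho> \<le> \<omega> y / \<rho>" using \<rho> by (intro divide_right_mono) auto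
    then have "\<omega> Y / \<rho> + 2 * \<epsilon> * Y * (ln y - ln Y) \<le> \<omega> y / \<rho>" using \<rho> by (simp add: add_divide_distrib mult_ac)
    moreover have "(2 * \<epsilon> * Y - real n) * (ln Y - ln y) \<le> ln Y"
    proof (cases "y \<le> Y")
      case True
      have "(2 * \<epsilon> * Y - real n) * (ln Y - ln y) \<le> 1 * (ln Y - ln y)"
        using True y n by (intro mult_right_mono) auto
      then show ?thesis by (rule order_trans) (use ln_ge_zero[OF y] in simp)
    next
      case False
      then have "(2 * \<epsilon> * Y - real n) * (ln Y - ln y) \<le> 0" using Y(1) n y by (intro mult_nonneg_nonpos) auto
      then show ?thesis using Y(1) ln_ge_zero[of Y] by linarith
    qed
    ultimately show "real n * ln y - \<omega> y / \<rho> \<le> b" unfolding b_def by (simp add: algebra_simps)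
  qed
  then have "exp (phi_w_star \<omega> (\<rho> * real n) / \<rho>) \<le> exp b" by simp
  also have "exp b = Y ^ (n + 1) * exp (- \<omega> Y / \<rho>)"
  proof -
    have "exp ((real n + 1) * ln Y) = Y ^ (n + 1)"
      using Y(1) exp_of_nat_mult[of "n + 1" "ln Y"] by (simp add: add.commute)
    then show ?thesis unfolding b_def by (simp add: exp_diff exp_minus divide_inverse)
  qed
  finally have "exp (phi_w_star \<omega> (\<rho> * real n) / \<rho>) * \<epsilon> ^ n / fact n \<le> Y ^ (n + 1) * exp (- \<omega> Y / \<rho>) * \<epsilon> ^ n / fact n"
    using \<epsilon> by (intro divide_right_mono mult_right_mono) auto
  also have "\<dots> = Y * ((2 * \<epsilon> * Y) ^ n / fact n) * (1/2) ^ n * exp (- \<omega> Y / \<rho>)"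
    using \<epsilon> by (simp add: power_mult_distrib power_divide)
  also have "\<dots> \<le> Y * exp (2 * \<epsilon> * Y) * (1/2) ^ n * exp (- \<omega> Y / \<rho>)"
    using power_div_fact_le_exp[of "2 * \<epsilon> * Y" n] \<epsilon> Y(1) by (intro mult_right_mono mult_left_mono) auto
  also have "\<dots> = (Y * (1/2) ^ n) * exp (- conj_weight (2 * \<rho> * \<epsilon>) / \<rho>)"
  proof -
    have "conj_weight (2 * \<rho> * \<epsilon>) = \<omega> Y - 2 * \<rho> * \<epsilon> * Y" by (rule conj_weight_eq) (use Y in auto)
    then have "- conj_weight (2 * \<rho> * \<epsilon>) / \<rho> = 2 * \<epsilon> * Y + - \<omega> Y / \<rho>" using \<rho> by (simp add: field_simps)
    then have "exp (- conj_weight (2 * \<rho> * \<epsilon>) / \<rho>) = exp (2 * \<epsilon> * Y) * exp (- \<omega> Y / \<rho>)"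
      by (simp only: exp_add)
    then show ?thesis by (simp only: mult_ac)
  qed
  also have "\<dots> \<le> (1 / (2 * \<epsilon>)) * exp (- conj_weight (2 * \<rho> * \<epsilon>) / \<rho>)"
  proof (rule mult_right_mono)
    have "real n + 1 \<le> 2 ^ n" using less_exp[of n] by (metis Suc_leI of_nat_Suc of_nat_le_iff of_nat_power of_nat_numeral add.commute)
    then have "2 * \<epsilon> * Y \<le> 2 ^ n" using n(2) by linarith
    then show "Y * (1/2) ^ n \<le> 1 / (2 * \<epsilon>)" using \<epsilon> by (simp add: field_simps power_divide)
  qed simp
  finally show ?thesis by simp
qed

text \<open>The approximant is the Taylor polynomial at \<open>x\<close> with terms below the
  critical order. The denominator is \<open>2 * \<rho>\<close> and not \<open>\<rho>\<close> because
  half of the exponent is spent on the factor \<open>1 / (2 * \<epsilon>)\<close> left by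
  \<open>phi_star_le_critical_order\<close>. The doubled radius keeps the segments from
  \<open>x\<close> to \<open>y\<close> in the domain.\<close>

theorem B_omega_imp_holo_approx:
  assumes \<rho>: "\<rho> > 0" and R: "R > 0" and f: "B_omega \<omega> \<rho> (ball 0 (2 * R)) f"
  shows "holo_approx (\<lambda>\<epsilon>. exp (- conj_weight (2 * \<rho> * \<epsilon>) / (2 * \<rho>))) R f"
proof -
  obtain D C0 where D: "derivs_on (ball 0 (2 * R)) f D"
    and C0: "\<And>x n. x \<in> ball 0 (2 * R) \<Longrightarrow> norm (D n x) * exp (- phi_w_star \<omega> (\<rho> * real n) / \<rho>) \<le> C0"
    using f unfolding B_omega_def by blast
  define C where "C = max C0 0"
  define M where "M = (\<lambda>n::nat. exp (phi_w_star \<omega> (\<rho> * real n) / \<rho>))"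
  have DM: "norm (D n x) \<le> C * M n" if "x \<in> ball 0 (2 * R)" for n x
  proof -
    have "norm (D n x) * exp (- phi_w_star \<omega> (\<rho> * real n) / \<rho>) \<le> C" using C0[OF that, of n] by (simp add: C_def)
    then have "norm (D n x) * exp (- phi_w_star \<omega> (\<rho> * real n) / \<rho>) * M n \<le> C * M n"
      by (rule mult_right_mono) (simp add: M_def)
    then show ?thesis by (simp add: M_def mult.assoc flip: exp_add)
  qed
  obtain s1 where s1: "s1 > 0" "\<And>s. 0 < s \<Longrightarrow> s \<le> s1 \<Longrightarrow> exp (- (1 / (2 * \<rho>)) * conj_weight s) \<le> s powr 1"
    using exp_conj_weight_le_powr[of "1 / (2 * \<rho>)" 1] \<rho> by auto
  obtain s2 where s2: "s2 > 0" "\<And>s. 0 < s \<Longrightarrow> s \<le> s2 \<Longrightarrow> 1 * ln (1 / s) \<le> conj_weight s"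
    using conj_weight_ge_ln[of 1] by auto
  \<comment> \<open>Here \<open>s1\<close> serves to absorb the factor
    \<open>1 / \<epsilon>\<close>, while \<open>s2\<close> and \<open>exp (- \<omega> 1)\<close>
    serve to force the maximiser above 1.\<close>
  define e where "e = min R (min s1 (min s2 (exp (- \<omega> 1))) / (2 * \<rho>))"
  have e: "e > 0" using R s1(1) s2(1) \<rho> by (simp add: e_def)
  define K where "K = 2 * C + C * \<rho>"
  have C: "C \<ge> 0" by (simp add: C_def)
  have "\<exists>F. disc_approx f K (exp (- conj_weight (2 * \<rho> * \<epsilon>) / (2 * \<rho>))) x \<epsilon> F"
    if x: "\<bar>x\<bar> < R" and \<epsilon>: "0 < \<epsilon>" "\<epsilon> < e" for x \<epsilon>
  proof -
    define \<sigma> where "\<sigma> = 2 * \<rho> * \<epsilon>"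
    have "\<epsilon> < min s1 (min s2 (exp (- \<omega> 1))) / (2 * \<rho>)" using \<epsilon> by (simp add: e_def)
    then have \<sigma>: "0 < \<sigma>" "\<sigma> \<le> s1" "\<sigma> \<le> s2" "\<sigma> < exp (- \<omega> 1)" and \<epsilon>R: "\<epsilon> < R"
      using \<epsilon> \<rho> by (auto simp: \<sigma>_def e_def field_simps)
    obtain Y where Y: "Y \<ge> 0" "\<And>t. t \<ge> 0 \<Longrightarrow> \<omega> t - \<sigma> * t \<le> \<omega> Y - \<sigma> * Y"
      using conj_weight_attained[OF \<sigma>(1)] by metis
    \<comment> \<open>\<open>log_tangent\<close> requires \<open>Y > 1\<close>. A maximiser in the
      unit interval would give \<open>conj_weight \<sigma> \<le> \<omega> 1\<close>, contradicting
      the lower bound \<open>ln (1 / \<sigma>)\<close>, which exceeds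
      \<open>\<omega> 1\<close>.\<close>
    have Y1: "Y > 1"
    proof (rule ccontr)
      assume "\<not> Y > 1"
      then have "\<omega> Y - \<sigma> * Y \<le> \<omega> 1" using mono[OF Y(1), of 1] Y(1) \<sigma>(1) mult_nonneg_nonneg[of \<sigma> Y] by linarith
      then have "conj_weight \<sigma> \<le> \<omega> 1" using conj_weight_eq[OF Y] by simp
      moreover have "ln \<sigma> < - \<omega> 1" using \<sigma> by (metis ln_exp ln_less_cancel_iff exp_gt_zero)
      ultimately show False using s2(2)[OF \<sigma>(1,3)] \<sigma>(1) by (simp add: ln_div)
    qed
    note Y' = Y(2)[unfolded \<sigma>_def]
    define n where "n = nat \<lfloor>2 * \<epsilon> * Y\<rfloor>"
    have n: "real n \<le> 2 * \<epsilon> * Y" "2 * \<epsilon> * Y < real n + 1"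
      using \<epsilon> Y1 by (auto simp: n_def)
    define F where "F = (\<lambda>z. \<Sum>k<n. D k x / fact k * (z - of_real x) ^ k)"
    have xb: "x \<in> ball 0 (2 * R)" using x R by (simp add: dist_norm)
    have "disc_approx f K (exp (- conj_weight \<sigma> / (2 * \<rho>))) x \<epsilon> F"
      unfolding disc_approx_def
    proof (intro conjI ballI allI impI)
      show "F holomorphic_on ball (of_real x) \<epsilon>" unfolding F_def by (intro holomorphic_intros)
      fix z :: complex assume "z \<in> ball (of_real x) \<epsilon>"
      then have z: "norm (z - of_real x) \<le> \<epsilon>" by (simp add: dist_norm norm_minus_commute)
      have "norm (F z) \<le> (\<Sum>k<n. C * (1/2) ^ k)"
        unfolding F_def
      proof (rule sum_norm_le)
        fix k assume "k \<in> {..<n}"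
        then have k: "real k \<le> 2 * \<epsilon> * Y" using n(1) by simp
        have "norm (D k x / fact k * (z - of_real x) ^ k) = norm (D k x) / fact k * norm (z - of_real x) ^ k"
          by (simp add: norm_mult norm_divide norm_power)
        also have "\<dots> \<le> (C * M k) / fact k * \<epsilon> ^ k"
          using DM[OF xb, of k] z \<epsilon> C by (intro mult_mono divide_right_mono power_mono) (auto simp: M_def)
        also have "\<dots> = C * (M k * \<epsilon> ^ k) / fact k" by simp
        also have "\<dots> \<le> C * (fact k * (1/2) ^ k) / fact k"
          using phi_star_le_low_order[OF \<rho> \<epsilon>(1) Y1 Y' k] C unfolding M_def
          by (intro divide_right_mono mult_left_mono) auto
        finally show "norm (D k x / fact k * (z - of_real x) ^ k) \<le> C * (1/2) ^ k" by simp
      qed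
      also have "\<dots> = C * (\<Sum>k<n. (1/2) ^ k)" by (simp add: sum_distrib_left)
      also have "(\<Sum>k<n. (1/2) ^ k) \<le> (2::real)"
        using sum_le_suminf[of "\<lambda>k. (1/2::real) ^ k" "{..<n}"] suminf_geometric[of "1/2::real"] by simp
      finally have "norm (F z) \<le> C * 2" using C by (simp add: mult_left_mono)
      then show "norm (F z) \<le> K" using C \<rho> unfolding K_def by (smt (verit) mult_nonneg_nonneg)
    next
      fix y assume y: "\<bar>y - x\<bar> < \<epsilon>"
      have seg: "closed_segment x y \<subseteq> ball 0 (2 * R)"
      proof (rule closed_segment_subset)
        show "y \<in> ball 0 (2 * R)" using x y \<epsilon>R by (simp add: dist_norm)
      qed (use xb in auto)
      have "norm (f y - F (of_real y)) \<le> (C * M n) * \<bar>y - x\<bar> ^ n / fact n"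
        unfolding F_def of_real_diff[symmetric]
        by (rule derivs_on_taylor_le[OF D seg]) (use DM seg in blast)
      also have "\<dots> \<le> (C * M n) * \<epsilon> ^ n / fact n"
        using y C by (intro divide_right_mono mult_left_mono power_mono) (auto simp: M_def)
      also have "\<dots> = C * (M n * \<epsilon> ^ n / fact n)" by simp
      also have "\<dots> \<le> C * (exp (- conj_weight \<sigma> / \<rho>) / (2 * \<epsilon>))"
        using phi_star_le_critical_order[OF \<rho> \<epsilon>(1) Y1 Y' n] C unfolding M_def \<sigma>_def by (intro mult_left_mono) auto
      \<comment> \<open>One of the two halves is at most
        \<open>\<sigma> = 2 * \<rho> * \<epsilon>\<close> and cancels the denominator
        \<open>2 * \<epsilon>\<close>.\<close>
      also have "exp (- conj_weight \<sigma> / \<rho>) = exp (- conj_weight \<sigma> / (2 * \<rho>)) * exp (- conj_weight \<sigma> / (2 * \<rho>))"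
        using \<rho> by (simp add: field_simps flip: exp_add)
      also have "C * (exp (- conj_weight \<sigma> / (2 * \<rho>)) * exp (- conj_weight \<sigma> / (2 * \<rho>)) / (2 * \<epsilon>))
         \<le> C * (\<sigma> * exp (- conj_weight \<sigma> / (2 * \<rho>)) / (2 * \<epsilon>))"
        using s1(2)[OF \<sigma>(1,2)] C \<epsilon> \<sigma>(1) by (intro mult_left_mono divide_right_mono mult_right_mono) auto
      also have "\<dots> = C * \<rho> * exp (- conj_weight \<sigma> / (2 * \<rho>))" using \<epsilon> by (simp add: \<sigma>_def)
      also have "\<dots> \<le> K * exp (- conj_weight \<sigma> / (2 * \<rho>))"
        using C by (intro mult_right_mono) (auto simp: K_def)
      finally show "norm (F (of_real y) - f y) \<le> K * exp (- conj_weight \<sigma> / (2 * \<rho>))"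
        by (simp add: norm_minus_commute)
    qed
    then show ?thesis unfolding \<sigma>_def by blast
  qed
  moreover have "K \<ge> 0" using C \<rho> by (simp add: K_def)
  ultimately show ?thesis unfolding holo_approx_def using e by blast
qed

text \<open>Evaluating \<open>conj_weight (B * \<epsilon>) \<ge> \<omega> y - B * \<epsilon> * y\<close> at \<open>y = (n + 1) / (\<tau> * B * \<epsilon>)\<close> turns the Cauchy factor
  \<open>fact n / \<epsilon> ^ n\<close> into a geometric factor times \<open>y ^ n\<close>; the geometric factor is absorbed by the doubling
  property of \<open>\<omega>\<close>.\<close>

theorem B_omega_of_consecutive_powers:
  assumes j: "j \<ge> 1"
  shows "\<exists>\<Lambda>>0. \<forall>f \<rho> R. \<rho> > 0 \<longrightarrow> R > 0 \<longrightarrow> B_omega \<omega> \<rho> (ball 0 (2 * R)) (\<lambda>x. f x ^ j) \<longrightarrow>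
     B_omega \<omega> \<rho> (ball 0 (2 * R)) (\<lambda>x. f x ^ (j + 1)) \<longrightarrow> B_omega \<omega> (\<Lambda> * \<rho>) (ball 0 R) f"
proof -
  define A :: real where "A = 32 ^ (j * j)"
  define k :: real where "k = (1/96) ^ (j * j)"
  have A: "A > 0" and k: "k > 0" by (simp_all add: A_def k_def)
  \<comment> \<open>The factor \<open>4 * k * A\<close> is the geometric factor from Cauchy's
    inequality, and \<open>exp 1\<close> accounts for the linear part of the conjugate at
    \<open>y\<close>; \<open>q\<close> doublings absorb both. Nothing here involves
    \<open>\<rho>\<close>, so \<open>H\<close> and \<open>\<Lambda>\<close> are fixed before
    \<open>f\<close>, \<open>\<rho>\<close> and \<open>R\<close>.\<close>
  obtain q where q: "4 * exp 1 * k * A < 2 ^ q" using real_arch_pow[of 2 "4 * exp 1 * k * A"] by auto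
  obtain H H' where H: "H \<ge> 1" "\<And>t. t \<ge> 0 \<Longrightarrow> \<omega> (2 ^ q * t) \<le> H * \<omega> t + H'" using doubling_power[of q] by blast
  define \<Lambda> where "\<Lambda> = 8 * H / k"
  have \<Lambda>: "\<Lambda> > 0" using H k by (simp add: \<Lambda>_def)
  have "B_omega \<omega> (\<Lambda> * \<rho>) (ball 0 R) f"
    if \<rho>: "\<rho> > 0" and R: "R > 0" and f1: "B_omega \<omega> \<rho> (ball 0 (2 * R)) (\<lambda>x. f x ^ j)"
      and f2: "B_omega \<omega> \<rho> (ball 0 (2 * R)) (\<lambda>x. f x ^ (j + 1))" for f \<rho> R
  proof -
    define \<delta> where "\<delta> = (\<lambda>\<epsilon>. exp (- conj_weight (2 * \<rho> * \<epsilon>) / (2 * \<rho>)))"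
    have \<delta>: "decay_gauge \<delta>"
      unfolding decay_gauge_def \<delta>_def using \<rho> conj_weight_nonneg
      by (auto intro!: divide_right_mono conj_weight_antimono)
    define \<delta>' where "\<delta>' = (\<lambda>\<epsilon>. \<delta> (A * \<epsilon>) powr k)"
    have \<delta>': "decay_gauge \<delta>'" unfolding \<delta>'_def by (rule decay_gauge_rescale[OF \<delta> A k])
    have approx: "holo_approx \<delta>' R f"
      unfolding \<delta>'_def A_def k_def
      by (rule holo_approx_of_consecutive_powers[OF \<delta> _ _ j])
         (unfold \<delta>_def, rule B_omega_imp_holo_approx[OF \<rho> R f1], rule B_omega_imp_holo_approx[OF \<rho> R f2])
    \<comment> \<open>\<open>\<rho>\<close> cancels in \<open>\<tau> * B = k * A / 4\<close>, which
      is what makes the geometric factor independent of \<open>\<rho>\<close>; and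
      \<open>\<Lambda>\<close> was chosen to give
      \<open>1 / (\<Lambda> * \<rho>) = \<tau> / H\<close>.\<close>
    define \<tau> where "\<tau> = k / (8 * \<rho>)"
    define B where "B = 2 * \<rho> * A"
    have \<tau>: "\<tau> > 0" and B: "B > 0" using \<rho> k A by (simp_all add: \<tau>_def B_def)
    \<comment> \<open>The decay is split into two equal factors: one pays for
      \<open>\<epsilon>\<^sup>2\<close>, the other is tested at \<open>y\<close>.\<close>
    have sq: "sqrt (\<delta>' \<epsilon>) = exp (- \<tau> * conj_weight (B * \<epsilon>)) * exp (- \<tau> * conj_weight (B * \<epsilon>))" for \<epsilon>
    proof -
      have "sqrt (\<delta>' \<epsilon>) = exp (- (k / (4 * \<rho>)) * conj_weight (B * \<epsilon>))"
        unfolding \<delta>'_def \<delta>_def B_def by (simp add: powr_def powr_half_sqrt[symmetric] mult_ac)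
      then show ?thesis by (simp add: \<tau>_def field_simps flip: exp_add)
    qed
    obtain s0 where s0: "s0 > 0" "\<And>s. 0 < s \<Longrightarrow> s \<le> s0 \<Longrightarrow> exp (- \<tau> * conj_weight s) \<le> s powr 2"
      using exp_conj_weight_le_powr[of \<tau> 2] \<tau> by auto
    \<comment> \<open>The first bound makes the power estimate of \<open>s0\<close> applicable, the
      second ensures \<open>y \<ge> 1\<close>, the range on which \<open>phi_w_star\<close> is
      tested.\<close>
    define e0 where "e0 = min (s0 / B) (1 / (\<tau> * B))"
    have e0: "e0 > 0" using s0 B \<tau> by (simp add: e0_def)
    have \<Lambda>\<rho>: "1 / (\<Lambda> * \<rho>) = \<tau> / H" using k \<rho> H by (simp add: \<Lambda>_def \<tau>_def field_simps)
    define c where "c = (\<lambda>n::nat. B\<^sup>2 * exp (1 + \<tau> * H' / H) * exp (phi_w_star \<omega> (\<Lambda> * \<rho> * real n) / (\<Lambda> * \<rho>)))"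
    have c: "fact n * (16 / \<epsilon>) ^ n * sqrt (\<delta>' \<epsilon>) \<le> c n * \<epsilon>\<^sup>2" if \<epsilon>: "0 < \<epsilon>" "\<epsilon> \<le> e0" for n \<epsilon>
    proof -
      define y where "y = (real n + 1) / (\<tau> * B * \<epsilon>)"
      have y1: "y \<ge> 1"
      proof -
        have "\<epsilon> \<le> 1 / (\<tau> * B)" using \<epsilon> by (simp add: e0_def)
        then have "\<tau> * B * \<epsilon> \<le> 1" using \<tau> B by (simp add: field_simps)
        then show ?thesis using \<tau> B \<epsilon> by (simp add: y_def le_divide_eq)
      qed
      have y\<epsilon>: "1 / \<epsilon> = \<tau> * B * y / (real n + 1)" and yB: "\<tau> * (B * \<epsilon>) * y = real n + 1"
      proof -
        have "real n + 1 \<noteq> 0" by linarith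
        then show "1 / \<epsilon> = \<tau> * B * y / (real n + 1)" using \<tau> B \<epsilon> by (simp add: y_def)
        show "\<tau> * (B * \<epsilon>) * y = real n + 1" using \<tau> B \<epsilon> by (simp add: y_def)
      qed
      have a: "exp (- \<tau> * conj_weight (B * \<epsilon>)) \<le> B\<^sup>2 * \<epsilon>\<^sup>2"
      proof -
        have "B * \<epsilon> \<le> s0" using \<epsilon> B by (simp add: e0_def field_simps)
        from s0(2)[OF _ this] B \<epsilon> show ?thesis by (simp add: power_mult_distrib)
      qed
      have b: "exp (- \<tau> * conj_weight (B * \<epsilon>)) \<le> exp (real n + 1 - \<tau> * \<omega> y)"
      proof -
        have "\<omega> y - (B * \<epsilon>) * y \<le> conj_weight (B * \<epsilon>)" using B \<epsilon> y1 by (intro conj_weight_ge) auto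
        then have "\<tau> * (\<omega> y - (B * \<epsilon>) * y) \<le> \<tau> * conj_weight (B * \<epsilon>)" using \<tau> by (intro mult_left_mono) auto
        then show ?thesis using yB by (simp add: algebra_simps)
      qed
      have f: "fact n * (16 / \<epsilon>) ^ n \<le> (4 * k * A * y) ^ n"
      proof -
        have "fact n \<le> real (n ^ n)" by (rule fact_le_power)
        also have "\<dots> \<le> (real n + 1) ^ n" unfolding of_nat_power by (rule power_mono) auto
        finally have "fact n \<le> (real n + 1) ^ n" .
        then have "fact n * (16 / \<epsilon>) ^ n \<le> (real n + 1) ^ n * (16 / \<epsilon>) ^ n"
          using \<epsilon> by (intro mult_right_mono) auto
        also have "\<dots> = ((real n + 1) * (16 * (1 / \<epsilon>))) ^ n"
          by (simp only: power_mult_distrib[symmetric] times_divide_eq_right mult_1_right)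
        also have "(real n + 1) * (16 * (1 / \<epsilon>)) = 16 * (\<tau> * B) * y" unfolding y\<epsilon> by simp
        also have "16 * (\<tau> * B) * y = 4 * k * A * y" using \<rho> by (simp add: \<tau>_def B_def)
        finally show ?thesis .
      qed
      have g: "(4 * k * A * y) ^ n * exp (real n - \<tau> * \<omega> y) \<le> exp (\<tau> * H' / H) * exp (phi_w_star \<omega> (\<Lambda> * \<rho> * real n) / (\<Lambda> * \<rho>))"
      proof -
        define x where "x = 2 ^ q * y"
        have "(1::real) \<le> 2 ^ q" by simp
        then have x1: "x \<ge> 1" using y1 mult_mono[of 1 "2 ^ q" 1 y] by (simp add: x_def)
        have "(4 * k * A * y) ^ n * exp (real n) = (4 * exp 1 * k * A * y) ^ n"
          by (simp add: power_mult_distrib mult_ac flip: exp_of_nat_mult)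
        also have "\<dots> \<le> x ^ n"
          unfolding x_def using q y1 k A by (intro power_mono mult_right_mono) auto
        also have "x ^ n = exp (real n * ln x)" using x1 by (simp add: exp_of_nat_mult)
        finally have 1: "(4 * k * A * y) ^ n * exp (real n) \<le> exp (real n * ln x)" .
        have "\<omega> x \<le> H * \<omega> y + H'" unfolding x_def using y1 by (intro H(2)) simp
        then have "\<tau> / H * \<omega> x \<le> \<tau> / H * (H * \<omega> y + H')" using \<tau> H by (intro mult_left_mono) auto
        then have 2: "- \<tau> * \<omega> y \<le> \<tau> * H' / H - \<omega> x / (\<Lambda> * \<rho>)"
        proof -
          have "\<omega> x / (\<Lambda> * \<rho>) = \<omega> x * (1 / (\<Lambda> * \<rho>))" by simp
          then have "\<omega> x / (\<Lambda> * \<rho>) = \<tau> / H * \<omega> x" unfolding \<Lambda>\<rho> by simp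
          moreover have "\<tau> / H * (H * \<omega> y + H') = \<tau> * \<omega> y + \<tau> * H' / H" using H(1) by (simp add: distrib_left)
          ultimately show ?thesis using \<open>\<tau> / H * \<omega> x \<le> _\<close> by simp
        qed
        have "(4 * k * A * y) ^ n * exp (real n - \<tau> * \<omega> y) = ((4 * k * A * y) ^ n * exp (real n)) * exp (- \<tau> * \<omega> y)"
          by (simp add: exp_diff exp_minus divide_inverse)
        also have "\<dots> \<le> exp (real n * ln x) * exp (\<tau> * H' / H - \<omega> x / (\<Lambda> * \<rho>))"
          using 1 2 by (intro mult_mono) auto
        also have "\<dots> = exp (\<tau> * H' / H) * exp (real n * ln x - \<omega> x / (\<Lambda> * \<rho>))"
          by (simp flip: exp_add)
        also have "\<dots> \<le> exp (\<tau> * H' / H) * exp (phi_w_star \<omega> (\<Lambda> * \<rho> * real n) / (\<Lambda> * \<rho>))"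
          using phi_star_ge[of "\<Lambda> * \<rho>" x n] \<Lambda> \<rho> x1 by (intro mult_left_mono) auto
        finally show ?thesis .
      qed
      have "fact n * (16 / \<epsilon>) ^ n * sqrt (\<delta>' \<epsilon>) \<le> (4 * k * A * y) ^ n * ((B\<^sup>2 * \<epsilon>\<^sup>2) * exp (real n + 1 - \<tau> * \<omega> y))"
        unfolding sq using f a b k A y1 \<epsilon> by (intro mult_mono) auto
      also have "\<dots> = (B\<^sup>2 * \<epsilon>\<^sup>2 * exp 1) * ((4 * k * A * y) ^ n * exp (real n - \<tau> * \<omega> y))"
        by (simp add: mult_ac flip: exp_add)
      also have "\<dots> \<le> (B\<^sup>2 * \<epsilon>\<^sup>2 * exp 1) * (exp (\<tau> * H' / H) * exp (phi_w_star \<omega> (\<Lambda> * \<rho> * real n) / (\<Lambda> * \<rho>)))"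
        by (intro mult_left_mono g) simp
      also have "\<dots> = c n * \<epsilon>\<^sup>2" by (simp add: c_def exp_add)
      finally show ?thesis .
    qed
    obtain D C where D: "derivs_on (ball 0 R) f D" and DC: "\<And>x n. x \<in> ball 0 R \<Longrightarrow> norm (D n x) \<le> C * c n"
      using holo_approx_imp_derivs[OF \<delta>' approx e0 c] by blast
    have "norm (D n x) * exp (- phi_w_star \<omega> (\<Lambda> * \<rho> * real n) / (\<Lambda> * \<rho>)) \<le> C * (B\<^sup>2 * exp (1 + \<tau> * H' / H))"
      if "x \<in> ball 0 R" for x n
    proof -
      have "norm (D n x) * exp (- phi_w_star \<omega> (\<Lambda> * \<rho> * real n) / (\<Lambda> * \<rho>))
          \<le> C * c n * exp (- phi_w_star \<omega> (\<Lambda> * \<rho> * real n) / (\<Lambda> * \<rho>))"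
        by (intro mult_right_mono DC[OF that]) simp
      also have "\<dots> = C * (B\<^sup>2 * exp (1 + \<tau> * H' / H))" by (simp add: c_def mult.assoc flip: exp_add)
      finally show ?thesis .
    qed
    with D show ?thesis unfolding B_omega_def by blast
  qed
  with \<Lambda> show ?thesis by blast
qed

end

section \<open>From estimates on balls to germs\<close>

lemma B_omega_imp_smooth: "B_omega \<omega> \<rho> U f \<Longrightarrow> smooth_on U f"
  unfolding B_omega_def smooth_on_def by blast

lemma rel_compact_open_in_ball: "0 < s \<Longrightarrow> s < r \<Longrightarrow> rel_compact_open_in (ball (0::real) s) (ball 0 r)"
  by (auto simp: rel_compact_open_in_def)

theorem theorem3p1:
  fixes \<omega> :: "real \<Rightarrow> real"
  assumes "weight_function \<omega>"
    and "concave_on {0..} \<omega>"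
  shows "property_D (germ_Roumieu \<omega>) \<and> property_D (germ_Beurling \<omega>)"
proof -
  interpret concave_weight \<omega> by unfold_locales (fact assms)+
  have radius: "\<exists>R>0. rel_compact_open_in (ball 0 (2 * R)) (ball (0::real) r1) \<and> rel_compact_open_in (ball 0 (2 * R)) (ball (0::real) r2)"
    if "r1 > 0" "r2 > 0" for r1 r2
    using that by (intro exI[of _ "min r1 r2 / 4"] conjI rel_compact_open_in_ball) auto
  have "germ_Roumieu \<omega> f" if j: "j \<ge> 1" and f1: "germ_Roumieu \<omega> (\<lambda>x. f x ^ j)" and f2: "germ_Roumieu \<omega> (\<lambda>x. f x ^ (j + 1))" for f j
  proof -
    obtain \<Lambda> where \<Lambda>: "\<Lambda> > 0" "\<And>f \<rho> R. \<rho> > 0 \<Longrightarrow> R > 0 \<Longrightarrow> B_omega \<omega> \<rho> (ball 0 (2 * R)) (\<lambda>x. f x ^ j) \<Longrightarrow>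
       B_omega \<omega> \<rho> (ball 0 (2 * R)) (\<lambda>x. f x ^ (j + 1)) \<Longrightarrow> B_omega \<omega> (\<Lambda> * \<rho>) (ball 0 R) f"
      using B_omega_of_consecutive_powers[OF j] by blast
    obtain r1 r2 where r: "r1 > 0" "r2 > 0" and E1: "E_Roumieu \<omega> (ball 0 r1) (\<lambda>x. f x ^ j)" and E2: "E_Roumieu \<omega> (ball 0 r2) (\<lambda>x. f x ^ (j + 1))"
      using f1 f2 unfolding germ_Roumieu_def by blast
    obtain R where R: "R > 0" "rel_compact_open_in (ball 0 (2 * R)) (ball (0::real) r1)" "rel_compact_open_in (ball 0 (2 * R)) (ball (0::real) r2)"
      using radius[OF r] by blast
    obtain n1 n2 :: nat where n: "n1 \<ge> 1" "n2 \<ge> 1" and B1: "B_omega \<omega> (real n1) (ball 0 (2 * R)) (\<lambda>x. f x ^ j)"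
      and B2: "B_omega \<omega> (real n2) (ball 0 (2 * R)) (\<lambda>x. f x ^ (j + 1))"
      using E1 E2 R unfolding E_Roumieu_def by metis
    define \<rho> where "\<rho> = real (max n1 n2)"
    have \<rho>: "\<rho> > 0" using n by (simp add: \<rho>_def)
    have B: "B_omega \<omega> (\<Lambda> * \<rho>) (ball 0 R) f"
    proof (rule \<Lambda>(2)[OF \<rho> R(1)])
      show "B_omega \<omega> \<rho> (ball 0 (2 * R)) (\<lambda>x. f x ^ j)"
        by (rule B_omega_mono[OF B1]) (use n in \<open>auto simp: \<rho>_def\<close>)
      show "B_omega \<omega> \<rho> (ball 0 (2 * R)) (\<lambda>x. f x ^ (j + 1))"
        by (rule B_omega_mono[OF B2]) (use n in \<open>auto simp: \<rho>_def\<close>)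
    qed
    obtain m :: nat where m: "\<Lambda> * \<rho> \<le> real m" using real_arch_simple by blast
    have "0 < \<Lambda> * \<rho>" using \<Lambda> \<rho> by simp
    then have "m \<ge> 1" using m by (cases m) auto
    moreover have "B_omega \<omega> (real m) V f" if "V \<subseteq> ball 0 R" for V
      by (rule B_omega_mono[OF B _ m that]) (use \<Lambda> \<rho> in simp)
    ultimately have "E_Roumieu \<omega> (ball 0 R) f"
      unfolding E_Roumieu_def using B_omega_imp_smooth[OF B] by (auto simp: rel_compact_open_in_def)
    then show ?thesis unfolding germ_Roumieu_def using R(1) by blast
  qed
  moreover have "germ_Beurling \<omega> f" if j: "j \<ge> 1" and f1: "germ_Beurling \<omega> (\<lambda>x. f x ^ j)" and f2: "germ_Beurling \<omega> (\<lambda>x. f x ^ (j + 1))" for f j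
  proof -
    obtain \<Lambda> where \<Lambda>: "\<Lambda> > 0" "\<And>f \<rho> R. \<rho> > 0 \<Longrightarrow> R > 0 \<Longrightarrow> B_omega \<omega> \<rho> (ball 0 (2 * R)) (\<lambda>x. f x ^ j) \<Longrightarrow>
       B_omega \<omega> \<rho> (ball 0 (2 * R)) (\<lambda>x. f x ^ (j + 1)) \<Longrightarrow> B_omega \<omega> (\<Lambda> * \<rho>) (ball 0 R) f"
      using B_omega_of_consecutive_powers[OF j] by blast
    obtain r1 r2 where r: "r1 > 0" "r2 > 0" and E1: "E_Beurling \<omega> (ball 0 r1) (\<lambda>x. f x ^ j)" and E2: "E_Beurling \<omega> (ball 0 r2) (\<lambda>x. f x ^ (j + 1))"
      using f1 f2 unfolding germ_Beurling_def by blast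
    obtain R where R: "R > 0" "rel_compact_open_in (ball 0 (2 * R)) (ball (0::real) r1)" "rel_compact_open_in (ball 0 (2 * R)) (ball (0::real) r2)"
      using radius[OF r] by blast
    have B: "B_omega \<omega> (1 / real n) V f" if n: "n \<ge> 1" and V: "V \<subseteq> ball 0 R" for n V
    proof -
      \<comment> \<open>The target parameter \<open>1 / n\<close> is reached from
        \<open>1 / m\<close> with \<open>m\<close> at least \<open>\<Lambda> * n\<close>; the powers
        satisfy the bounds for every \<open>m\<close> on one ball, so the radius \<open>R\<close>
        does not shrink with \<open>n\<close>.\<close>
      obtain m :: nat where m: "\<Lambda> * real n \<le> real m" using real_arch_simple by blast
      have "0 < \<Lambda> * real n" using \<Lambda> n by simp
      then have m1: "m \<ge> 1" using m by (cases m) auto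
      have "B_omega \<omega> (1 / real m) (ball 0 (2 * R)) (\<lambda>x. f x ^ j)" "B_omega \<omega> (1 / real m) (ball 0 (2 * R)) (\<lambda>x. f x ^ (j + 1))"
        using E1 E2 R m1 unfolding E_Beurling_def by blast+
      then have "B_omega \<omega> (\<Lambda> * (1 / real m)) (ball 0 R) f"
        using m1 R(1) by (intro \<Lambda>(2)) auto
      then show ?thesis
        by (rule B_omega_mono) (use \<Lambda> n m m1 V in \<open>auto simp: field_simps\<close>)
    qed
    have "E_Beurling \<omega> (ball 0 R) f"
      unfolding E_Beurling_def using B B_omega_imp_smooth[OF B[of 1 "ball 0 R"]] by (auto simp: rel_compact_open_in_def)
    then show ?thesis unfolding germ_Beurling_def using R(1) by blast
  qed
  ultimately show ?thesis unfolding property_D_def by blast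
qed

end
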